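(* Let $d\geq 1$ and let $g(t)=\zeta_0+\zeta_1\binom{t}{1}+\cdots+\zeta_d\binom{t}{d}$ be the random $p$-adic polynomial where $\zeta_0,\ldots,\zeta_d$ are independent random variables uniformly distributed in $\mathbb{Z}_p$. (1) The expected number of zeroes of $g$ in $\mathbb{Z}_p$ equals $\dfrac{p^{\lfloor\log_p d\rfloor}}{1+p^{-1}}$. (2) For every $m\geq 1$ the expected number of zeroes of $g$ in the annulus $\frac{1}{p^m}\mathbb{Z}_p\setminus\frac{1}{p^{m-1}}\mathbb{Z}_p$ equals $\dfrac{|d|_p}{p^m}\cdot\dfrac{1-p^{-1}}{1+p^{-1}}$, and in particular the expected number of zeroes of $g$ in $\mathbb{Q}_p$ is $$\mathbb{E}\#\{g=0\}=\frac{p^{\lfloor \log_p d\rfloor}}{1+p^{-1}}+\sum_{m\geq 1}\frac{|d|_p}{p^m}\frac{1-p^{-1}}{1+p^{-1}}=\frac{p^{\lfloor \log_p d\rfloor}+|d|_p\,p^{-1}}{1+p^{-1}}.$$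
   Context: $p$ is a prime, $|\cdot|_p$ is the $p$-adic absolute value on $\mathbb{Q}_p$ with $|p|_p=p^{-1}$, and $\binom{t}{k}=\frac{t(t-1)\cdots(t-k+1)}{k!}\in\mathbb{Q}_p[t]$. "Uniformly distributed in $\mathbb{Z}_p$" means distributed according to the Haar probability measure on $\mathbb{Z}_p$. *)

theory Defs
  imports
    "HOL-Probability.Probability"
    "HOL-Computational_Algebra.Computational_Algebra"
    "Berlekamp_Zassenhaus.Finite_Field"
begin

section \<open>The \<open>p\<close>-adic absolute value on the rationals\<close>

definition padic_abs :: "nat \<Rightarrow> rat \<Rightarrow> real" where
  "padic_abs p r = (if r = 0 then 0 else
     real p powi (int (multiplicity (int p) (snd (quotient_of r)))
                - int (multiplicity (int p) (fst (quotient_of r)))))"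

lemma padic_abs_0 [simp]: "padic_abs p 0 = 0"
  by (simp add: padic_abs_def)

context
  fixes p :: nat
  assumes p: "prime p"
begin

lemma padic_abs_frac:
  assumes "a \<noteq> 0" "b \<noteq> 0"
  shows "padic_abs p (of_int a / of_int b)
    = real p powi (int (multiplicity (int p) b) - int (multiplicity (int p) a))"
proof -
  define r where "r = (of_int a / of_int b :: rat)"
  obtain c e where ce: "quotient_of r = (c, e)" by (cases "quotient_of r")
  have e: "e > 0" using ce by (rule quotient_of_denom_pos)
  have r: "r = of_int c / of_int e" using ce by (rule quotient_of_div)
  have r0: "r \<noteq> 0" using assms by (simp add: r_def)
  hence c: "c \<noteq> 0" using r by auto
  have "(of_int (a * e) :: rat) = of_int (c * b)"
    using assms e r unfolding r_def by (simp add: field_simps)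
  hence eq: "a * e = c * b" by (simp only: of_int_eq_iff)
  have pe: "prime_elem (int p)" using p by simp
  have "multiplicity (int p) a + multiplicity (int p) e = multiplicity (int p) c + multiplicity (int p) b"
    using prime_elem_multiplicity_mult_distrib[OF pe assms(1), of e]
      prime_elem_multiplicity_mult_distrib[OF pe c assms(2)] eq e by simp
  hence "int (multiplicity (int p) e) - int (multiplicity (int p) c)
    = int (multiplicity (int p) b) - int (multiplicity (int p) a)" by linarith
  thus ?thesis using r0 ce unfolding padic_abs_def r_def[symmetric] by simp
qed

lemma rat_fracE:
  fixes r :: rat
  assumes "r \<noteq> 0"
  obtains a b :: int where "r = of_int a / of_int b" "a \<noteq> 0" "b \<noteq> 0"
proof -
  obtain c e where ce: "quotient_of r = (c, e)" by (cases "quotient_of r")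
  have "e > 0" using ce by (rule quotient_of_denom_pos)
  moreover have "r = of_int c / of_int e" using ce by (rule quotient_of_div)
  ultimately show ?thesis using that[of c e] assms by auto
qed

lemma real_p_pos [simp]: "0 < real p"
  using p prime_gt_0_nat by simp

lemma padic_abs_nonneg [simp]: "padic_abs p r \<ge> 0"
  by (simp add: padic_abs_def)

lemma padic_abs_eq_0_iff [simp]: "padic_abs p r = 0 \<longleftrightarrow> r = 0"
  using real_p_pos by (auto simp add: padic_abs_def simp del: real_p_pos)

lemma padic_abs_1 [simp]: "padic_abs p 1 = 1"
  using padic_abs_frac[of 1 1] by simp

lemma padic_abs_mult: "padic_abs p (r * s) = padic_abs p r * padic_abs p s"
proof (cases "r = 0 \<or> s = 0")
  case False
  obtain a b where r: "r = of_int a / of_int b" "a \<noteq> 0" "b \<noteq> 0" using False rat_fracE by metis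
  obtain c e where s: "s = of_int c / of_int e" "c \<noteq> 0" "e \<noteq> 0" using False rat_fracE by metis
  have rs: "r * s = of_int (a * c) / of_int (b * e)" using r s by simp
  have pe: "prime_elem (int p)" using p by simp
  have "padic_abs p (r * s) = real p powi
     ((int (multiplicity (int p) b) - int (multiplicity (int p) a))
    + (int (multiplicity (int p) e) - int (multiplicity (int p) c)))"
    unfolding rs using r s
    by (subst padic_abs_frac) (simp_all add: prime_elem_multiplicity_mult_distrib[OF pe] algebra_simps)
  also have "\<dots> = padic_abs p r * padic_abs p s"
    unfolding r(1) s(1) using r s real_p_pos
    by (subst power_int_add) (simp_all add: padic_abs_frac del: real_p_pos)
  finally show ?thesis .
qed auto

lemma padic_abs_minus [simp]: "padic_abs p (- r) = padic_abs p r"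
proof -
  have "padic_abs p (-1) * padic_abs p (-1) = 1"
    using padic_abs_mult[of "-1" "-1"] by simp
  hence "padic_abs p (-1) = 1"
    using padic_abs_nonneg[of "-1"] by (simp add: power2_eq_1_iff flip: power2_eq_square)
  thus ?thesis using padic_abs_mult[of "-1" r] by simp
qed

lemma padic_abs_diff_commute: "padic_abs p (r - s) = padic_abs p (s - r)"
  using padic_abs_minus[of "r - s"] by simp

lemma padic_abs_inverse: "padic_abs p (inverse r) = inverse (padic_abs p r)"
proof (cases "r = 0")
  case False
  hence "padic_abs p r * padic_abs p (inverse r) = 1" by (simp flip: padic_abs_mult)
  thus ?thesis using inverse_unique by metis
qed simp

lemma padic_abs_of_int:
  "a \<noteq> 0 \<Longrightarrow> padic_abs p (of_int a) = real p powi (- int (multiplicity (int p) a))"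
  using padic_abs_frac[of a 1] by simp

lemma padic_abs_add_of_int:
  "padic_abs p (of_int a + of_int b) \<le> max (padic_abs p (of_int a)) (padic_abs p (of_int b))"
proof (cases "a = 0 \<or> b = 0 \<or> a + b = 0")
  case True
  hence "a = 0 \<or> b = 0 \<or> (of_int a + of_int b :: rat) = 0"
    by (metis of_int_0 of_int_add)
  thus ?thesis by (auto simp: le_max_iff_disj)
next
  case False
  define k where "k = min (multiplicity (int p) a) (multiplicity (int p) b)"
  have "int p ^ k dvd a" "int p ^ k dvd b" unfolding k_def by (auto intro: multiplicity_dvd')
  hence "int p ^ k dvd a + b" by simp
  hence k: "k \<le> multiplicity (int p) (a + b)"
    using False p by (subst (asm) power_dvd_iff_le_multiplicity) auto
  have "padic_abs p (of_int (a + b)) = real p powi (- int (multiplicity (int p) (a + b)))"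
    using False by (subst padic_abs_of_int) auto
  also have "\<dots> \<le> real p powi (- int k)"
    using k prime_ge_1_nat[OF p] by (intro power_int_increasing) auto
  also have "\<dots> \<le> max (padic_abs p (of_int a)) (padic_abs p (of_int b))"
    using False by (auto simp: padic_abs_of_int k_def min_def)
  finally show ?thesis by simp
qed

lemma padic_abs_ultra: "padic_abs p (r + s) \<le> max (padic_abs p r) (padic_abs p s)"
proof (cases "r = 0 \<or> s = 0")
  case False
  obtain a b where r: "r = of_int a / of_int b" "a \<noteq> 0" "b \<noteq> 0" using False rat_fracE by metis
  obtain c e where s: "s = of_int c / of_int e" "c \<noteq> 0" "e \<noteq> 0" using False rat_fracE by metis
  define q where "q = (inverse (of_int (b * e)) :: rat)"
  have eq: "r = of_int (a * e) * q" "s = of_int (c * b) * q"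
    "r + s = (of_int (a * e) + of_int (c * b)) * q"
    using r s by (auto simp: q_def field_simps)
  have "padic_abs p (r + s) = padic_abs p (of_int (a * e) + of_int (c * b)) * padic_abs p q"
    unfolding eq(3) by (rule padic_abs_mult)
  also have "\<dots> \<le> max (padic_abs p (of_int (a * e))) (padic_abs p (of_int (c * b))) * padic_abs p q"
    by (intro mult_right_mono padic_abs_add_of_int) auto
  also have "\<dots> = max (padic_abs p r) (padic_abs p s)"
    by (simp only: eq(1,2) padic_abs_mult max_mult_distrib_right padic_abs_nonneg if_True)
  finally show ?thesis .
qed (auto simp: le_max_iff_disj)

lemma padic_abs_triangle: "padic_abs p (r + s) \<le> padic_abs p r + padic_abs p s"
  using padic_abs_ultra[of r s] padic_abs_nonneg[of r] padic_abs_nonneg[of s] by linarith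

lemma padic_abs_triangle_diff: "padic_abs p (r - s) \<le> padic_abs p r + padic_abs p s"
  using padic_abs_triangle[of r "- s"] by simp

lemma padic_abs_triangle3: "\<bar>padic_abs p r - padic_abs p s\<bar> \<le> padic_abs p (r - s)"
  using padic_abs_triangle[of "r - s" s] padic_abs_triangle[of "s - r" r]
  by (simp add: padic_abs_diff_commute abs_le_iff)

end


section \<open>The field of \<open>p\<close>-adic numbers\<close>

definition padic_vanishes :: "nat \<Rightarrow> (nat \<Rightarrow> rat) \<Rightarrow> bool" where
  "padic_vanishes p X \<longleftrightarrow> (\<lambda>n. padic_abs p (X n)) \<longlonglongrightarrow> 0"

definition padic_cauchy :: "nat \<Rightarrow> (nat \<Rightarrow> rat) \<Rightarrow> bool" where
  "padic_cauchy p X \<longleftrightarrow> (\<forall>e>0. \<exists>N. \<forall>m\<ge>N. \<forall>n\<ge>N. padic_abs p (X m - X n) < e)"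

definition padic_rel :: "nat \<Rightarrow> (nat \<Rightarrow> rat) \<Rightarrow> (nat \<Rightarrow> rat) \<Rightarrow> bool" where
  "padic_rel p X Y \<longleftrightarrow> padic_cauchy p X \<and> padic_cauchy p Y \<and> padic_vanishes p (\<lambda>n. X n - Y n)"

context
  fixes p :: nat
  assumes p: "prime p"
begin

lemma padic_vanishes_minus: "padic_vanishes p X \<Longrightarrow> padic_vanishes p (\<lambda>n. - X n)"
  by (simp add: padic_vanishes_def padic_abs_minus[OF p])

lemma padic_vanishes_add:
  assumes "padic_vanishes p X" "padic_vanishes p Y"
  shows "padic_vanishes p (\<lambda>n. X n + Y n)"
  unfolding padic_vanishes_def
proof (rule tendsto_sandwich[OF _ _ tendsto_const])
  show "(\<lambda>n. padic_abs p (X n) + padic_abs p (Y n)) \<longlonglongrightarrow> 0"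
    using tendsto_add[OF assms[unfolded padic_vanishes_def]] by simp
qed (auto simp: padic_abs_triangle[OF p] padic_abs_nonneg[OF p])

lemma padic_vanishes_diff:
  "padic_vanishes p X \<Longrightarrow> padic_vanishes p Y \<Longrightarrow> padic_vanishes p (\<lambda>n. X n - Y n)"
  using padic_vanishes_add[of X "\<lambda>n. - Y n"] padic_vanishes_minus[of Y] by simp

lemma padic_cauchy_const: "padic_cauchy p (\<lambda>n. c)"
  by (simp add: padic_cauchy_def)

lemma padic_cauchy_add:
  assumes "padic_cauchy p X" "padic_cauchy p Y"
  shows "padic_cauchy p (\<lambda>n. X n + Y n)"
  unfolding padic_cauchy_def
proof (intro allI impI)
  fix e :: real assume e: "e > 0"
  obtain M where M: "\<forall>m\<ge>M. \<forall>n\<ge>M. padic_abs p (X m - X n) < e" using assms e by (metis padic_cauchy_def)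
  obtain N where N: "\<forall>m\<ge>N. \<forall>n\<ge>N. padic_abs p (Y m - Y n) < e" using assms e by (metis padic_cauchy_def)
  have "padic_abs p (X m + Y m - (X n + Y n)) < e" if "m \<ge> max M N" "n \<ge> max M N" for m n
  proof -
    have "padic_abs p ((X m - X n) + (Y m - Y n)) \<le> max (padic_abs p (X m - X n)) (padic_abs p (Y m - Y n))"
      by (rule padic_abs_ultra[OF p])
    also have "\<dots> < e" using that M N by simp
    finally show ?thesis by (simp add: algebra_simps)
  qed
  thus "\<exists>N. \<forall>m\<ge>N. \<forall>n\<ge>N. padic_abs p (X m + Y m - (X n + Y n)) < e" by blast
qed

lemma padic_cauchy_minus: "padic_cauchy p X \<Longrightarrow> padic_cauchy p (\<lambda>n. - X n)"
  unfolding padic_cauchy_def minus_diff_minus padic_abs_minus[OF p] .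

lemma padic_cauchy_diff:
  "padic_cauchy p X \<Longrightarrow> padic_cauchy p Y \<Longrightarrow> padic_cauchy p (\<lambda>n. X n - Y n)"
  using padic_cauchy_add[of X "\<lambda>n. - Y n"] padic_cauchy_minus[of Y] by simp

lemma padic_cauchy_abs_convergent:
  assumes "padic_cauchy p X"
  shows "convergent (\<lambda>n. padic_abs p (X n))"
proof -
  have "Cauchy (\<lambda>n. padic_abs p (X n))"
    unfolding Cauchy_def dist_real_def
    using assms[unfolded padic_cauchy_def] padic_abs_triangle3[OF p] by (meson order_le_less_trans)
  thus ?thesis by (rule Cauchy_convergent)
qed

lemma padic_cauchy_bounded:
  assumes "padic_cauchy p X"
  shows "Bfun (\<lambda>n. padic_abs p (X n)) sequentially"
  using padic_cauchy_abs_convergent[OF assms] by (rule convergent_imp_Bseq)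

lemma padic_vanishes_mult:
  assumes "padic_cauchy p X" "padic_vanishes p Y"
  shows "padic_vanishes p (\<lambda>n. X n * Y n)"
  unfolding padic_vanishes_def padic_abs_mult[OF p]
proof -
  obtain L where "(\<lambda>n. padic_abs p (X n)) \<longlonglongrightarrow> L"
    using padic_cauchy_abs_convergent[OF assms(1)] by (auto simp: convergent_def)
  from tendsto_mult[OF this assms(2)[unfolded padic_vanishes_def]]
  show "(\<lambda>n. padic_abs p (X n) * padic_abs p (Y n)) \<longlonglongrightarrow> 0" by simp
qed

lemma padic_cauchy_mult:
  assumes "padic_cauchy p X" "padic_cauchy p Y"
  shows "padic_cauchy p (\<lambda>n. X n * Y n)"
  unfolding padic_cauchy_def
proof (intro allI impI)
  fix e :: real assume e: "e > 0"
  obtain K where K: "K > 0" "\<And>n. padic_abs p (X n) \<le> K"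
    using padic_cauchy_bounded[OF assms(1)] padic_abs_nonneg[OF p] by (auto simp: Bseq_def)
  obtain L where L: "L > 0" "\<And>n. padic_abs p (Y n) \<le> L"
    using padic_cauchy_bounded[OF assms(2)] padic_abs_nonneg[OF p] by (auto simp: Bseq_def)
  obtain M where M: "\<forall>m\<ge>M. \<forall>n\<ge>M. padic_abs p (X m - X n) < e / L"
    using assms e L by (metis padic_cauchy_def divide_pos_pos)
  obtain N where N: "\<forall>m\<ge>N. \<forall>n\<ge>N. padic_abs p (Y m - Y n) < e / K"
    using assms e K by (metis padic_cauchy_def divide_pos_pos)
  have "padic_abs p (X m * Y m - X n * Y n) < e" if mn: "m \<ge> max M N" "n \<ge> max M N" for m n
  proof -
    have 1: "padic_abs p (X m * (Y m - Y n)) < e"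
    proof -
      have "padic_abs p (X m) * padic_abs p (Y m - Y n) \<le> K * padic_abs p (Y m - Y n)"
        using K by (intro mult_right_mono) (auto simp: padic_abs_nonneg[OF p])
      also have "\<dots> < K * (e / K)" using N mn K by (intro mult_strict_left_mono) auto
      finally show ?thesis using K by (simp add: padic_abs_mult[OF p])
    qed
    have 2: "padic_abs p ((X m - X n) * Y n) < e"
    proof -
      have "padic_abs p (X m - X n) * padic_abs p (Y n) \<le> padic_abs p (X m - X n) * L"
        using L by (intro mult_left_mono) (auto simp: padic_abs_nonneg[OF p])
      also have "\<dots> < e / L * L" using M mn L by (intro mult_strict_right_mono) auto
      finally show ?thesis using L by (simp add: padic_abs_mult[OF p])
    qed
    have "X m * Y m - X n * Y n = X m * (Y m - Y n) + (X m - X n) * Y n"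
      by (simp add: algebra_simps)
    thus ?thesis
      using padic_abs_ultra[OF p, of "X m * (Y m - Y n)" "(X m - X n) * Y n"] 1 2 by simp
  qed
  thus "\<exists>N. \<forall>m\<ge>N. \<forall>n\<ge>N. padic_abs p (X m * Y m - X n * Y n) < e" by blast
qed

lemma padic_cauchy_not_vanishes:
  assumes "padic_cauchy p X" "\<not> padic_vanishes p X"
  obtains b N where "b > 0" "\<And>n. n \<ge> N \<Longrightarrow> b < padic_abs p (X n)"
proof -
  obtain L where L: "(\<lambda>n. padic_abs p (X n)) \<longlonglongrightarrow> L"
    using padic_cauchy_abs_convergent[OF assms(1)] by (auto simp: convergent_def)
  have "L \<ge> 0" using L by (rule LIMSEQ_le_const) (auto simp: padic_abs_nonneg[OF p])
  moreover have "L \<noteq> 0" using assms(2) L by (auto simp: padic_vanishes_def)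
  ultimately have L0: "L / 2 > 0" "L / 2 < L" by auto
  have "eventually (\<lambda>n. L / 2 < padic_abs p (X n)) sequentially"
    using order_tendstoD(1)[OF L L0(2)] .
  thus ?thesis using that[OF L0(1)] by (auto simp: eventually_sequentially)
qed

lemma padic_abs_inverse_diff:
  "r \<noteq> 0 \<Longrightarrow> s \<noteq> 0 \<Longrightarrow> padic_abs p (inverse r - inverse s)
     = inverse (padic_abs p r) * padic_abs p (r - s) * inverse (padic_abs p s)"
  by (simp add: inverse_diff_inverse padic_abs_mult[OF p] padic_abs_inverse[OF p] padic_abs_minus[OF p])

lemma padic_cauchy_inverse:
  assumes "padic_cauchy p X" "\<not> padic_vanishes p X"
  shows "padic_cauchy p (\<lambda>n. inverse (X n))"
  unfolding padic_cauchy_def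
proof (intro allI impI)
  fix e :: real assume e: "e > 0"
  obtain b M where b: "b > 0" "\<And>n. n \<ge> M \<Longrightarrow> b < padic_abs p (X n)"
    using padic_cauchy_not_vanishes[OF assms] by blast
  have "b * e * b > 0" using b e by simp
  then obtain N where N: "\<forall>m\<ge>N. \<forall>n\<ge>N. padic_abs p (X m - X n) < b * e * b"
    using assms(1) by (metis padic_cauchy_def)
  have "padic_abs p (inverse (X m) - inverse (X n)) < e" if mn: "m \<ge> max M N" "n \<ge> max M N" for m n
  proof -
    have pos: "b < padic_abs p (X m)" "b < padic_abs p (X n)" using b mn by auto
    hence nz: "X m \<noteq> 0" "X n \<noteq> 0" using b(1) by auto
    have "padic_abs p (inverse (X m) - inverse (X n))
        = inverse (padic_abs p (X m)) * padic_abs p (X m - X n) * inverse (padic_abs p (X n))"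
      by (rule padic_abs_inverse_diff[OF nz])
    also have "\<dots> \<le> inverse b * padic_abs p (X m - X n) * inverse b"
      using pos b by (intro mult_mono le_imp_inverse_le) (auto simp: padic_abs_nonneg[OF p])
    also have "\<dots> < inverse b * (b * e * b) * inverse b"
      using N mn b by (intro mult_strict_right_mono mult_strict_left_mono) auto
    also have "\<dots> = e" using b by (simp add: field_simps)
    finally show ?thesis .
  qed
  thus "\<exists>N. \<forall>m\<ge>N. \<forall>n\<ge>N. padic_abs p (inverse (X m) - inverse (X n)) < e" by blast
qed

lemma padic_vanishes_diff_inverse:
  assumes X: "padic_cauchy p X" "\<not> padic_vanishes p X"
    and Y: "padic_cauchy p Y" "\<not> padic_vanishes p Y"
    and XY: "padic_vanishes p (\<lambda>n. X n - Y n)"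
  shows "padic_vanishes p (\<lambda>n. inverse (X n) - inverse (Y n))"
proof -
  obtain b M where b: "b > 0" "\<And>n. n \<ge> M \<Longrightarrow> b < padic_abs p (X n)"
    using padic_cauchy_not_vanishes[OF X] by blast
  obtain c N where c: "c > 0" "\<And>n. n \<ge> N \<Longrightarrow> c < padic_abs p (Y n)"
    using padic_cauchy_not_vanishes[OF Y] by blast
  have le: "padic_abs p (inverse (X n) - inverse (Y n)) \<le> inverse b * padic_abs p (X n - Y n) * inverse c"
    if n: "n \<ge> max M N" for n
  proof -
    have pos: "b < padic_abs p (X n)" "c < padic_abs p (Y n)" using b c n by auto
    hence nz: "X n \<noteq> 0" "Y n \<noteq> 0" using b(1) c(1) by auto
    show ?thesis unfolding padic_abs_inverse_diff[OF nz]
      using pos b c by (intro mult_mono le_imp_inverse_le) (auto simp: padic_abs_nonneg[OF p])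
  qed
  have "(\<lambda>n. inverse b * padic_abs p (X n - Y n) * inverse c) \<longlonglongrightarrow> inverse b * 0 * inverse c"
    by (intro tendsto_intros XY[unfolded padic_vanishes_def])
  hence lim: "(\<lambda>n. inverse b * padic_abs p (X n - Y n) * inverse c) \<longlonglongrightarrow> 0" by simp
  show ?thesis unfolding padic_vanishes_def
    by (rule tendsto_sandwich[OF _ _ tendsto_const lim])
      (auto simp: padic_abs_nonneg[OF p] eventually_sequentially intro!: exI[of _ "max M N"] le)
qed

lemma padic_rel_refl: "padic_cauchy p X \<Longrightarrow> padic_rel p X X"
  by (simp add: padic_rel_def padic_vanishes_def)

lemma part_equivp_padic_rel: "part_equivp (padic_rel p)"
proof (rule part_equivpI)
  show "\<exists>X. padic_rel p X X" using padic_rel_refl padic_cauchy_const by blast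
  show "symp (padic_rel p)"
    by (auto simp: symp_def padic_rel_def padic_vanishes_def padic_abs_diff_commute[OF p])
  show "transp (padic_rel p)"
    unfolding padic_rel_def
    by (rule transpI) (force dest: padic_vanishes_add)
qed

lemma padic_rel_vanishes: "padic_rel p X Y \<Longrightarrow> padic_vanishes p X \<longleftrightarrow> padic_vanishes p Y"
  using padic_vanishes_diff[of X "\<lambda>n. X n - Y n"] padic_vanishes_add[of "\<lambda>n. X n - Y n" Y]
  by (auto simp: padic_rel_def)

lemma padic_rel_abs_lim:
  assumes "padic_rel p X Y"
  shows "lim (\<lambda>n. padic_abs p (X n)) = lim (\<lambda>n. padic_abs p (Y n))"
proof -
  have "(\<lambda>n. padic_abs p (X n)) \<longlonglongrightarrow> lim (\<lambda>n. padic_abs p (X n))"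
    using assms padic_cauchy_abs_convergent by (simp add: padic_rel_def convergent_LIMSEQ_iff)
  moreover have "(\<lambda>n. padic_abs p (X n) - padic_abs p (Y n)) \<longlonglongrightarrow> 0"
  proof (rule Lim_null_comparison)
    show "(\<lambda>n. padic_abs p (X n - Y n)) \<longlonglongrightarrow> 0"
      using assms by (simp add: padic_rel_def padic_vanishes_def)
  qed (simp add: padic_abs_triangle3[OF p])
  ultimately have "(\<lambda>n. padic_abs p (X n) - (padic_abs p (X n) - padic_abs p (Y n)))
      \<longlonglongrightarrow> lim (\<lambda>n. padic_abs p (X n)) - 0"
    by (rule tendsto_diff)
  hence "(\<lambda>n. padic_abs p (Y n)) \<longlonglongrightarrow> lim (\<lambda>n. padic_abs p (X n))" by simp
  thus ?thesis by (simp add: limI)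
qed

end

text \<open>
  \<open>\<rat>\<^sub>p\<close> is the completion of \<open>\<rat>\<close> with respect to \<open>\<bar>\<cdot>\<bar>\<^sub>p\<close>, i.e. rational Cauchy sequences modulo null
  sequences. The prime is carried by a phantom type argument: \<open>p = CARD('p)\<close>.
  (The command \<open>quotient_type\<close> with a partial relation does not support phantom arguments.)
\<close>

typedef (overloaded) 'p padic =
  "{c. \<exists>X. padic_cauchy CARD('p::prime_card) X \<and> c = Collect (padic_rel CARD('p) X)}"
  using padic_cauchy_const[OF prime_card] by blast

definition Padic :: "(nat \<Rightarrow> rat) \<Rightarrow> 'p::prime_card padic" where
  "Padic X = Abs_padic (Collect (padic_rel CARD('p) X))"

definition rep_padic :: "'p::prime_card padic \<Rightarrow> nat \<Rightarrow> rat" where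
  "rep_padic x = (SOME X. X \<in> Rep_padic x)"

definition cr_padic :: "(nat \<Rightarrow> rat) \<Rightarrow> 'p::prime_card padic \<Rightarrow> bool" where
  "cr_padic X x \<longleftrightarrow> padic_cauchy CARD('p) X \<and> Padic X = x"

lemma quot_type_padic:
  "quot_type (padic_rel CARD('p)) (Abs_padic :: _ \<Rightarrow> 'p::prime_card padic) Rep_padic"
proof (rule quot_type.intro)
  have "padic_cauchy CARD('p) X \<longleftrightarrow> padic_rel CARD('p) X X" for X
    by (simp add: padic_rel_def padic_vanishes_def)
  hence eq: "{c. \<exists>X. padic_cauchy CARD('p) X \<and> c = Collect (padic_rel CARD('p) X)}
      = {c. \<exists>X. padic_rel CARD('p) X X \<and> c = Collect (padic_rel CARD('p) X)}" by simp
  note td = type_definition_padic[where 'p='p, unfolded eq]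
  show "part_equivp (padic_rel CARD('p))"
    by (rule part_equivp_padic_rel[OF prime_card])
  show "\<exists>x. padic_rel CARD('p) x x \<and> Rep_padic y = Collect (padic_rel CARD('p) x)"
    for y :: "'p padic" using type_definition.Rep[OF td, of y] by simp
  show "(Abs_padic (Rep_padic y)) = y" for y :: "'p padic"
    by (rule type_definition.Rep_inverse[OF td])
  show "\<exists>x. padic_rel CARD('p) x x \<and> c = Collect (padic_rel CARD('p) x) \<Longrightarrow>
      Rep_padic (Abs_padic c :: 'p padic) = c" for c
    by (rule type_definition.Abs_inverse[OF td]) simp
  show "(Rep_padic c = Rep_padic d) = (c = d)" for c d :: "'p padic"
    by (rule Rep_padic_inject)
qed

lemma Quotient_padic:
  "Quotient (padic_rel CARD('p)) (Padic :: _ \<Rightarrow> 'p::prime_card padic) rep_padic cr_padic"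
proof -
  have "Quotient3 (padic_rel CARD('p)) (Padic :: _ \<Rightarrow> 'p padic) rep_padic"
    using quot_type.Quotient[OF quot_type_padic[where 'p='p]]
    unfolding quot_type.abs_def[OF quot_type_padic] quot_type.rep_def[OF quot_type_padic]
      Padic_def[abs_def] rep_padic_def[abs_def] .
  thus ?thesis
    by (auto simp: Quotient_def Quotient3_def cr_padic_def fun_eq_iff padic_rel_def padic_vanishes_def)
qed

setup_lifting Quotient_padic

lemma cr_padic_eq:
  "(pcr_padic :: _ \<Rightarrow> 'p::prime_card padic \<Rightarrow> bool) = (\<lambda>x y. padic_cauchy CARD('p) x \<and> Padic x = y)"
  unfolding padic.pcr_cr_eq cr_padic_def by auto

lemma padic_cauchy_cases [cases type: padic]:
  obtains X where "padic_cauchy CARD('p::prime_card) X" "(x :: 'p padic) = Padic X"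
proof (induct x)
  case (1 X)
  thus ?case by (auto simp: padic_rel_def)
qed

instantiation padic :: (prime_card) field
begin

lift_definition zero_padic :: "'a padic" is "\<lambda>n. 0"
  by (simp add: padic_rel_refl padic_cauchy_const prime_card)

lift_definition one_padic :: "'a padic" is "\<lambda>n. 1"
  by (simp add: padic_rel_refl padic_cauchy_const prime_card)

lift_definition plus_padic :: "'a padic \<Rightarrow> 'a padic \<Rightarrow> 'a padic" is "\<lambda>X Y n. X n + Y n"
  unfolding padic_rel_def add_diff_add
  by (simp add: padic_cauchy_add padic_vanishes_add prime_card)

lift_definition uminus_padic :: "'a padic \<Rightarrow> 'a padic" is "\<lambda>X n. - X n"
  unfolding padic_rel_def minus_diff_minus
  by (simp only: padic_cauchy_minus padic_vanishes_minus prime_card simp_thms)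

lift_definition times_padic :: "'a padic \<Rightarrow> 'a padic \<Rightarrow> 'a padic" is "\<lambda>X Y n. X n * Y n"
proof -
  fix f1 f2 f3 f4 :: "nat \<Rightarrow> rat"
  let ?p = "CARD('a)"
  assume "padic_rel ?p f1 f2" "padic_rel ?p f3 f4"
  hence *: "padic_cauchy ?p f1" "padic_cauchy ?p f2" "padic_cauchy ?p f3" "padic_cauchy ?p f4"
    "padic_vanishes ?p (\<lambda>n. f1 n - f2 n)" "padic_vanishes ?p (\<lambda>n. f3 n - f4 n)"
    by (auto simp: padic_rel_def)
  have "padic_vanishes ?p (\<lambda>n. f1 n * (f3 n - f4 n) + f4 n * (f1 n - f2 n))"
    by (intro padic_vanishes_add padic_vanishes_mult * prime_card)
  thus "padic_rel ?p (\<lambda>n. f1 n * f3 n) (\<lambda>n. f2 n * f4 n)"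
    using * by (simp add: padic_rel_def padic_cauchy_mult prime_card algebra_simps)
qed

lift_definition inverse_padic :: "'a padic \<Rightarrow> 'a padic"
  is "\<lambda>X. if padic_vanishes CARD('a) X then (\<lambda>n. 0) else (\<lambda>n. inverse (X n))"
proof -
  fix X Y :: "nat \<Rightarrow> rat"
  assume *: "padic_rel CARD('a) X Y"
  show "?thesis X Y"
    using * padic_rel_vanishes[OF prime_card *]
    by (auto simp: padic_rel_def padic_cauchy_const padic_cauchy_inverse padic_vanishes_diff_inverse
        prime_card) (simp add: padic_vanishes_def)
qed

definition "x - y = x + - y" for x y :: "'a padic"

definition "x div y = x * inverse y" for x y :: "'a padic"

instance
proof
  fix a b c :: "'a padic"
  have van0: "padic_vanishes CARD('a) (\<lambda>n. 0)" by (simp add: padic_vanishes_def)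
  note defs = padic_rel_def van0
  show "a + b = b + a"
    by transfer (simp add: ac_simps defs padic_cauchy_add prime_card)
  show "(a + b) + c = a + (b + c)"
    by transfer (simp add: ac_simps defs padic_cauchy_add prime_card)
  show "0 + a = a"
    by transfer (simp add: defs)
  show "- a + a = 0"
    by transfer (simp add: defs padic_cauchy_const prime_card)
  show "a - b = a + - b"
    by (rule minus_padic_def)
  show "(a * b) * c = a * (b * c)"
    by transfer (simp add: ac_simps defs padic_cauchy_mult prime_card)
  show "a * b = b * a"
    by transfer (simp add: ac_simps defs padic_cauchy_mult prime_card)
  show "1 * a = a"
    by transfer (simp add: defs)
  show "(a + b) * c = a * c + b * c"
    by transfer (simp add: distrib_right defs padic_cauchy_mult padic_cauchy_add prime_card)
  show "(0::'a padic) \<noteq> 1"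
    by transfer (simp add: padic_rel_def padic_vanishes_def padic_abs_minus padic_abs_1 prime_card LIMSEQ_const_iff)
  have "padic_vanishes CARD('a) (\<lambda>n. inverse (X n) * X n - 1)"
    if X: "padic_cauchy CARD('a) X" "\<not> padic_vanishes CARD('a) X" for X
  proof -
    obtain b N where b: "b > 0" "\<And>n. n \<ge> N \<Longrightarrow> b < padic_abs CARD('a) (X n)"
      using padic_cauchy_not_vanishes[OF prime_card X] by blast
    hence "X n \<noteq> 0" if "n \<ge> N" for n using that by (metis padic_abs_0 not_less_iff_gr_or_eq)
    hence "eventually (\<lambda>n. padic_abs CARD('a) (inverse (X n) * X n - 1) = 0) sequentially"
      by (auto simp: eventually_sequentially intro!: exI[of _ N])
    thus ?thesis unfolding padic_vanishes_def by (rule tendsto_eventually)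
  qed
  thus "a \<noteq> 0 \<Longrightarrow> inverse a * a = 1"
    by transfer (auto simp: defs padic_cauchy_mult padic_cauchy_inverse padic_cauchy_const prime_card)
  show "a div b = a * inverse b"
    by (rule divide_padic_def)
  show "inverse (0::'a padic) = 0"
    by transfer (simp add: defs padic_cauchy_const prime_card)
qed

end

lemma add_Padic: "padic_cauchy CARD('p) X \<Longrightarrow> padic_cauchy CARD('p) Y \<Longrightarrow>
    Padic X + Padic Y = (Padic (\<lambda>n. X n + Y n) :: 'p::prime_card padic)"
  using plus_padic.transfer[where 'a='p] by (simp add: cr_padic_eq rel_fun_def)

lemma uminus_Padic: "padic_cauchy CARD('p) X \<Longrightarrow>
    - Padic X = (Padic (\<lambda>n. - X n) :: 'p::prime_card padic)"
  using uminus_padic.transfer[where 'a='p] by (simp add: cr_padic_eq rel_fun_def)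

lemma diff_Padic: "padic_cauchy CARD('p) X \<Longrightarrow> padic_cauchy CARD('p) Y \<Longrightarrow>
    Padic X - Padic Y = (Padic (\<lambda>n. X n - Y n) :: 'p::prime_card padic)"
  by (simp add: minus_padic_def uminus_Padic add_Padic padic_cauchy_minus[OF prime_card])

lemma mult_Padic: "padic_cauchy CARD('p) X \<Longrightarrow> padic_cauchy CARD('p) Y \<Longrightarrow>
    Padic X * Padic Y = (Padic (\<lambda>n. X n * Y n) :: 'p::prime_card padic)"
  using times_padic.transfer[where 'a='p] by (simp add: cr_padic_eq rel_fun_def)

lemma Padic_eq_0_iff: "padic_cauchy CARD('p) X \<Longrightarrow>
    (Padic X :: 'p::prime_card padic) = 0 \<longleftrightarrow> padic_vanishes CARD('p) X"
  using padic.rel_eq_transfer[where 'p='p] zero_padic.transfer[where 'a='p]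
  unfolding cr_padic_eq rel_fun_def padic_rel_def
  by (metis (no_types, lifting) diff_zero ext)

lemma of_nat_Padic: "(of_nat k :: 'p::prime_card padic) = Padic (\<lambda>_. of_nat k)"
proof (induction k)
  case 0
  show ?case by (simp add: zero_padic.abs_eq)
next
  case (Suc k)
  have "(1 :: 'p padic) = Padic (\<lambda>_. 1)" by (simp add: one_padic.abs_eq)
  thus ?case
    using add_Padic[of "\<lambda>_. 1" "\<lambda>_. of_nat k", where 'p='p] Suc
    by (simp add: padic_cauchy_const prime_card)
qed

instance padic :: (prime_card) field_char_0
proof
  have "k = 0" if "(of_nat k :: 'a padic) = 0" for k
    using that unfolding of_nat_Padic
    by (subst (asm) Padic_eq_0_iff)
      (auto simp: padic_cauchy_const prime_card padic_vanishes_def LIMSEQ_const_iff)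
  hence ne: "(of_nat k :: 'a padic) \<noteq> 0" if "k > 0" for k using that by auto
  have "m = n" if "(of_nat m :: 'a padic) = of_nat n" "m \<le> n" for m n
    using that ne[of "n - m"] by (cases "m = n") auto
  thus "inj (of_nat :: nat \<Rightarrow> 'a padic)"
    by (intro injI) (metis linear)
qed

lift_definition padic_norm :: "'p::prime_card padic \<Rightarrow> real"
  is "\<lambda>X. lim (\<lambda>n. padic_abs CARD('p) (X n))"
  by (rule padic_rel_abs_lim[OF prime_card])

lemma padic_norm_Padic_LIMSEQ:
  assumes "padic_cauchy CARD('p) X"
  shows "(\<lambda>n. padic_abs CARD('p) (X n)) \<longlonglongrightarrow> padic_norm (Padic X :: 'p::prime_card padic)"
proof -
  have "padic_norm (Padic X :: 'p padic) = lim (\<lambda>n. padic_abs CARD('p) (X n))"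
    using padic_norm.transfer[where 'p='p] assms by (simp add: cr_padic_eq rel_fun_def)
  thus ?thesis
    using padic_cauchy_abs_convergent[OF prime_card assms] by (simp add: convergent_LIMSEQ_iff)
qed

lemma padic_norm_nonneg [simp]: "padic_norm (x :: 'p::prime_card padic) \<ge> 0"
proof (cases x)
  case (1 X)
  show ?thesis unfolding 1(2)
    by (rule LIMSEQ_le_const[OF padic_norm_Padic_LIMSEQ[OF 1(1)]]) (auto simp: padic_abs_nonneg prime_card)
qed

lemma padic_norm_eq_0_iff [simp]: "padic_norm (x :: 'p::prime_card padic) = 0 \<longleftrightarrow> x = 0"
proof (cases x)
  case (1 X)
  show ?thesis unfolding 1(2) Padic_eq_0_iff[OF 1(1)] padic_vanishes_def
    using padic_norm_Padic_LIMSEQ[OF 1(1)] LIMSEQ_unique by metis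
qed

lemma padic_norm_mult: "padic_norm (x * y) = padic_norm x * padic_norm (y :: 'p::prime_card padic)"
proof (cases x; cases y)
  fix X Y assume X: "padic_cauchy CARD('p) X" "x = Padic X" and Y: "padic_cauchy CARD('p) Y" "y = Padic Y"
  have "(\<lambda>n. padic_abs CARD('p) (X n * Y n)) \<longlonglongrightarrow> padic_norm x * padic_norm y"
    unfolding padic_abs_mult[OF prime_card] X(2) Y(2)
    by (intro tendsto_mult padic_norm_Padic_LIMSEQ X Y)
  moreover have "(\<lambda>n. padic_abs CARD('p) (X n * Y n)) \<longlonglongrightarrow> padic_norm (x * y)"
    unfolding X(2) Y(2) mult_Padic[OF X(1) Y(1)]
    by (intro padic_norm_Padic_LIMSEQ padic_cauchy_mult prime_card X Y)
  ultimately show ?thesis using LIMSEQ_unique by blast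
qed

lemma padic_norm_ultra: "padic_norm (x + y) \<le> max (padic_norm x) (padic_norm (y :: 'p::prime_card padic))"
proof (cases x; cases y)
  fix X Y assume X: "padic_cauchy CARD('p) X" "x = Padic X" and Y: "padic_cauchy CARD('p) Y" "y = Padic Y"
  have "(\<lambda>n. max (padic_abs CARD('p) (X n)) (padic_abs CARD('p) (Y n))) \<longlonglongrightarrow> max (padic_norm x) (padic_norm y)"
    unfolding X(2) Y(2) by (intro tendsto_max padic_norm_Padic_LIMSEQ X Y)
  moreover have "(\<lambda>n. padic_abs CARD('p) (X n + Y n)) \<longlonglongrightarrow> padic_norm (x + y)"
    unfolding X(2) Y(2) add_Padic[OF X(1) Y(1)]
    by (intro padic_norm_Padic_LIMSEQ padic_cauchy_add prime_card X Y)
  ultimately show ?thesis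
    using LIMSEQ_le padic_abs_ultra[OF prime_card] by blast
qed

lemma padic_norm_minus [simp]: "padic_norm (- x) = padic_norm (x :: 'p::prime_card padic)"
proof (cases x)
  case (1 X)
  have "(\<lambda>n. padic_abs CARD('p) (- X n)) \<longlonglongrightarrow> padic_norm (- x)"
    unfolding 1(2) uminus_Padic[OF 1(1)]
    by (intro padic_norm_Padic_LIMSEQ padic_cauchy_minus prime_card 1)
  thus ?thesis
    unfolding padic_abs_minus[OF prime_card] 1(2)
    using padic_norm_Padic_LIMSEQ[OF 1(1)] LIMSEQ_unique by blast
qed

lemma padic_norm_triangle: "padic_norm (x + y) \<le> padic_norm x + padic_norm (y :: 'p::prime_card padic)"
  using padic_norm_ultra[of x y] padic_norm_nonneg[of x] padic_norm_nonneg[of y] by linarith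

instantiation padic :: (prime_card) metric_space
begin

definition dist_padic :: "'a padic \<Rightarrow> 'a padic \<Rightarrow> real"
  where "dist_padic x y = padic_norm (x - y)"

definition uniformity_padic :: "('a padic \<times> 'a padic) filter"
  where "uniformity_padic = (INF e\<in>{0<..}. principal {(x, y). dist x y < e})"

definition open_padic :: "'a padic set \<Rightarrow> bool"
  where "open_padic U = (\<forall>x\<in>U. \<forall>\<^sub>F (x', y) in uniformity. x' = x \<longrightarrow> y \<in> U)"

instance
proof
  fix x y z :: "'a padic"
  show "dist x y = 0 \<longleftrightarrow> x = y" by (simp add: dist_padic_def)
  show "dist x y \<le> dist x z + dist y z"
    using padic_norm_triangle[of "x - z" "z - y"] padic_norm_minus[of "y - z"]
    by (simp add: dist_padic_def)
qed (simp_all add: uniformity_padic_def open_padic_def)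

end

lemma of_rat_Padic: "(of_rat r :: 'p::prime_card padic) = Padic (\<lambda>_. r)"
proof -
  obtain a b where r: "r = of_int a / of_int b" "b > 0"
    by (metis quotient_of_denom_pos quotient_of_div surj_pair)
  have of_int: "(of_int k :: 'p padic) = Padic (\<lambda>_. of_int k)" for k
    by (cases k) (auto simp: of_nat_Padic uminus_Padic padic_cauchy_const prime_card simp del: of_nat_Suc)
  have "Padic (\<lambda>_. r) * (of_int b :: 'p padic) = of_int a"
    using r by (simp add: of_int mult_Padic padic_cauchy_const prime_card)
  moreover have "of_rat r * of_int b = (of_int a :: 'p padic)"
    using r by (simp add: of_rat_divide)
  ultimately have "Padic (\<lambda>_. r) * (of_int b :: 'p padic) = of_rat r * of_int b" by simp
  thus ?thesis using r(2) by simp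
qed

lemma padic_norm_of_rat: "padic_norm (of_rat r :: 'p::prime_card padic) = padic_abs CARD('p) r"
  unfolding of_rat_Padic
  using padic_norm_Padic_LIMSEQ[OF padic_cauchy_const[OF prime_card], of r, where 'p='p]
  by (simp add: LIMSEQ_const_iff)

lemma Padic_LIMSEQ:
  assumes X: "padic_cauchy CARD('p) X"
  shows "(\<lambda>n. of_rat (X n)) \<longlonglongrightarrow> (Padic X :: 'p::prime_card padic)"
proof (rule metric_LIMSEQ_I)
  fix e :: real assume e: "e > 0"
  then obtain N where N: "\<forall>m\<ge>N. \<forall>n\<ge>N. padic_abs CARD('p) (X m - X n) < e / 2"
    using X unfolding padic_cauchy_def by (meson half_gt_zero)
  have "dist (of_rat (X n)) (Padic X :: 'p padic) < e" if "n \<ge> N" for n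
  proof -
    have "(\<lambda>m. padic_abs CARD('p) (X n - X m)) \<longlonglongrightarrow> dist (of_rat (X n)) (Padic X :: 'p padic)"
      unfolding dist_padic_def of_rat_Padic diff_Padic[OF padic_cauchy_const[OF prime_card] X]
      by (intro padic_norm_Padic_LIMSEQ padic_cauchy_diff padic_cauchy_const prime_card X)
    hence "dist (of_rat (X n)) (Padic X :: 'p padic) \<le> e / 2"
      by (rule LIMSEQ_le_const2) (use N that in \<open>auto intro!: exI[of _ N] less_imp_le\<close>)
    thus ?thesis using e by simp
  qed
  thus "\<exists>N. \<forall>n\<ge>N. dist (of_rat (X n)) (Padic X :: 'p padic) < e" by blast
qed

instance padic :: (prime_card) complete_space
proof
  fix x :: "nat \<Rightarrow> 'a padic" assume x: "Cauchy x"
  have "\<exists>r. dist (of_rat r) (x n) < inverse (real (Suc n))" for n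
  proof (cases "x n")
    case (1 X)
    show ?thesis
      using metric_LIMSEQ_D[OF Padic_LIMSEQ[OF 1(1)], of "inverse (real (Suc n))"] unfolding 1(2)
      by (metis inverse_positive_iff_positive of_nat_0_less_iff order_refl zero_less_Suc)
  qed
  then obtain r where r: "\<And>n. dist (of_rat (r n)) (x n) < inverse (real (Suc n))" by metis
  have lim0: "(\<lambda>n. dist (of_rat (r n)) (x n)) \<longlonglongrightarrow> 0"
    by (rule tendsto_sandwich[OF _ _ tendsto_const LIMSEQ_inverse_real_of_nat])
      (use less_imp_le[OF r] in \<open>simp_all\<close>)
  have "padic_cauchy CARD('a) r"
    unfolding padic_cauchy_def
  proof (intro allI impI)
    fix e :: real assume e: "e > 0"
    hence e3: "e / 3 > 0" by simp
    obtain M where M: "\<And>m n. m \<ge> M \<Longrightarrow> n \<ge> M \<Longrightarrow> dist (x m) (x n) < e / 3"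
      using metric_CauchyD[OF x e3] by blast
    obtain N where N: "\<And>n. n \<ge> N \<Longrightarrow> dist (of_rat (r n)) (x n) < e / 3"
      using metric_LIMSEQ_D[OF lim0 e3] by auto
    have "padic_abs CARD('a) (r m - r n) < e" if "m \<ge> max M N" "n \<ge> max M N" for m n
    proof -
      have "padic_abs CARD('a) (r m - r n) = dist (of_rat (r m)) (of_rat (r n) :: 'a padic)"
        by (simp add: dist_padic_def padic_norm_of_rat flip: of_rat_diff)
      also have "\<dots> \<le> dist (of_rat (r m)) (x m) + dist (x m) (x n) + dist (of_rat (r n)) (x n)"
        using dist_triangle[of "of_rat (r m)" "of_rat (r n)" "x m"]
          dist_triangle[of "x m" "of_rat (r n)" "x n"]
        by (simp add: dist_commute)
      also have "\<dots> < e" using M[of m n] N[of m] N[of n] that by auto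
      finally show ?thesis .
    qed
    thus "\<exists>N. \<forall>m\<ge>N. \<forall>n\<ge>N. padic_abs CARD('a) (r m - r n) < e" by blast
  qed
  hence "(\<lambda>n. of_rat (r n)) \<longlonglongrightarrow> (Padic r :: 'a padic)" by (rule Padic_LIMSEQ)
  moreover have "(\<lambda>n. dist (x n) (of_rat (r n))) \<longlonglongrightarrow> 0"
    using lim0 by (simp add: dist_commute)
  ultimately have lim: "(\<lambda>n. dist (x n) (of_rat (r n)) + dist (of_rat (r n)) (Padic r :: 'a padic)) \<longlonglongrightarrow> 0"
    unfolding tendsto_dist_iff[of "\<lambda>n. of_rat (r n)"] by (intro tendsto_add_zero)
  have "(\<lambda>n. dist (x n) (Padic r)) \<longlonglongrightarrow> 0"
    by (rule tendsto_sandwich[OF _ _ tendsto_const lim]) (simp_all add: dist_triangle)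
  hence "x \<longlonglongrightarrow> Padic r" by (simp only: tendsto_dist_iff[of x])
  thus "convergent x" by (auto simp: convergent_def)
qed


section \<open>Uniform distribution and zeroes\<close>

definition padic_integers :: "'p::prime_card padic set" where
  "padic_integers = {x. padic_norm x \<le> 1}"

definition padic_scaled_integers :: "nat \<Rightarrow> 'p::prime_card padic set" where
  "padic_scaled_integers m = (\<lambda>x. 1 / of_nat CARD('p) ^ m * x) ` padic_integers"

text \<open>The Haar probability measure of the compact additive group \<open>\<int>\<^sub>p\<close> is characterised by
  being a translation-invariant Borel probability measure on it.\<close>

definition haar_prob_padic_integers :: "'p::prime_card padic measure \<Rightarrow> bool" where
  "haar_prob_padic_integers \<mu> \<longleftrightarrow>
     prob_space \<mu> \<and> sets \<mu> = sets (restrict_space borel padic_integers) \<and>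
     (\<forall>a\<in>padic_integers. \<forall>A\<in>sets \<mu>. emeasure \<mu> ((+) a ` A) = emeasure \<mu> A)"

text \<open>Since \<^const>\<open>haar_prob_padic_integers\<close> includes total mass 1, the restriction below forces
  \<open>X \<in> \<int>\<^sub>p\<close> almost surely.\<close>

definition uniform_padic_integers :: "'a measure \<Rightarrow> ('a \<Rightarrow> 'p::prime_card padic) \<Rightarrow> bool" where
  "uniform_padic_integers M X \<longleftrightarrow>
     X \<in> borel_measurable M \<and>
     haar_prob_padic_integers (restrict_space (distr M borel X) padic_integers)"

definition binomial_poly :: "nat \<Rightarrow> (nat \<Rightarrow> 'p::prime_card padic) \<Rightarrow> 'p padic \<Rightarrow> 'p padic" where
  "binomial_poly d c t = (\<Sum>k\<le>d. c k * (t gchoose k))"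

text \<open>Counting measure gives \<open>\<infinity>\<close> for an infinite zero set (the zero polynomial), unlike
  \<^const>\<open>card\<close>.\<close>

definition num_zeros :: "('b \<Rightarrow> 'c::zero) \<Rightarrow> 'b set \<Rightarrow> ennreal" where
  "num_zeros f S = emeasure (count_space UNIV) {t \<in> S. f t = 0}"

text \<open>Measurability is part of the claim: \<^const>\<open>nn_integral\<close> of a non-measurable function is
  only a lower integral.\<close>

definition has_expectation :: "'a measure \<Rightarrow> ('a \<Rightarrow> ennreal) \<Rightarrow> real \<Rightarrow> bool" where
  "has_expectation M X e \<longleftrightarrow> X \<in> borel_measurable M \<and> (\<integral>\<^sup>+ \<omega>. X \<omega> \<partial>M) = ennreal e"

end

theory Submission
  imports Defs
begin

text \<open>
  Suppose that a random function has the form \<open>F = \<zeta>\<^sub>0 + \<Sum>k. \<zeta>\<^sub>k r\<^sub>k\<close> on a disc, where the coefficients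
  are independent and uniform in the p-adic integers and the functions \<open>r\<^sub>k\<close> are integral and
  differentiable. At a point \<open>t\<close> the value of \<open>F\<close> is uniform and independent of the derivative \<open>L\<close>,
  because the derivative does not contain \<open>\<zeta>\<^sub>0\<close>. By Hensel's lemma a small disc of radius \<open>\<rho>\<close> about
  \<open>t\<close> contains a zero if and only if the value at \<open>t\<close> is at most \<open>\<bar>L\<bar> \<rho>\<close> in absolute value, which has
  probability \<open>\<bar>L\<bar> \<rho>\<close> given \<open>L\<close>. This fails only where \<open>L\<close> is itself of order \<open>\<rho>\<close>, and there a zero
  forces the value to be of order \<open>\<rho>\<^sup>2\<close>, an event of probability of that order. Summing over the
  discs of a partition and letting \<open>\<rho>\<close> tend to 0, the expected number of zeros in a unit disc is the mean of \<open>E \<bar>L\<bar>\<close> over \<open>t\<close>. The derivative \<open>L = \<Sum>k. \<zeta>\<^sub>k r\<^sub>k'\<close> is uniform in the disc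
  whose radius is the largest \<open>\<bar>r\<^sub>k'\<bar>\<close>, and a uniform p-adic integer has mean absolute value
  \<open>1 / (1 + 1 / p)\<close>, so \<open>E \<bar>L\<bar>\<close> is the largest \<open>\<bar>r\<^sub>k'\<bar>\<close> divided by \<open>1 + 1 / p\<close>. This is
  \<open>expected_zeros_unit_disc\<close>, whose probabilistic core is \<open>prob_zero_bounds\<close>.

  It remains to see that the largest derivative is constant in the cases at hand. On the p-adic
  integers the \<open>r\<^sub>k\<close> are the binomial polynomials themselves. By Vandermonde's identity their
  derivatives are integral combinations of the numbers \<open>1 / j\<close> with \<open>j \<le> d\<close>, and the largest one has
  absolute value \<open>p\<^sup>L\<close>, where \<open>p\<^sup>L\<close> is the largest power of \<open>p\<close> up to \<open>d\<close>. Where \<open>\<bar>t\<bar> = p\<^sup>m\<close> with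
  \<open>m \<ge> 1\<close>, one first divides by the dominating polynomial of degree \<open>d\<close>. The ratios are products of
  factors \<open>(i + 1) / (t - i)\<close>, and the largest derivative is that of the ratio \<open>d / (t - d + 1)\<close> in
  degree \<open>d - 1\<close>, of absolute value \<open>\<bar>d\<bar>\<close> divided by \<open>p\<^sup>2\<^sup>m\<close>. The annulus consists of
  \<open>p\<^sup>m (1 - 1 / p)\<close> unit discs, which gives the second formula; the third follows by summing a
  geometric series.
\<close>

section \<open>The ultrametric geometry of the p-adic numbers\<close>

lemma card_gt_1 [simp]: "1 < real CARD('p::prime_card)"
  using prime_gt_1_nat[OF prime_card[where 'a='p]] by simp

lemma card_pos [simp]: "0 < real CARD('p::prime_card)"
  using card_gt_1[where 'p='p] by linarith

lemma padic_norm_0 [simp]: "padic_norm (0 :: 'p::prime_card padic) = 0"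
  by simp

lemma padic_norm_1 [simp]: "padic_norm (1 :: 'p::prime_card padic) = 1"
  using padic_norm_mult[of 1 "1 :: 'p padic"] by simp

lemma padic_norm_diff_commute:
  "padic_norm (x - y) = padic_norm (y - x :: 'p::prime_card padic)"
  using padic_norm_minus[of "x - y"] by simp

lemma padic_norm_power: "padic_norm (x ^ n) = padic_norm (x :: 'p::prime_card padic) ^ n"
  by (induction n) (simp_all add: padic_norm_mult)

lemma padic_norm_inverse: "padic_norm (inverse x) = inverse (padic_norm (x :: 'p::prime_card padic))"
proof (cases "x = 0")
  case False
  hence "padic_norm x * padic_norm (inverse x) = 1" by (simp flip: padic_norm_mult)
  thus ?thesis by (metis inverse_unique)
qed simp

lemma padic_norm_divide: "padic_norm (x / y) = padic_norm x / padic_norm (y :: 'p::prime_card padic)"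
  by (simp add: divide_inverse padic_norm_mult padic_norm_inverse)

lemma padic_norm_add_le:
  "padic_norm x \<le> r \<Longrightarrow> padic_norm y \<le> r \<Longrightarrow> padic_norm (x + y :: 'p::prime_card padic) \<le> r"
  using padic_norm_ultra[of x y] by linarith

lemma padic_norm_diff_le:
  "padic_norm x \<le> r \<Longrightarrow> padic_norm y \<le> r \<Longrightarrow> padic_norm (x - y :: 'p::prime_card padic) \<le> r"
  using padic_norm_add_le[of x r "- y"] by simp

lemma padic_norm_sum_le:
  assumes "\<And>i. i \<in> I \<Longrightarrow> padic_norm (f i :: 'p::prime_card padic) \<le> r" "0 \<le> r"
  shows "padic_norm (sum f I) \<le> r"
  using assms by (induction I rule: infinite_finite_induct) (auto intro: padic_norm_add_le)

lemma padic_norm_add_eq: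
  assumes "padic_norm y < padic_norm (x :: 'p::prime_card padic)"
  shows "padic_norm (x + y) = padic_norm x"
  using padic_norm_ultra[of x y] padic_norm_ultra[of "x + y" "- y"] assms by auto

lemma padic_norm_of_int: "padic_norm (of_int z :: 'p::prime_card padic) = padic_abs CARD('p) (of_int z)"
  using padic_norm_of_rat[of "of_int z", where 'p='p] by simp

lemma padic_norm_of_nat:
  assumes "n > 0"
  shows "padic_norm (of_nat n :: 'p::prime_card padic)
    = real CARD('p) powi (- int (multiplicity (int CARD('p)) (int n)))"
  using padic_norm_of_int[of "int n", where 'p='p] padic_abs_of_int[OF prime_card, of "int n"] assms
  by simp

lemma padic_norm_card [simp]: "padic_norm (of_nat CARD('p) :: 'p::prime_card padic) = inverse (real CARD('p))"
  using prime_card_int[where 'a='p]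
  by (subst padic_norm_of_nat) (auto simp: power_int_minus multiplicity_prime[OF prime_imp_prime_elem])

lemma padic_norm_of_int_le_1 [simp]: "padic_norm (of_int z :: 'p::prime_card padic) \<le> 1"
  by (cases "z = 0") (auto simp: padic_norm_of_int padic_abs_of_int[OF prime_card] power_int_minus
      intro!: inverse_le_1_iff[THEN iffD2] one_le_power)

lemma padic_norm_of_nat_le_1 [simp]: "padic_norm (of_nat n :: 'p::prime_card padic) \<le> 1"
  using padic_norm_of_int_le_1[of "int n", where 'p='p] by simp

lemma powi_le_card_iff [simp]:
  "real CARD('p::prime_card) powi i \<le> real CARD('p) powi j \<longleftrightarrow> i \<le> j"
  by (meson card_gt_1 leD le_less_linear less_imp_le power_int_strict_increasing power_int_increasing)

lemma powi_less_card_iff [simp]: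
  "real CARD('p::prime_card) powi i < real CARD('p) powi j \<longleftrightarrow> i < j"
  by (simp flip: not_le)

lemma powi_card_pos [simp]: "0 < real CARD('p::prime_card) powi i"
  by (simp add: zero_less_power_int)

lemma padic_norm_of_int_le_iff:
  "padic_norm (of_int z :: 'p::prime_card padic) \<le> real CARD('p) powi (- int n)
     \<longleftrightarrow> int CARD('p) ^ n dvd z"
proof (cases "z = 0")
  case False
  have "\<not> is_unit (int CARD('p))" using prime_card_int[where 'a='p] by (simp add: prime_int_iff)
  thus ?thesis using False
    by (simp add: padic_norm_of_int padic_abs_of_int[OF prime_card] power_dvd_iff_le_multiplicity)
qed (simp add: less_imp_le)

lemma padic_norm_of_nat_diff_le_iff:
  "padic_norm (of_nat c - of_nat c' :: 'p::prime_card padic) \<le> real CARD('p) powi (- int n)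
     \<longleftrightarrow> c mod CARD('p) ^ n = c' mod CARD('p) ^ n"
  using padic_norm_of_int_le_iff[of "int c - int c'" n, where 'p='p]
  by (simp add: mod_eq_dvd_iff flip: zmod_int of_nat_power)
     (metis (mono_tags, lifting) mod_eq_dvd_iff of_nat_eq_iff of_nat_power zmod_int)

lemma of_rat_dense:
  assumes "e > 0"
  shows "\<exists>r. padic_norm (x - of_rat r :: 'p::prime_card padic) < e"
proof (cases x)
  case (1 X)
  show ?thesis
    using metric_LIMSEQ_D[OF Padic_LIMSEQ[OF 1(1)] assms] 1(2)
    by (metis dist_padic_def order_refl padic_norm_diff_commute)
qed

text \<open>A nonzero number has the absolute value of any sufficiently good rational approximation.\<close>

lemma padic_norm_value_group:
  assumes "x \<noteq> (0 :: 'p::prime_card padic)"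
  obtains k where "padic_norm x = real CARD('p) powi k"
proof -
  obtain r where r: "padic_norm (x - of_rat r) < padic_norm x"
    using of_rat_dense[of "padic_norm x" x] assms padic_norm_nonneg[of x] by (auto simp: less_le)
  have "padic_norm (of_rat r :: 'p padic) = padic_norm x"
    using padic_norm_add_eq[of "- (x - of_rat r)" x] r by (simp add: padic_norm_diff_commute)
  moreover have "(of_rat r :: 'p padic) \<noteq> 0" using calculation assms by (metis padic_norm_eq_0_iff)
  ultimately have "padic_norm x = real CARD('p) powi
     (int (multiplicity (int CARD('p)) (snd (quotient_of r)))
                - int (multiplicity (int CARD('p)) (fst (quotient_of r))))"
    unfolding padic_norm_of_rat padic_abs_def by auto
  thus ?thesis by (rule that)
qed

text \<open>A rational \<open>a / b\<close> with \<open>p\<close> not dividing \<open>b\<close> is congruent modulo \<open>p\<^sup>n\<close> to the integer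
  \<open>a\<close> times an inverse of \<open>b\<close>; so residues modulo \<open>p\<^sup>n\<close> approximate every p-adic integer.\<close>

lemma nat_approximation:
  assumes "padic_norm (t :: 'p::prime_card padic) \<le> 1"
  obtains c where "c < CARD('p) ^ n" "padic_norm (t - of_nat c) \<le> real CARD('p) powi (- int n)"
proof -
  let ?q = "int CARD('p) ^ n"
  obtain r where r: "padic_norm (t - of_rat r) < real CARD('p) powi (- int n)"
    using of_rat_dense[of "real CARD('p) powi (- int n)" t] by auto
  have "real CARD('p) powi (- int n) \<le> real CARD('p) powi 0" by (subst powi_le_card_iff) simp
  hence r1: "padic_norm (of_rat r :: 'p padic) \<le> 1"
    using padic_norm_diff_le[OF assms, of "t - of_rat r"] r by simp
  obtain a b where ab: "quotient_of r = (a, b)" by (cases "quotient_of r")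
  have b: "b > 0" using ab by (rule quotient_of_denom_pos)
  have cop: "coprime a b" using ab by (rule quotient_of_coprime)
  have rab: "r = of_int a / of_int b" using ab by (rule quotient_of_div)
  have "\<not> int CARD('p) dvd b"
  proof
    assume p: "int CARD('p) dvd b"
    hence "\<not> int CARD('p) dvd a"
      using cop prime_card_int[where 'a='p] not_prime_unit coprime_common_divisor by blast
    hence "\<not> padic_norm (of_int a :: 'p padic) \<le> real CARD('p) powi (- int 1)"
      by (subst padic_norm_of_int_le_iff) simp
    moreover have "padic_norm (of_int b :: 'p padic) \<le> real CARD('p) powi (- int 1)"
      using p by (subst padic_norm_of_int_le_iff) simp
    moreover have "padic_norm (of_int a :: 'p padic) = padic_norm (of_rat r :: 'p padic) * padic_norm (of_int b :: 'p padic)"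
      using b by (simp add: rab of_rat_divide flip: padic_norm_mult)
    ultimately show False
      using r1 mult_right_mono[of "padic_norm (of_rat r :: 'p padic)" 1 "padic_norm (of_int b :: 'p padic)"]
      by simp
  qed
  hence copb: "coprime b ?q"
    using prime_imp_coprime[OF prime_card_int[where 'a='p], of b] by (auto simp: coprime_commute)
  obtain u v where uv: "b * u + ?q * v = 1"
    using copb bezout_int[of b ?q] by (auto simp: mult.commute coprime_iff_gcd_eq_1)
  define c where "c = (a * u) mod ?q"
  have c: "0 \<le> c" "c < ?q" by (simp_all add: c_def)
  have "?q dvd a - b * c"
  proof -
    have "c = a * u - ?q * (a * u div ?q)" unfolding c_def by (simp add: minus_mult_div_eq_mod)
    hence "a - b * c = a * (b * u + ?q * v) - b * (a * u - ?q * (a * u div ?q))"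
      by (simp add: uv)
    also have "\<dots> = ?q * (a * v + b * (a * u div ?q))" by (simp add: algebra_simps)
    finally show ?thesis by simp
  qed
  hence n1: "padic_norm (of_int (a - b * c) :: 'p padic) \<le> real CARD('p) powi (- int n)"
    by (subst padic_norm_of_int_le_iff)
  have "\<not> padic_norm (of_int b :: 'p padic) \<le> real CARD('p) powi (- int 1)"
    using \<open>\<not> int CARD('p) dvd b\<close> by (subst padic_norm_of_int_le_iff) simp
  moreover obtain k where k: "padic_norm (of_int b :: 'p padic) = real CARD('p) powi k"
    using padic_norm_value_group[of "of_int b :: 'p padic"] b by auto
  moreover have "real CARD('p) powi k \<le> real CARD('p) powi 0"
    using padic_norm_of_int_le_1[of b, where 'p='p] k by simp
  ultimately have "\<not> k \<le> - 1" "k \<le> 0" by (simp_all only: powi_le_card_iff of_nat_1 simp_thms)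
  hence "k = 0" by simp
  hence nb: "padic_norm (of_int b :: 'p padic) = 1" using k by simp
  have "(of_int (a - b * c) :: 'p padic) = of_int b * (of_rat r - of_int c)"
    using b by (simp add: rab of_rat_divide field_simps)
  hence n2: "padic_norm (of_rat r - of_int c :: 'p padic) \<le> real CARD('p) powi (- int n)"
    using n1 nb by (simp add: padic_norm_mult)
  show ?thesis
  proof (rule that)
    show "nat c < CARD('p) ^ n" using c by (simp add: nat_less_iff)
    have "padic_norm ((t - of_rat r) + (of_rat r - of_int c)) \<le> real CARD('p) powi (- int n)"
      using r n2 by (intro padic_norm_add_le) auto
    thus "padic_norm (t - of_nat (nat c)) \<le> real CARD('p) powi (- int n)" using c by simp
  qed
qed

subsection \<open>Discs\<close>

text \<open>The second argument is the exponent of the radius: every nonzero absolute value is an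
  integral power of \<open>p\<close>, so these are all the closed discs.\<close>

definition padic_disc :: "'p::prime_card padic \<Rightarrow> int \<Rightarrow> 'p padic set" where
  "padic_disc a k = {t. padic_norm (t - a) \<le> real CARD('p) powi k}"

lemma in_padic_disc: "t \<in> padic_disc a k \<longleftrightarrow> padic_norm (t - a) \<le> real CARD('p) powi k"
  for a :: "'p::prime_card padic"
  by (simp add: padic_disc_def)

lemma centre_in_padic_disc [simp]: "a \<in> padic_disc a k"
  by (simp add: in_padic_disc less_imp_le)

lemma padic_disc_mono: "k \<le> l \<Longrightarrow> padic_disc (a :: 'p::prime_card padic) k \<subseteq> padic_disc a l"
  using powi_le_card_iff[of k l, where 'p='p] by (fastforce simp: in_padic_disc simp del: powi_le_card_iff)

text \<open>By the ultrametric inequality each point of a disc is a centre of it. Hence discs are open, and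
  two discs of equal radius coincide or are disjoint.\<close>

lemma padic_disc_recentre:
  assumes "b \<in> padic_disc a k"
  shows "padic_disc b k = padic_disc a k"
proof -
  have "padic_norm (t - a) \<le> real CARD('a) powi k \<longleftrightarrow> padic_norm (t - b) \<le> real CARD('a) powi k" for t
    using padic_norm_add_le[of "t - b" _ "b - a"] padic_norm_diff_le[of "t - a" _ "b - a"] assms
    by (auto simp: in_padic_disc)
  thus ?thesis by (auto simp: in_padic_disc)
qed

lemma padic_disc_eq_cball: "padic_disc a k = cball a (real CARD('p) powi k)" for a :: "'p::prime_card padic"
  by (auto simp: in_padic_disc dist_padic_def padic_norm_diff_commute)

lemma open_padic_disc: "open (padic_disc (a :: 'p::prime_card padic) k)"
  unfolding open_contains_ball
proof
  fix t assume t: "t \<in> padic_disc a k"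
  have "ball t (real CARD('p) powi k) \<subseteq> padic_disc t k"
    by (auto simp: padic_disc_eq_cball)
  thus "\<exists>e>0. ball t e \<subseteq> padic_disc a k"
    using padic_disc_recentre[OF t] by (intro exI[of _ "real CARD('p) powi k"]) auto
qed

lemma closed_padic_disc: "closed (padic_disc a k)"
  by (simp add: padic_disc_eq_cball)

lemma padic_integers_eq_disc: "padic_integers = padic_disc 0 0"
  by (auto simp: padic_integers_def in_padic_disc)

lemma padic_scaled_integers_eq_disc: "padic_scaled_integers m = padic_disc 0 (int m)"
proof -
  have "x \<in> padic_scaled_integers m \<longleftrightarrow> x \<in> padic_disc 0 (int m)" for x :: "'a padic"
  proof
    assume "x \<in> padic_scaled_integers m"
    then obtain y where y: "padic_norm y \<le> 1" "x = 1 / of_nat CARD('a) ^ m * y"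
      unfolding padic_scaled_integers_def padic_integers_def by auto
    show "x \<in> padic_disc 0 (int m)"
      using y by (simp add: in_padic_disc padic_norm_mult padic_norm_inverse padic_norm_power
          power_inverse divide_inverse mult_left_le)
  next
    assume x: "x \<in> padic_disc 0 (int m)"
    have "padic_norm (of_nat CARD('a) ^ m * x) \<le> 1"
      using x by (simp add: in_padic_disc padic_norm_mult padic_norm_power power_inverse field_simps)
    thus "x \<in> padic_scaled_integers m"
      unfolding padic_scaled_integers_def padic_integers_def
      by (intro image_eqI[of _ _ "of_nat CARD('a) ^ m * x"]) auto
  qed
  thus ?thesis by blast
qed

text \<open>The residues modulo \<open>p\<^sup>n\<close>, translated by \<open>a\<close>, are the centres of the partition of the unit
  disc about \<open>a\<close> into \<open>p\<^sup>n\<close> discs of radius \<open>p\<close> to the power \<open>-n\<close>. Zeros are counted, and the Haar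
  measure is computed, by refining this partition.\<close>

lemma unit_disc_cover:
  assumes "t \<in> padic_disc (a :: 'p::prime_card padic) 0"
  obtains c where "c < CARD('p) ^ n" "t \<in> padic_disc (a + of_nat c) (- int n)"
proof -
  have "padic_norm (t - a) \<le> 1" using assms by (simp add: in_padic_disc)
  then obtain c where "c < CARD('p) ^ n" "padic_norm (t - a - of_nat c) \<le> real CARD('p) powi (- int n)"
    by (rule nat_approximation)
  thus ?thesis using that[of c] by (simp add: in_padic_disc algebra_simps)
qed

lemma unit_disc_cover_unique:
  assumes "t \<in> padic_disc (a + of_nat c :: 'p::prime_card padic) (- int n)"
    and "t \<in> padic_disc (a + of_nat c') (- int n)" "c < CARD('p) ^ n" "c' < CARD('p) ^ n"
  shows "c = c'"
proof -
  have "padic_norm ((t - (a + of_nat c')) - (t - (a + of_nat c))) \<le> real CARD('p) powi (- int n)"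
    using assms(1,2) unfolding in_padic_disc by (rule padic_norm_diff_le[rotated])
  hence "padic_norm (of_nat c - of_nat c' :: 'p padic) \<le> real CARD('p) powi (- int n)" by simp
  thus ?thesis using assms(3,4) by (subst (asm) padic_norm_of_nat_diff_le_iff) simp
qed

lemma sub_disc_subset_unit_disc:
  "padic_disc (a + of_nat c :: 'p::prime_card padic) (- int n) \<subseteq> padic_disc a 0"
proof -
  have "a + of_nat c \<in> padic_disc a 0" by (simp add: in_padic_disc)
  thus ?thesis using padic_disc_mono[of "- int n" 0 "a + of_nat c"] padic_disc_recentre by fastforce
qed

lemma ex_powi_less:
  assumes "e > 0"
  shows "\<exists>n. real CARD('p::prime_card) powi (- int n) < e"
proof -
  obtain n where "inverse (real CARD('p)) ^ n < e"
    using real_arch_pow_inv[OF assms, of "inverse (real CARD('p))"] card_gt_1[where 'p='p]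
    by (auto simp: inverse_less_1_iff simp del: card_gt_1)
  thus ?thesis by (intro exI[of _ n]) (simp add: power_int_minus power_inverse)
qed

text \<open>The unit disc is complete, and the partitions into residue discs make it totally bounded.\<close>

lemma compact_unit_disc: "compact (padic_disc (a :: 'p::prime_card padic) 0)"
  unfolding compact_eq_totally_bounded
proof (intro conjI allI impI, goal_cases)
  case 1
  show ?case by (simp add: complete_eq_closed closed_padic_disc)
next
  case (2 e)
  then obtain n where n: "real CARD('p) powi (- int n) < e" using ex_powi_less by blast
  have "padic_disc a 0 \<subseteq> (\<Union>x\<in>(\<lambda>c. a + of_nat c) ` {..<CARD('p) ^ n}. ball x e)"
  proof
    fix t assume "t \<in> padic_disc a 0"
    then obtain c where "c < CARD('p) ^ n" "t \<in> padic_disc (a + of_nat c) (- int n)"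
      by (rule unit_disc_cover)
    thus "t \<in> (\<Union>x\<in>(\<lambda>c. a + of_nat c) ` {..<CARD('p) ^ n}. ball x e)"
      using n by (auto simp: padic_disc_eq_cball intro!: bexI[of _ c])
  qed
  thus ?case by blast
qed

lemma compact_sub_disc: "compact (padic_disc (a :: 'p::prime_card padic) (- int n))"
  using compact_Int_closed[OF compact_unit_disc[of a] closed_padic_disc[of a "- int n"]]
    padic_disc_mono[of "- int n" 0 a] by (simp add: Int_absorb1)

subsection \<open>Topology and measurability of the field operations\<close>

instance padic :: (prime_card) topological_monoid_add
proof
  fix a b :: "'a padic"
  show "((\<lambda>x. fst x + snd x) \<longlongrightarrow> a + b) (nhds a \<times>\<^sub>F nhds b)"
  proof (rule metric_tendsto_imp_tendsto[where f = "\<lambda>x. dist (fst x) a + dist (snd x) b" and a = 0])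
    have "((\<lambda>x. dist (fst x) a + dist (snd x) b) \<longlongrightarrow> dist a a + dist b b) (nhds a \<times>\<^sub>F nhds b)"
      by (intro tendsto_intros filterlim_fst filterlim_snd)
    thus "((\<lambda>x. dist (fst x) a + dist (snd x) b) \<longlongrightarrow> 0) (nhds a \<times>\<^sub>F nhds b)" by simp
    show "\<forall>\<^sub>F x in nhds a \<times>\<^sub>F nhds b. dist (fst x + snd x) (a + b) \<le> dist (dist (fst x) a + dist (snd x) b) 0"
      using padic_norm_triangle by (intro always_eventually) (auto simp: dist_padic_def add_diff_add)
  qed
qed

instance padic :: (prime_card) topological_comm_monoid_add ..

text \<open>Second countability (the rational numbers are dense) is what makes sums and products of
  Borel measurable p-adic functions measurable.\<close>

instance padic :: (prime_card) second_countable_topology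
proof
  define B where "B = (\<lambda>(r, n). padic_disc (of_rat r :: 'a padic) (- int n)) ` (UNIV :: (rat \<times> nat) set)"
  have "topological_basis B"
  proof (rule topological_basisI)
    fix U and x :: "'a padic" assume U: "open U" "x \<in> U"
    then obtain e where e: "e > 0" "ball x e \<subseteq> U" by (auto simp: open_contains_ball)
    obtain n where n: "real CARD('a) powi (- int n) < e" using ex_powi_less[OF e(1)] by blast
    obtain r where "padic_norm (x - of_rat r) < real CARD('a) powi (- int n)"
      using of_rat_dense[of "real CARD('a) powi (- int n)" x] by auto
    hence x: "x \<in> padic_disc (of_rat r) (- int n)" by (simp add: in_padic_disc)
    hence "padic_disc (of_rat r) (- int n) = cball x (real CARD('a) powi (- int n))"
      using padic_disc_recentre[OF x] by (simp add: padic_disc_eq_cball)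
    hence "padic_disc (of_rat r) (- int n) \<subseteq> U" using n e(2) by auto
    thus "\<exists>B'\<in>B. x \<in> B' \<and> B' \<subseteq> U" using x unfolding B_def by blast
  qed (auto simp: B_def open_padic_disc)
  moreover have "countable B" by (simp add: B_def)
  ultimately show "\<exists>B :: 'a padic set set. countable B \<and> open = generate_topology B"
    using topological_basis_imp_subbasis by blast
qed

instance padic :: (prime_card) topological_semigroup_mult
proof
  fix a b :: "'a padic"
  let ?F = "nhds a \<times>\<^sub>F nhds b"
  let ?f = "\<lambda>x. dist (fst x) a * (dist (snd x) b + padic_norm b) + padic_norm a * dist (snd x) b"
  show "((\<lambda>x. fst x * snd x) \<longlongrightarrow> a * b) ?F"
  proof (rule metric_tendsto_imp_tendsto[where f = ?f and a = 0])
    have "(?f \<longlongrightarrow> dist a a * (dist b b + padic_norm b) + padic_norm a * dist b b) ?F"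
      by (intro tendsto_intros filterlim_fst filterlim_snd)
    thus "(?f \<longlongrightarrow> 0) ?F" by simp
    have "dist (x * y) (a * b) \<le> dist x a * (dist y b + padic_norm b) + padic_norm a * dist y b" for x y
    proof -
      have "x * y - a * b = (x - a) * y + a * (y - b)" by (simp add: algebra_simps)
      hence "dist (x * y) (a * b) \<le> padic_norm (x - a) * padic_norm y + padic_norm a * padic_norm (y - b)"
        unfolding dist_padic_def using padic_norm_triangle[of "(x - a) * y" "a * (y - b)"]
        by (simp add: padic_norm_mult)
      also have "padic_norm y \<le> padic_norm (y - b) + padic_norm b"
        using padic_norm_triangle[of "y - b" b] by simp
      finally show ?thesis by (simp add: dist_padic_def mult_left_mono)
    qed
    thus "\<forall>\<^sub>F x in ?F. dist (fst x * snd x) (a * b) \<le> dist (?f x) 0"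
      by (intro always_eventually) (auto intro: order_trans)
  qed
qed

lemma continuous_on_padic_norm: "continuous_on UNIV (padic_norm :: 'p::prime_card padic \<Rightarrow> real)"
  using continuous_on_dist[OF continuous_on_id continuous_on_const[of UNIV "0 :: 'p padic"]]
  by (simp add: dist_padic_def)

lemma borel_measurable_padic_norm [measurable]:
  "(padic_norm :: 'p::prime_card padic \<Rightarrow> real) \<in> borel_measurable borel"
  by (rule borel_measurable_continuous_onI[OF continuous_on_padic_norm])

lemma borel_measurable_padic_times [measurable]:
  fixes f g :: "'a \<Rightarrow> 'p::prime_card padic"
  assumes "f \<in> borel_measurable M" "g \<in> borel_measurable M"
  shows "(\<lambda>x. f x * g x) \<in> borel_measurable M"
  using assms by (rule borel_measurable_continuous_Pair)
    (auto intro!: continuous_on_mult' continuous_intros)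

lemma borel_measurable_padic_sum [measurable]:
  fixes f :: "'i \<Rightarrow> 'a \<Rightarrow> 'p::prime_card padic"
  assumes "\<And>i. i \<in> I \<Longrightarrow> f i \<in> borel_measurable M"
  shows "(\<lambda>x. \<Sum>i\<in>I. f i x) \<in> borel_measurable M"
  using assms by (induction I rule: infinite_finite_induct) auto

section \<open>Functions with a quadratic remainder\<close>

text \<open>A strict form of differentiability at \<open>t\<close> with derivative \<open>D\<close>: the difference quotient over
  two points near \<open>t\<close>, neither of which need be \<open>t\<close>, deviates from \<open>D\<close> by at most \<open>C\<close> times the
  distance of the two points from \<open>t\<close>. The two-point form makes Newton's map a contraction, and
  for a constant \<open>C\<close> that serves all \<open>t\<close> it gives estimates uniform in the centre.\<close>

definition quadratic_remainder ::
  "'p::prime_card padic set \<Rightarrow> ('p padic \<Rightarrow> 'p padic) \<Rightarrow> 'p padic \<Rightarrow> 'p padic \<Rightarrow> real \<Rightarrow> bool" where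
  "quadratic_remainder S f t D C \<longleftrightarrow> (\<forall>u\<in>S. \<forall>v\<in>S.
     padic_norm (f u - f v - D * (u - v)) \<le> C * padic_norm (u - v) * max (padic_norm (u - t)) (padic_norm (v - t)))"

lemma quadratic_remainderD:
  "quadratic_remainder S f t D C \<Longrightarrow> u \<in> S \<Longrightarrow> v \<in> S \<Longrightarrow>
     padic_norm (f u - f v - D * (u - v)) \<le> C * padic_norm (u - v) * max (padic_norm (u - t)) (padic_norm (v - t))"
  by (simp add: quadratic_remainder_def)

lemma quadratic_remainder_mono:
  assumes "quadratic_remainder S f t D C" "C \<le> C'"
  shows "quadratic_remainder S f t D C'"
  unfolding quadratic_remainder_def
proof (intro ballI)
  fix u v assume "u \<in> S" "v \<in> S"
  hence "padic_norm (f u - f v - D * (u - v)) \<le> C * padic_norm (u - v) * max (padic_norm (u - t)) (padic_norm (v - t))"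
    using assms by (simp add: quadratic_remainder_def)
  also have "\<dots> \<le> C' * padic_norm (u - v) * max (padic_norm (u - t)) (padic_norm (v - t))"
    using assms by (intro mult_right_mono) (auto simp: le_max_iff_disj)
  finally show "padic_norm (f u - f v - D * (u - v))
    \<le> C' * padic_norm (u - v) * max (padic_norm (u - t)) (padic_norm (v - t))" .
qed

lemma quadratic_remainder_const: "0 \<le> C \<Longrightarrow> quadratic_remainder S (\<lambda>_. c) t 0 C"
  by (auto simp: quadratic_remainder_def le_max_iff_disj)

lemma quadratic_remainder_add:
  assumes "quadratic_remainder S f t D C" "quadratic_remainder S g t E C"
  shows "quadratic_remainder S (\<lambda>x. f x + g x) t (D + E) C"
  unfolding quadratic_remainder_def
proof (intro ballI)
  fix u v assume uv: "u \<in> S" "v \<in> S"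
  have eq: "f u + g u - (f v + g v) - (D + E) * (u - v)
    = (f u - f v - D * (u - v)) + (g u - g v - E * (u - v))" by (simp add: algebra_simps)
  show "padic_norm (f u + g u - (f v + g v) - (D + E) * (u - v))
    \<le> C * padic_norm (u - v) * max (padic_norm (u - t)) (padic_norm (v - t))"
    unfolding eq using assms uv by (intro padic_norm_add_le quadratic_remainderD)
qed

lemma quadratic_remainder_cmult:
  assumes "quadratic_remainder S f t D C"
  shows "quadratic_remainder S (\<lambda>x. c * f x) t (c * D) (padic_norm c * C)"
  unfolding quadratic_remainder_def
proof (intro ballI)
  fix u v assume uv: "u \<in> S" "v \<in> S"
  have eq: "c * f u - c * f v - c * D * (u - v) = c * (f u - f v - D * (u - v))"
    by (simp add: algebra_simps)
  show "padic_norm (c * f u - c * f v - c * D * (u - v))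
    \<le> padic_norm c * C * padic_norm (u - v) * max (padic_norm (u - t)) (padic_norm (v - t))"
    unfolding eq padic_norm_mult using quadratic_remainderD[OF assms uv]
    by (simp add: mult.assoc mult_left_mono)
qed

lemma quadratic_remainder_sum:
  assumes "\<And>i. i \<in> I \<Longrightarrow> quadratic_remainder S (f i) t (D i) C" "0 \<le> C"
  shows "quadratic_remainder S (\<lambda>x. \<Sum>i\<in>I. f i x) t (\<Sum>i\<in>I. D i) C"
  using assms
  by (induction I rule: infinite_finite_induct)
    (auto intro!: quadratic_remainder_add quadratic_remainder_const)

text \<open>Hensel's lemma in the form needed for counting: the simplified Newton map \<open>u - F u / D\<close> is a
  contraction as soon as \<open>D\<close> dominates the quadratic remainder, and then it maps the disc about
  \<open>t\<close> to itself provided that it moves the centre by no more than the radius.\<close>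

lemma hensel_zero:
  fixes F :: "'p::prime_card padic \<Rightarrow> 'p padic"
  assumes rem: "quadratic_remainder S F t D C" and S: "padic_disc t (- int n) \<subseteq> S"
    and C: "0 \<le> C" "C * real CARD('p) powi (- int n) < padic_norm D"
    and Ft: "padic_norm (F t) \<le> padic_norm D * real CARD('p) powi (- int n)"
  shows "\<exists>u\<in>padic_disc t (- int n). F u = 0"
proof -
  let ?B = "padic_disc t (- int n)" and ?r = "real CARD('p) powi (- int n)"
  define c where "c = C * ?r / padic_norm D"
  define N where "N u = u - F u / D" for u
  have "0 \<le> C * ?r" using C(1) less_imp_le[OF powi_card_pos[of "- int n", where 'p='p]] by simp
  hence D: "0 < padic_norm D" using C(2) by linarith
  hence D0: "D \<noteq> 0" by auto
  have c: "0 \<le> c" "c < 1" using D C(2) \<open>0 \<le> C * ?r\<close> by (simp_all add: c_def divide_less_eq_1)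
  have contr: "padic_norm (N u - N v) \<le> c * padic_norm (u - v)" if "u \<in> ?B" "v \<in> ?B" for u v
  proof -
    have "N u - N v = - ((F u - F v - D * (u - v)) / D)"
      using D0 by (simp add: N_def field_simps)
    hence "padic_norm (N u - N v) = padic_norm (F u - F v - D * (u - v)) / padic_norm D"
      by (simp only: padic_norm_minus padic_norm_divide)
    also have "\<dots> \<le> C * padic_norm (u - v) * max (padic_norm (u - t)) (padic_norm (v - t)) / padic_norm D"
      using D that S by (intro divide_right_mono quadratic_remainderD[OF rem]) auto
    also have "\<dots> \<le> C * padic_norm (u - v) * ?r / padic_norm D"
      using D that C by (intro divide_right_mono mult_left_mono) (auto simp: in_padic_disc)
    finally show ?thesis by (simp add: c_def field_simps)
  qed
  have "N ` ?B \<subseteq> ?B"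
  proof
    fix y assume "y \<in> N ` ?B"
    then obtain u where u: "u \<in> ?B" "y = N u" by auto
    have "padic_norm (N u - N t) \<le> c * padic_norm (u - t)" using u by (intro contr) auto
    also have "\<dots> \<le> 1 * ?r" using u c by (intro mult_mono) (auto simp: in_padic_disc)
    finally have "padic_norm (N u - N t) \<le> ?r" by simp
    moreover have "padic_norm (N t - t) \<le> ?r"
      using Ft D by (simp add: N_def padic_norm_divide field_simps)
    ultimately have "padic_norm ((N u - N t) + (N t - t)) \<le> ?r" by (rule padic_norm_add_le)
    thus "y \<in> ?B" using u by (simp add: in_padic_disc)
  qed
  moreover have "?B \<noteq> {}" using centre_in_padic_disc by blast
  ultimately have "\<exists>!x. x \<in> ?B \<and> N x = x"
    using contr c
    by (intro Banach_fix[where c = c]) (simp_all add: complete_eq_closed closed_padic_disc dist_padic_def)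
  thus ?thesis using D0 by (auto simp: N_def)
qed

text \<open>The converse of the preceding lemma, up to the quadratic remainder: when \<open>D\<close> dominates, the
  two together say that the disc contains a zero exactly if \<open>F t\<close> lies in the image of the disc
  under the linear part.\<close>

lemma zero_nearby_imp_small:
  fixes F :: "'p::prime_card padic \<Rightarrow> 'p padic"
  assumes rem: "quadratic_remainder S F t D C" and S: "padic_disc t (- int n) \<subseteq> S"
    and C: "0 \<le> C" and u: "u \<in> padic_disc t (- int n)" "F u = 0"
  shows "padic_norm (F t) \<le> max (padic_norm D * real CARD('p) powi (- int n))
    (C * real CARD('p) powi (- int n) * real CARD('p) powi (- int n))"
proof -
  let ?r = "real CARD('p) powi (- int n)"
  have r: "0 \<le> ?r" by (simp add: less_imp_le)
  have "padic_norm (F u - F t - D * (u - t)) \<le> C * padic_norm (u - t) * max (padic_norm (u - t)) (padic_norm (t - t))"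
    using u S by (intro quadratic_remainderD[OF rem]) auto
  also have "\<dots> \<le> C * ?r * ?r"
    using u C r by (intro mult_mono) (auto simp: in_padic_disc intro!: mult_nonneg_nonneg)
  finally have 1: "padic_norm (F u - F t - D * (u - t)) \<le> C * ?r * ?r" .
  have 2: "padic_norm (D * (u - t)) \<le> padic_norm D * ?r"
    using u by (simp add: padic_norm_mult in_padic_disc mult_left_mono)
  have "padic_norm ((F u - F t - D * (u - t)) + D * (u - t))
    \<le> max (padic_norm D * ?r) (C * ?r * ?r)"
    using 1 2 by (intro padic_norm_add_le) auto
  thus ?thesis using u by simp
qed

lemma quadratic_remainder_continuous_on:
  fixes F :: "'p::prime_card padic \<Rightarrow> 'p padic"
  assumes "\<And>t. t \<in> S \<Longrightarrow> quadratic_remainder S F t (D t) C" "0 \<le> C"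
  shows "continuous_on S F"
  unfolding continuous_on_def
proof
  fix t assume t: "t \<in> S"
  let ?h = "\<lambda>u. padic_norm (D t) * dist u t + C * dist u t * dist u t"
  show "(F \<longlongrightarrow> F t) (at t within S)"
  proof (rule metric_tendsto_imp_tendsto[where f = ?h and a = 0])
    have "(?h \<longlongrightarrow> padic_norm (D t) * dist t t + C * dist t t * dist t t) (at t within S)"
      by (intro tendsto_intros)
    thus "(?h \<longlongrightarrow> 0) (at t within S)" by simp
    have "dist (F u) (F t) \<le> dist (?h u) 0" if "u \<in> S" for u
    proof -
      have "dist (F u) (F t) = padic_norm (D t * (u - t) + (F u - F t - D t * (u - t)))"
        by (simp add: dist_padic_def)
      also have "\<dots> \<le> padic_norm (D t * (u - t)) + padic_norm (F u - F t - D t * (u - t))"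
        by (rule padic_norm_triangle)
      also have "padic_norm (F u - F t - D t * (u - t)) \<le> C * dist u t * max (dist u t) (dist t t)"
        unfolding dist_padic_def using that t by (intro quadratic_remainderD[OF assms(1)])
      finally show ?thesis using assms(2) by (simp add: padic_norm_mult dist_padic_def)
    qed
    thus "\<forall>\<^sub>F u in at t within S. dist (F u) (F t) \<le> dist (?h u) 0"
      by (auto simp: eventually_at_filter)
  qed
qed

section \<open>Counting zeros by refining residue discs\<close>

text \<open>The cells of the partition into \<open>p\<^sup>n\<close> residue discs that meet \<open>Z\<close>. Their number increases
  with \<open>n\<close> to the number of elements of \<open>Z\<close>, finite or not, since finitely many points are
  eventually separated.\<close>

definition hit_residues :: "'p::prime_card padic \<Rightarrow> 'p padic set \<Rightarrow> nat \<Rightarrow> nat set" where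
  "hit_residues a Z n = {c. c < CARD('p) ^ n \<and> Z \<inter> padic_disc (a + of_nat c) (- int n) \<noteq> {}}"

lemma finite_hit_residues [simp]: "finite (hit_residues a Z n)"
  by (simp add: hit_residues_def)

lemma card_hit_residues_mono:
  fixes Z :: "'p::prime_card padic set"
  assumes Z: "Z \<subseteq> padic_disc a 0"
  shows "card (hit_residues a Z n) \<le> card (hit_residues a Z (Suc n))"
proof -
  let ?q = "CARD('p) ^ n"
  have "hit_residues a Z n \<subseteq> (\<lambda>c. c mod ?q) ` hit_residues a Z (Suc n)"
  proof
    fix c assume c: "c \<in> hit_residues a Z n"
    then obtain t where t: "t \<in> Z" "t \<in> padic_disc (a + of_nat c) (- int n)" "c < ?q"
      by (auto simp: hit_residues_def)
    obtain c' where c': "c' < CARD('p) ^ Suc n" "t \<in> padic_disc (a + of_nat c') (- int (Suc n))"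
      using unit_disc_cover[of t a "Suc n"] Z t by blast
    have "t \<in> padic_disc (a + of_nat c') (- int n)"
      using c'(2) padic_disc_mono[of "- int (Suc n)" "- int n" "a + of_nat c'"] by auto
    hence "padic_norm ((t - (a + of_nat c')) - (t - (a + of_nat c))) \<le> real CARD('p) powi (- int n)"
      using t(2) unfolding in_padic_disc by (rule padic_norm_diff_le)
    hence "padic_norm (of_nat c - of_nat c' :: 'p padic) \<le> real CARD('p) powi (- int n)" by simp
    hence "c = c' mod ?q" using t(3) by (subst (asm) padic_norm_of_nat_diff_le_iff) simp
    thus "c \<in> (\<lambda>c. c mod ?q) ` hit_residues a Z (Suc n)"
      using c' t(1) by (auto simp: hit_residues_def)
  qed
  hence "card (hit_residues a Z n) \<le> card ((\<lambda>c. c mod ?q) ` hit_residues a Z (Suc n))"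
    by (intro card_mono) auto
  also have "\<dots> \<le> card (hit_residues a Z (Suc n))" by (rule card_image_le) simp
  finally show ?thesis .
qed

lemma card_hit_residues_le:
  fixes Z :: "'p::prime_card padic set"
  assumes "finite Z"
  shows "card (hit_residues a Z n) \<le> card Z"
proof -
  have "\<forall>c\<in>hit_residues a Z n. \<exists>t. t \<in> Z \<and> t \<in> padic_disc (a + of_nat c) (- int n)"
    by (auto simp: hit_residues_def)
  then obtain f where f: "\<forall>c\<in>hit_residues a Z n. f c \<in> Z \<and> f c \<in> padic_disc (a + of_nat c) (- int n)"
    by metis
  have "inj_on f (hit_residues a Z n)"
  proof (rule inj_onI)
    fix c c' assume c: "c \<in> hit_residues a Z n" "c' \<in> hit_residues a Z n" "f c = f c'"
    show "c = c'"
      using f c by (intro unit_disc_cover_unique[of "f c" a c n c']) (auto simp: hit_residues_def)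
  qed
  thus ?thesis using f assms by (intro card_inj_on_le[of f]) auto
qed

lemma finite_subset_hit_residues:
  fixes Z :: "'p::prime_card padic set"
  assumes Z: "Z \<subseteq> padic_disc a 0" and F: "finite F" "F \<subseteq> Z"
  shows "\<exists>n. card F \<le> card (hit_residues a Z n)"
proof -
  define \<delta> where "\<delta> = Min (insert 1 ((\<lambda>(x, y). padic_norm (x - y)) ` {(x, y) \<in> F \<times> F. x \<noteq> y}))"
  have fin: "finite (insert 1 ((\<lambda>(x, y). padic_norm (x - y)) ` {(x, y) \<in> F \<times> F. x \<noteq> y}))"
    using F(1) by (auto intro!: finite_imageI intro: finite_subset[of _ "F \<times> F"])
  have "\<delta> > 0" unfolding \<delta>_def
    by (subst Min_gr_iff[OF fin]) (auto simp: less_le)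
  then obtain n where n: "real CARD('p) powi (- int n) < \<delta>" using ex_powi_less by blast
  have sep: "x = y" if "x \<in> F" "y \<in> F" "padic_norm (x - y) \<le> real CARD('p) powi (- int n)" for x y
  proof (rule ccontr)
    assume "x \<noteq> y"
    hence "\<delta> \<le> padic_norm (x - y)" unfolding \<delta>_def using that by (intro Min_le[OF fin]) auto
    thus False using n that(3) by simp
  qed
  have "\<forall>t\<in>F. \<exists>c. c < CARD('p) ^ n \<and> t \<in> padic_disc (a + of_nat c) (- int n)"
    using Z F(2) unit_disc_cover[of _ a n] by (metis subsetD)
  then obtain f where f: "\<forall>t\<in>F. f t < CARD('p) ^ n \<and> t \<in> padic_disc (a + of_nat (f t)) (- int n)"
    by metis
  have "inj_on f F"
  proof (rule inj_onI)
    fix x y assume xy: "x \<in> F" "y \<in> F" "f x = f y"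
    have "padic_norm (x - (a + of_nat (f x))) \<le> real CARD('p) powi (- int n)"
      "padic_norm (y - (a + of_nat (f x))) \<le> real CARD('p) powi (- int n)"
      using f xy by (auto simp: in_padic_disc)
    from padic_norm_diff_le[OF this] show "x = y" using sep xy by simp
  qed
  moreover have "f ` F \<subseteq> hit_residues a Z n" using f F(2) by (auto simp: hit_residues_def)
  ultimately show ?thesis by (intro exI[of _ n] card_inj_on_le[of f]) auto
qed

lemma count_eq_SUP_hit_residues:
  fixes Z :: "'p::prime_card padic set"
  assumes Z: "Z \<subseteq> padic_disc a 0"
  shows "emeasure (count_space UNIV) Z = (SUP n. of_nat (card (hit_residues a Z n)))"
proof (cases "finite Z")
  case True
  obtain n where n: "card Z \<le> card (hit_residues a Z n)"
    using finite_subset_hit_residues[OF Z True] by auto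
  show ?thesis
  proof (rule antisym)
    show "emeasure (count_space UNIV) Z \<le> (SUP n. of_nat (card (hit_residues a Z n)))"
      using True n by (intro SUP_upper2[of n]) auto
    show "(SUP n. of_nat (card (hit_residues a Z n))) \<le> emeasure (count_space UNIV) Z"
      using True card_hit_residues_le[OF True] by (intro SUP_least) auto
  qed
next
  case False
  have "(SUP n. of_nat (card (hit_residues a Z n)) :: ennreal) = \<top>"
  proof (rule ccontr)
    assume "(SUP n. of_nat (card (hit_residues a Z n)) :: ennreal) \<noteq> \<top>"
    then obtain N where N: "(SUP n. of_nat (card (hit_residues a Z n)) :: ennreal) < of_nat N"
      using ennreal_Ex_less_of_nat[of "SUP n. of_nat (card (hit_residues a Z n))"]
      unfolding less_top by blast
    obtain F where F: "finite F" "card F = N" "F \<subseteq> Z"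
      using infinite_arbitrarily_large[OF False] by blast
    obtain n where "N \<le> card (hit_residues a Z n)"
      using finite_subset_hit_residues[OF Z F(1,3)] F(2) by auto
    hence "of_nat N \<le> (SUP n. of_nat (card (hit_residues a Z n)) :: ennreal)"
      by (intro SUP_upper2[of n]) auto
    thus False using N by simp
  qed
  moreover have "emeasure (count_space UNIV) Z = \<top>" using False by simp
  ultimately show ?thesis by (rule trans[OF _ sym, rotated])
qed

text \<open>A continuous function on a compact set has a zero if and only if it takes arbitrarily small
  values there, and as the set is open a countable dense subset detects these values.\<close>

lemma sets_zero_event:
  fixes F :: "'b \<Rightarrow> 'p::prime_card padic \<Rightarrow> 'p padic"
  assumes B: "compact B" "open B"
    and meas: "\<And>t. t \<in> B \<Longrightarrow> (\<lambda>\<omega>. F \<omega> t) \<in> borel_measurable M"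
    and cont: "\<And>\<omega>. \<omega> \<in> space M \<Longrightarrow> continuous_on B (F \<omega>)"
  shows "{\<omega> \<in> space M. \<exists>t\<in>B. F \<omega> t = 0} \<in> sets M"
proof -
  obtain Q :: "'p padic set" where Q: "countable Q" "\<And>X. open X \<Longrightarrow> X \<noteq> {} \<Longrightarrow> \<exists>x. x \<in> Q \<and> x \<in> X"
    using countable_dense_setE by metis
  have "(\<exists>t\<in>B. F \<omega> t = 0) \<longleftrightarrow> (\<forall>j. \<exists>t\<in>Q \<inter> B. padic_norm (F \<omega> t) < inverse (real (Suc j)))"
    if \<omega>: "\<omega> \<in> space M" for \<omega>
  proof
    assume "\<exists>t\<in>B. F \<omega> t = 0"
    then obtain t where t: "t \<in> B" "F \<omega> t = 0" by auto
    show "\<forall>j. \<exists>t\<in>Q \<inter> B. padic_norm (F \<omega> t) < inverse (real (Suc j))"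
    proof
      fix j
      let ?U = "B \<inter> F \<omega> -` ball 0 (inverse (real (Suc j)))"
      have "open ?U" by (rule continuous_open_preimage[OF cont[OF \<omega>] B(2) open_ball])
      moreover have "t \<in> ?U" using t by simp
      ultimately obtain s where "s \<in> Q" "s \<in> ?U" using Q(2) by blast
      thus "\<exists>t\<in>Q \<inter> B. padic_norm (F \<omega> t) < inverse (real (Suc j))"
        by (auto simp: dist_padic_def)
    qed
  next
    assume small: "\<forall>j. \<exists>t\<in>Q \<inter> B. padic_norm (F \<omega> t) < inverse (real (Suc j))"
    hence "B \<noteq> {}" by auto
    moreover have "continuous_on B (\<lambda>t. padic_norm (F \<omega> t))"
      using continuous_on_compose2[OF continuous_on_padic_norm cont[OF \<omega>]] by simp
    ultimately obtain x where x: "x \<in> B" "\<And>t. t \<in> B \<Longrightarrow> padic_norm (F \<omega> x) \<le> padic_norm (F \<omega> t)"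
      using continuous_attains_inf[OF B(1)] by blast
    have "padic_norm (F \<omega> x) \<le> inverse (real (Suc j))" for j
      using small x(2) by (meson IntE order_trans less_imp_le)
    hence "padic_norm (F \<omega> x) \<le> 0"
      by (intro LIMSEQ_le_const[OF LIMSEQ_inverse_real_of_nat]) auto
    hence "F \<omega> x = 0" using padic_norm_nonneg[of "F \<omega> x"] by (simp add: order_antisym)
    thus "\<exists>t\<in>B. F \<omega> t = 0" using x(1) by blast
  qed
  hence "{\<omega> \<in> space M. \<exists>t\<in>B. F \<omega> t = 0}
    = {\<omega> \<in> space M. \<forall>j. \<exists>t\<in>Q \<inter> B. padic_norm (F \<omega> t) < inverse (real (Suc j))}" by auto
  also have "\<dots> = (\<Inter>j. \<Union>t\<in>Q \<inter> B. {\<omega> \<in> space M. padic_norm (F \<omega> t) < inverse (real (Suc j))})"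
    by auto
  also have "\<dots> \<in> sets M"
  proof (intro sets.countable_INT'[of UNIV] image_subsetI sets.countable_UN')
    show "countable (Q \<inter> B)" using Q(1) by blast
    fix t j assume "t \<in> Q \<inter> B"
    hence [measurable]: "(\<lambda>\<omega>. F \<omega> t) \<in> borel_measurable M" using meas by simp
    show "{\<omega> \<in> space M. padic_norm (F \<omega> t) < inverse (real (Suc j))} \<in> sets M" by measurable
  qed auto
  finally show ?thesis .
qed

text \<open>The expected number of zeros is the limit of sums of probabilities that a small disc
  contains a zero. Monotone convergence applies because the number of hit cells increases.\<close>

lemma num_zeros_unit_disc:
  fixes F :: "'b \<Rightarrow> 'p::prime_card padic \<Rightarrow> 'p padic"
  assumes meas: "\<And>t. t \<in> padic_disc a 0 \<Longrightarrow> (\<lambda>\<omega>. F \<omega> t) \<in> borel_measurable M"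
    and cont: "\<And>\<omega>. \<omega> \<in> space M \<Longrightarrow> continuous_on (padic_disc a 0) (F \<omega>)"
  defines "E \<equiv> \<lambda>n c. {\<omega> \<in> space M. \<exists>t\<in>padic_disc (a + of_nat c) (- int n). F \<omega> t = 0}"
  shows sets_zero_in_sub_disc: "E n c \<in> sets M"
    and measurable_num_zeros_unit_disc: "(\<lambda>\<omega>. num_zeros (F \<omega>) (padic_disc a 0)) \<in> borel_measurable M"
    and LIMSEQ_num_zeros_unit_disc: "(\<lambda>n. \<Sum>c<CARD('p) ^ n. emeasure M (E n c))
      \<longlonglongrightarrow> (\<integral>\<^sup>+ \<omega>. num_zeros (F \<omega>) (padic_disc a 0) \<partial>M)"
proof -
  have E: "E n c \<in> sets M" for n c
    unfolding E_def using sub_disc_subset_unit_disc[of a c n]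
    by (intro sets_zero_event compact_sub_disc open_padic_disc meas continuous_on_subset[OF cont]) auto
  thus "E n c \<in> sets M" .
  let ?N = "\<lambda>n \<omega>. of_nat (card (hit_residues a {t \<in> padic_disc a 0. F \<omega> t = 0} n)) :: ennreal"
  have hit: "{t \<in> padic_disc a 0. F \<omega> t = 0} \<inter> padic_disc (a + of_nat c) (- int n) \<noteq> {}
    \<longleftrightarrow> (\<exists>t\<in>padic_disc (a + of_nat c) (- int n). F \<omega> t = 0)" for \<omega> c n
    using sub_disc_subset_unit_disc[of a c n] by auto
  have N: "?N n \<omega> = (\<Sum>c<CARD('p) ^ n. indicator (E n c) \<omega>)" if "\<omega> \<in> space M" for n \<omega>
  proof -
    have "hit_residues a {t \<in> padic_disc a 0. F \<omega> t = 0} n = {c\<in>{..<CARD('p) ^ n}. \<omega> \<in> E n c}"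
      unfolding hit_residues_def hit E_def using that by auto
    thus ?thesis by (simp add: indicator_def sum.If_cases Int_def flip: of_nat_sum)
  qed
  have nz: "num_zeros (F \<omega>) (padic_disc a 0) = (SUP n. ?N n \<omega>)" for \<omega>
    unfolding num_zeros_def by (rule count_eq_SUP_hit_residues) auto
  have Nm: "?N n \<in> borel_measurable M" for n
    using E by (subst measurable_cong[OF N]) auto
  show "(\<lambda>\<omega>. num_zeros (F \<omega>) (padic_disc a 0)) \<in> borel_measurable M"
    unfolding nz using Nm by (intro borel_measurable_SUP) auto
  have inc: "incseq ?N"
    by (intro incseq_SucI le_funI) (auto intro!: card_hit_residues_mono)
  have "(\<integral>\<^sup>+ \<omega>. num_zeros (F \<omega>) (padic_disc a 0) \<partial>M) = (SUP n. \<integral>\<^sup>+ \<omega>. ?N n \<omega> \<partial>M)"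
    unfolding nz by (rule nn_integral_monotone_convergence_SUP[OF inc Nm])
  moreover have "incseq (\<lambda>n. \<integral>\<^sup>+ \<omega>. ?N n \<omega> \<partial>M)"
    using inc by (auto simp: incseq_def le_fun_def intro!: nn_integral_mono)
  moreover have "(\<lambda>n. (\<integral>\<^sup>+ \<omega>. ?N n \<omega> \<partial>M)) = (\<lambda>n. \<Sum>c<CARD('p) ^ n. emeasure M (E n c))"
    using E by (intro ext, subst nn_integral_cong[OF N]) (simp_all add: nn_integral_sum)
  ultimately show "(\<lambda>n. \<Sum>c<CARD('p) ^ n. emeasure M (E n c))
      \<longlonglongrightarrow> (\<integral>\<^sup>+ \<omega>. num_zeros (F \<omega>) (padic_disc a 0) \<partial>M)"
    using LIMSEQ_SUP by metis
qed

section \<open>Uniformly distributed p-adic integers\<close>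

text \<open>The only consequence of uniform distribution that is used below: every residue class modulo
  \<open>p\<^sup>n\<close> has probability \<open>p\<close> to the power \<open>-n\<close>.\<close>

definition residue_uniform :: "'a measure \<Rightarrow> ('a \<Rightarrow> 'p::prime_card padic) \<Rightarrow> bool" where
  "residue_uniform M X \<longleftrightarrow> X \<in> borel_measurable M \<and>
     (\<forall>c n. padic_norm c \<le> 1 \<longrightarrow>
       measure M {\<omega> \<in> space M. X \<omega> \<in> padic_disc c (- int n)} = real CARD('p) powi (- int n))"

lemma padic_disc_borel [measurable]: "padic_disc a k \<in> sets borel"
  using open_padic_disc by (rule borel_open)

lemma residue_uniform_measurable: "residue_uniform M X \<Longrightarrow> X \<in> borel_measurable M"
  by (simp add: residue_uniform_def)

lemma residue_uniformD:
  fixes X :: "'a \<Rightarrow> 'p::prime_card padic"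
  shows "residue_uniform M X \<Longrightarrow> padic_norm c \<le> 1 \<Longrightarrow>
    measure M {\<omega> \<in> space M. X \<omega> \<in> padic_disc c (- int n)} = real CARD('p) powi (- int n)"
  by (simp add: residue_uniform_def)

lemma disjoint_sub_discs:
  "disjoint_family_on (\<lambda>c. padic_disc (a + of_nat c :: 'p::prime_card padic) (- int n)) {..<CARD('p) ^ n}"
  unfolding disjoint_family_on_def using unit_disc_cover_unique[of _ a] by blast

lemma Union_sub_discs:
  "(\<Union>c<CARD('p) ^ n. padic_disc (a + of_nat c :: 'p::prime_card padic) (- int n)) = padic_disc a 0"
  using sub_disc_subset_unit_disc[of a _ n] unit_disc_cover[of _ a n] by blast

text \<open>The \<open>p\<^sup>n\<close> residue discs are translates of each other, hence have equal Haar measure, and they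
  partition a space of measure one.\<close>

lemma residue_uniform_if_uniform:
  fixes X :: "'a \<Rightarrow> 'p::prime_card padic"
  assumes X: "uniform_padic_integers M X"
  shows "residue_uniform M X"
proof -
  define \<mu> where "\<mu> = restrict_space (distr M borel X) (padic_integers :: 'p padic set)"
  have Xm [measurable]: "X \<in> borel_measurable M" using X by (simp add: uniform_padic_integers_def)
  have haar: "haar_prob_padic_integers \<mu>" using X by (simp add: uniform_padic_integers_def \<mu>_def)
  have Z: "padic_integers \<inter> space (distr M borel X) \<in> sets (distr M borel X)"
    by (simp add: padic_integers_eq_disc)
  have sets: "A \<in> sets \<mu> \<longleftrightarrow> A \<subseteq> padic_integers \<and> A \<in> sets borel" for A
    unfolding \<mu>_def using sets_restrict_space_iff[OF Z] by simp
  have em: "emeasure \<mu> A = emeasure M (X -` A \<inter> space M)" if "A \<in> sets \<mu>" for A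
    using that sets Z unfolding \<mu>_def by (simp add: emeasure_restrict_space emeasure_distr)
  have disc_sets: "padic_disc c (- int n) \<in> sets \<mu>" if "padic_norm c \<le> 1" for c n
  proof -
    have "c \<in> padic_disc 0 0" using that by (simp add: in_padic_disc)
    thus ?thesis
      using padic_disc_recentre[of c 0 0] padic_disc_mono[of "- int n" 0 c]
      by (simp add: sets padic_integers_eq_disc)
  qed
  have transl: "emeasure \<mu> (padic_disc c (- int n)) = emeasure \<mu> (padic_disc 0 (- int n))"
    if c: "padic_norm c \<le> 1" for c n
  proof -
    have img: "(+) c ` padic_disc 0 (- int n) = padic_disc c (- int n)"
    proof
      show "padic_disc c (- int n) \<subseteq> (+) c ` padic_disc 0 (- int n)"
      proof
        fix x assume "x \<in> padic_disc c (- int n)"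
        thus "x \<in> (+) c ` padic_disc 0 (- int n)"
          by (intro image_eqI[of _ _ "x - c"]) (auto simp: in_padic_disc)
      qed
      show "(+) c ` padic_disc 0 (- int n) \<subseteq> padic_disc c (- int n)"
        by (auto simp: in_padic_disc)
    qed
    have inv: "\<forall>a\<in>padic_integers. \<forall>A\<in>sets \<mu>. emeasure \<mu> ((+) a ` A) = emeasure \<mu> A"
      using haar unfolding haar_prob_padic_integers_def by (elim conjE)
    have "c \<in> padic_integers" using c by (simp add: padic_integers_def)
    have "emeasure \<mu> ((+) c ` padic_disc 0 (- int n)) = emeasure \<mu> (padic_disc 0 (- int n))"
      by (rule bspec[OF bspec[OF inv \<open>c \<in> padic_integers\<close>] disc_sets]) simp
    thus ?thesis unfolding img .
  qed
  have disc_mass: "emeasure \<mu> (padic_disc 0 (- int n)) = ennreal (real CARD('p) powi (- int n))" for n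
  proof -
    interpret \<mu>: prob_space \<mu> using haar by (simp add: haar_prob_padic_integers_def)
    have "space \<mu> = padic_disc 0 0"
      by (simp add: \<mu>_def space_restrict_space padic_integers_eq_disc)
    hence "1 = emeasure \<mu> (\<Union>c<CARD('p) ^ n. padic_disc (0 + of_nat c) (- int n))"
      using \<mu>.emeasure_space_1 by (simp only: Union_sub_discs)
    also have "\<dots> = (\<Sum>c<CARD('p) ^ n. emeasure \<mu> (padic_disc (0 + of_nat c) (- int n)))"
      using disc_sets disjoint_sub_discs[of 0 n] by (intro sum_emeasure[symmetric]) auto
    also have "\<dots> = (\<Sum>c<CARD('p) ^ n. emeasure \<mu> (padic_disc 0 (- int n)))"
      by (intro sum.cong transl) simp_all
    also have "\<dots> = of_nat (CARD('p) ^ n) * emeasure \<mu> (padic_disc 0 (- int n))"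
      by simp
    also have "\<dots> = ennreal (real CARD('p) ^ n * measure \<mu> (padic_disc 0 (- int n)))"
      by (simp add: \<mu>.emeasure_eq_measure ennreal_mult' ennreal_of_nat_eq_real_of_nat)
    finally have "real CARD('p) ^ n * measure \<mu> (padic_disc 0 (- int n)) = 1"
      by (simp add: ennreal_eq_1)
    hence "measure \<mu> (padic_disc 0 (- int n)) = real CARD('p) powi (- int n)"
      by (simp add: power_int_minus field_simps)
    thus ?thesis by (simp add: \<mu>.emeasure_eq_measure)
  qed
  have "measure M {\<omega> \<in> space M. X \<omega> \<in> padic_disc c (- int n)} = real CARD('p) powi (- int n)"
    if c: "padic_norm c \<le> 1" for c n
  proof -
    have "{\<omega> \<in> space M. X \<omega> \<in> padic_disc c (- int n)} = X -` padic_disc c (- int n) \<inter> space M" by auto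
    hence "emeasure M {\<omega> \<in> space M. X \<omega> \<in> padic_disc c (- int n)} = ennreal (real CARD('p) powi (- int n))"
      using trans[OF em[OF disc_sets[OF c], symmetric] trans[OF transl[OF c] disc_mass]] by simp
    thus ?thesis by (simp add: measure_def less_imp_le)
  qed
  thus ?thesis using Xm by (simp add: residue_uniform_def)
qed

context prob_space
begin

lemma AE_residue_uniform:
  assumes "residue_uniform M (X :: 'a \<Rightarrow> 'p::prime_card padic)"
  shows "AE \<omega> in M. padic_norm (X \<omega>) \<le> 1"
proof -
  have [measurable]: "X \<in> borel_measurable M" using assms by (rule residue_uniform_measurable)
  have "prob {\<omega> \<in> space M. X \<omega> \<in> padic_disc 0 (- int 0)} = real CARD('p) powi (- int 0)"
    using assms by (rule residue_uniformD) simp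
  hence "AE \<omega> in M. X \<omega> \<in> padic_disc 0 (- int 0)"
    by (intro prob_Collect_eq_1[THEN iffD1]) simp_all
  thus ?thesis by eventually_elim (simp add: in_padic_disc)
qed

text \<open>Conditioning on the residue class of \<open>Y\<close> replaces an integral over the distribution of \<open>Y\<close> by a
  finite sum.\<close>

lemma prob_split_residues:
  fixes Y :: "'a \<Rightarrow> 'p::prime_card padic"
  assumes [measurable]: "Y \<in> borel_measurable M" "B \<in> events"
    and Y: "AE \<omega> in M. padic_norm (Y \<omega>) \<le> 1"
  shows "prob B = (\<Sum>c<CARD('p) ^ n. prob {\<omega> \<in> B. Y \<omega> \<in> padic_disc (of_nat c) (- int n)})"
proof -
  have B: "{\<omega> \<in> B. Y \<omega> \<in> padic_disc c k} = B \<inter> (Y -` padic_disc c k \<inter> space M)" for c k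
    using sets.sets_into_space[OF assms(2)] by auto
  have "prob B = prob {\<omega> \<in> B. Y \<omega> \<in> padic_disc 0 0}"
    unfolding B using Y by (intro finite_measure_eq_AE) (auto simp: in_padic_disc elim!: eventually_mono)
  also have "{\<omega> \<in> B. Y \<omega> \<in> padic_disc 0 0}
      = (\<Union>c<CARD('p) ^ n. {\<omega> \<in> B. Y \<omega> \<in> padic_disc (of_nat c) (- int n)})"
    using Union_sub_discs[of "0 :: 'p padic" n] by auto
  also have "prob \<dots> = (\<Sum>c<CARD('p) ^ n. prob {\<omega> \<in> B. Y \<omega> \<in> padic_disc (of_nat c) (- int n)})"
    using disjoint_sub_discs[of "0 :: 'p padic" n] unfolding B
    by (intro finite_measure_finite_Union) (auto simp: disjoint_family_on_def)
  finally show ?thesis .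
qed

text \<open>Adding an independent p-adic integer does not disturb uniformity, even conditionally on that
  integer: on the event that \<open>f (W \<omega>)\<close> lies in the class of \<open>c\<close>, the sum is small exactly if \<open>X\<close>
  lies in the class of \<open>-c\<close>, an event whose probability depends only on \<open>n\<close>.\<close>

lemma prob_shifted_uniform:
  fixes X :: "'a \<Rightarrow> 'p::prime_card padic"
  assumes X: "residue_uniform M X" and W [measurable]: "W \<in> measurable M N"
    and ind: "\<And>B A. B \<in> sets borel \<Longrightarrow> A \<in> sets N \<Longrightarrow>
      prob {\<omega> \<in> space M. X \<omega> \<in> B \<and> W \<omega> \<in> A}
        = prob {\<omega> \<in> space M. X \<omega> \<in> B} * prob {\<omega> \<in> space M. W \<omega> \<in> A}"
    and f [measurable]: "f \<in> borel_measurable N" and A [measurable]: "A \<in> sets N"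
    and fW: "AE \<omega> in M. padic_norm (f (W \<omega>)) \<le> 1"
  shows "prob {\<omega> \<in> space M. W \<omega> \<in> A \<and> X \<omega> + f (W \<omega>) \<in> padic_disc 0 (- int n)}
    = real CARD('p) powi (- int n) * prob {\<omega> \<in> space M. W \<omega> \<in> A}"
proof -
  have [measurable]: "X \<in> borel_measurable M" using X by (rule residue_uniform_measurable)
  let ?r = "real CARD('p) powi (- int n)"
  let ?Ac = "\<lambda>c. {\<omega> \<in> {\<omega> \<in> space M. W \<omega> \<in> A}. f (W \<omega>) \<in> padic_disc (of_nat c) (- int n)}"
  have "prob {\<omega> \<in> space M. W \<omega> \<in> A \<and> X \<omega> + f (W \<omega>) \<in> padic_disc 0 (- int n)}
    = (\<Sum>c<CARD('p) ^ n. prob {\<omega> \<in> {\<omega> \<in> space M. W \<omega> \<in> A \<and> X \<omega> + f (W \<omega>) \<in> padic_disc 0 (- int n)}.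
        f (W \<omega>) \<in> padic_disc (of_nat c) (- int n)})"
    by (rule prob_split_residues[OF _ _ fW]) measurable
  also have "\<dots> = (\<Sum>c<CARD('p) ^ n. ?r * prob (?Ac c))"
  proof (rule sum.cong[OF refl])
    fix c
    let ?Y = "{w \<in> space N. w \<in> A \<and> f w \<in> padic_disc (of_nat c) (- int n)}"
    have iff: "X \<omega> + f (W \<omega>) \<in> padic_disc 0 (- int n) \<longleftrightarrow> X \<omega> \<in> padic_disc (- of_nat c) (- int n)"
      if "f (W \<omega>) \<in> padic_disc (of_nat c) (- int n)" for \<omega>
    proof -
      have eq: "X \<omega> - - of_nat c = (X \<omega> + f (W \<omega>)) - (f (W \<omega>) - of_nat c)"
        "X \<omega> + f (W \<omega>) - 0 = (X \<omega> - - of_nat c) + (f (W \<omega>) - of_nat c)" by simp_all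
      show ?thesis
        unfolding in_padic_disc using that[unfolded in_padic_disc]
        by (metis eq padic_norm_add_le padic_norm_diff_le diff_zero)
    qed
    have "{\<omega> \<in> {\<omega> \<in> space M. W \<omega> \<in> A \<and> X \<omega> + f (W \<omega>) \<in> padic_disc 0 (- int n)}.
        f (W \<omega>) \<in> padic_disc (of_nat c) (- int n)}
      = {\<omega> \<in> space M. X \<omega> \<in> padic_disc (- of_nat c) (- int n) \<and> W \<omega> \<in> ?Y}"
      using iff measurable_space[OF W] by auto
    hence "prob {\<omega> \<in> {\<omega> \<in> space M. W \<omega> \<in> A \<and> X \<omega> + f (W \<omega>) \<in> padic_disc 0 (- int n)}.
        f (W \<omega>) \<in> padic_disc (of_nat c) (- int n)}
      = prob {\<omega> \<in> space M. X \<omega> \<in> padic_disc (- of_nat c) (- int n)} * prob {\<omega> \<in> space M. W \<omega> \<in> ?Y}"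
      using ind[of "padic_disc (- of_nat c) (- int n)" ?Y] by simp
    also have "prob {\<omega> \<in> space M. X \<omega> \<in> padic_disc (- of_nat c) (- int n)} = ?r"
      using X by (rule residue_uniformD) simp
    also have "{\<omega> \<in> space M. W \<omega> \<in> ?Y} = ?Ac c"
      using measurable_space[OF W] by auto
    finally show "prob {\<omega> \<in> {\<omega> \<in> space M. W \<omega> \<in> A \<and> X \<omega> + f (W \<omega>) \<in> padic_disc 0 (- int n)}.
        f (W \<omega>) \<in> padic_disc (of_nat c) (- int n)} = ?r * prob (?Ac c)" .
  qed
  also have "\<dots> = ?r * (\<Sum>c<CARD('p) ^ n. prob (?Ac c))" by (simp add: sum_distrib_left)
  also have "(\<Sum>c<CARD('p) ^ n. prob (?Ac c)) = prob {\<omega> \<in> space M. W \<omega> \<in> A}"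
    by (rule prob_split_residues[symmetric, OF _ _ fW]) measurable
  finally show ?thesis .
qed

text \<open>Independence of one variable from the tuple of the others, stated for events because the two
  sides take values in different types.\<close>

lemma prob_component_rest:
  assumes ind: "indep_vars M' X (insert i I)" "i \<notin> I" and B: "B \<in> sets (M' i)" and A: "A \<in> sets (PiM I M')"
  shows "prob {\<omega> \<in> space M. X i \<omega> \<in> B \<and> restrict (\<lambda>k. X k \<omega>) I \<in> A}
    = prob {\<omega> \<in> space M. X i \<omega> \<in> B} * prob {\<omega> \<in> space M. restrict (\<lambda>k. X k \<omega>) I \<in> A}"
proof -
  have iv: "indep_var (PiM {i} M') (\<lambda>\<omega>. restrict (\<lambda>k. X k \<omega>) {i}) (PiM I M') (\<lambda>\<omega>. restrict (\<lambda>k. X k \<omega>) I)"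
    using ind by (intro indep_var_restrict[OF ind(1)]) auto
  have "{w \<in> space (PiM {i} M'). w i \<in> B} \<in> sets (PiM {i} M')"
    using B by measurable
  from indep_varD[OF iv this A]
  have "prob ((\<lambda>\<omega>. (restrict (\<lambda>k. X k \<omega>) {i}, restrict (\<lambda>k. X k \<omega>) I)) -`
      ({w \<in> space (PiM {i} M'). w i \<in> B} \<times> A) \<inter> space M)
    = prob ((\<lambda>\<omega>. restrict (\<lambda>k. X k \<omega>) {i}) -` {w \<in> space (PiM {i} M'). w i \<in> B} \<inter> space M) *
      prob ((\<lambda>\<omega>. restrict (\<lambda>k. X k \<omega>) I) -` A \<inter> space M)" .
  moreover have "restrict (\<lambda>k. X k \<omega>) {i} \<in> space (PiM {i} M')" if "\<omega> \<in> space M" for \<omega>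
    using measurable_space[OF indep_var_rv1[OF iv] that] .
  hence "(\<lambda>\<omega>. (restrict (\<lambda>k. X k \<omega>) {i}, restrict (\<lambda>k. X k \<omega>) I)) -`
      ({w \<in> space (PiM {i} M'). w i \<in> B} \<times> A) \<inter> space M
      = {\<omega> \<in> space M. X i \<omega> \<in> B \<and> restrict (\<lambda>k. X k \<omega>) I \<in> A}"
    "(\<lambda>\<omega>. restrict (\<lambda>k. X k \<omega>) {i}) -` {w \<in> space (PiM {i} M'). w i \<in> B} \<inter> space M
      = {\<omega> \<in> space M. X i \<omega> \<in> B}"
    "(\<lambda>\<omega>. restrict (\<lambda>k. X k \<omega>) I) -` A \<inter> space M = {\<omega> \<in> space M. restrict (\<lambda>k. X k \<omega>) I \<in> A}"
    by auto
  ultimately show ?thesis by simp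
qed

end

section \<open>The expected number of zeros in a unit disc\<close>

text \<open>The coefficient \<open>k\<^sub>0\<close> is the one whose coordinate function is normalised to be constantly 1; the
  others are multiplied by functions \<open>r k\<close>.\<close>

locale uniform_coefficients = prob_space M
  for M :: "'a measure" +
  fixes \<zeta> :: "'k \<Rightarrow> 'a \<Rightarrow> 'p::prime_card padic" and k\<^sub>0 :: 'k and K :: "'k set"
  assumes finite_K: "finite K" and k0_notin_K: "k\<^sub>0 \<notin> K"
    and indep: "indep_vars (\<lambda>_. borel) \<zeta> (insert k\<^sub>0 K)"
    and uniform: "\<And>k. k \<in> insert k\<^sub>0 K \<Longrightarrow> residue_uniform M (\<zeta> k)"
begin

lemma coefficient_measurable [measurable]: "k \<in> insert k\<^sub>0 K \<Longrightarrow> \<zeta> k \<in> borel_measurable M"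
  using uniform residue_uniform_measurable by blast

lemma AE_coefficients_integral: "AE \<omega> in M. \<forall>k\<in>insert k\<^sub>0 K. padic_norm (\<zeta> k \<omega>) \<le> 1"
  using finite_K uniform by (intro AE_finite_allI AE_residue_uniform) auto

text \<open>The linear form \<open>\<Sum>k\<in>K. \<zeta> k * D k\<close> will be the derivative of the random function at a point and
  the other sum its value there. The value is uniform and independent of the derivative, because it
  contains the extra coefficient \<open>\<zeta> k\<^sub>0\<close>. The derivative is uniform on the disc of radius
  \<open>p\<close> to the power \<open>e\<close>, the maximum of the \<open>\<bar>D k\<bar>\<close>: divide by a coefficient \<open>D k1\<close> of maximal
  absolute value and regard \<open>\<zeta> k1\<close> as shifted by the remaining terms.\<close>

lemma prob_joint:
  assumes r: "\<And>k. k \<in> K \<Longrightarrow> padic_norm (r k) \<le> 1"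
    and D: "\<And>k. k \<in> K \<Longrightarrow> padic_norm (D k) \<le> real CARD('p) powi e"
    and k1: "k1 \<in> K" "padic_norm (D k1) = real CARD('p) powi e"
  shows "prob {\<omega> \<in> space M. (\<Sum>k\<in>K. \<zeta> k \<omega> * D k) \<in> padic_disc 0 (e - int i) \<and>
      \<zeta> k\<^sub>0 \<omega> + (\<Sum>k\<in>K. \<zeta> k \<omega> * r k) \<in> padic_disc 0 (- int n)}
    = real CARD('p) powi (- int n) * real CARD('p) powi (- int i)"
proof -
  let ?N = "\<lambda>J. PiM J (\<lambda>_. borel) :: ('k \<Rightarrow> 'p padic) measure"
  let ?W = "\<lambda>J \<omega>. restrict (\<lambda>k. \<zeta> k \<omega>) J"
  have comp [measurable]: "(\<lambda>w. w k) \<in> borel_measurable (?N J)" if "k \<in> J" for k J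
    using that by measurable
  have lin: "(\<lambda>w. \<Sum>k\<in>J. w k * c k) \<in> borel_measurable (?N J)" for c and J :: "'k set"
    by (intro borel_measurable_padic_sum borel_measurable_padic_times comp) auto
  have Wm: "?W J \<in> measurable M (?N J)" if "J \<subseteq> insert k\<^sub>0 K" for J
    using that by (intro measurable_restrict coefficient_measurable) auto
  have sumW: "(\<Sum>k\<in>J. ?W J \<omega> k * c k) = (\<Sum>k\<in>J. \<zeta> k \<omega> * c k)" for J \<omega> c
    by (intro sum.cong) simp_all
  have AE_lin: "AE \<omega> in M. padic_norm (\<Sum>k\<in>J. ?W J \<omega> k * c k) \<le> 1"
    if "J \<subseteq> K" "\<And>k. k \<in> J \<Longrightarrow> padic_norm (c k) \<le> 1" for J c
    using AE_coefficients_integral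
  proof eventually_elim
    case (elim \<omega>)
    show ?case unfolding sumW
    proof (rule padic_norm_sum_le)
      fix k assume "k \<in> J"
      thus "padic_norm (\<zeta> k \<omega> * c k) \<le> 1"
        unfolding padic_norm_mult using elim that by (intro mult_le_one) auto
    qed simp
  qed
  have shift: "prob {\<omega> \<in> space M. ?W J \<omega> \<in> A \<and> \<zeta> j \<omega> + (\<Sum>k\<in>J. ?W J \<omega> k * c k) \<in> padic_disc 0 (- int n)}
    = real CARD('p) powi (- int n) * prob {\<omega> \<in> space M. ?W J \<omega> \<in> A}"
    if j: "j \<in> insert k\<^sub>0 K" "j \<notin> J" and J: "J \<subseteq> K" and A: "A \<in> sets (?N J)"
      and c: "\<And>k. k \<in> J \<Longrightarrow> padic_norm (c k) \<le> 1" for j J A c n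
  proof (rule prob_shifted_uniform[where N = "?N J" and W = "?W J" and f = "\<lambda>w. \<Sum>k\<in>J. w k * c k"])
    show "residue_uniform M (\<zeta> j)" using j(1) by (rule uniform)
    show "?W J \<in> measurable M (?N J)" using J by (intro Wm) auto
    show "(\<lambda>w. \<Sum>k\<in>J. w k * c k) \<in> borel_measurable (?N J)" by (rule lin)
    show "AE \<omega> in M. padic_norm (\<Sum>k\<in>J. ?W J \<omega> k * c k) \<le> 1" using J c by (rule AE_lin)
    have "indep_vars (\<lambda>_. borel) \<zeta> (insert j J)"
      using indep by (rule indep_vars_subset) (use J j in auto)
    thus "prob {\<omega> \<in> space M. \<zeta> j \<omega> \<in> B \<and> ?W J \<omega> \<in> A'}
        = prob {\<omega> \<in> space M. \<zeta> j \<omega> \<in> B} * prob {\<omega> \<in> space M. ?W J \<omega> \<in> A'}"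
      if "B \<in> sets borel" "A' \<in> sets (?N J)" for B A'
      using j(2) that by (rule prob_component_rest)
  qed (rule A)
  define A where "A = {w \<in> space (?N K). (\<Sum>k\<in>K. w k * D k) \<in> padic_disc 0 (e - int i)}"
  have A: "A \<in> sets (?N K)"
    unfolding A_def using measurable_sets[OF lin[of D K] padic_disc_borel[of 0 "e - int i"]]
    by (simp add: vimage_def Int_def conj_commute)
  have WA: "?W K \<omega> \<in> A \<longleftrightarrow> (\<Sum>k\<in>K. \<zeta> k \<omega> * D k) \<in> padic_disc 0 (e - int i)" if "\<omega> \<in> space M" for \<omega>
    using measurable_space[OF Wm[of K] that] unfolding A_def mem_Collect_eq sumW by blast
  have "prob {\<omega> \<in> space M. ?W K \<omega> \<in> A \<and> \<zeta> k\<^sub>0 \<omega> + (\<Sum>k\<in>K. ?W K \<omega> k * r k) \<in> padic_disc 0 (- int n)}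
    = real CARD('p) powi (- int n) * prob {\<omega> \<in> space M. ?W K \<omega> \<in> A}"
    using r A k0_notin_K by (intro shift) auto
  moreover have "{\<omega> \<in> space M. ?W K \<omega> \<in> A \<and> \<zeta> k\<^sub>0 \<omega> + (\<Sum>k\<in>K. ?W K \<omega> k * r k) \<in> padic_disc 0 (- int n)}
    = {\<omega> \<in> space M. (\<Sum>k\<in>K. \<zeta> k \<omega> * D k) \<in> padic_disc 0 (e - int i) \<and>
      \<zeta> k\<^sub>0 \<omega> + (\<Sum>k\<in>K. \<zeta> k \<omega> * r k) \<in> padic_disc 0 (- int n)}"
    unfolding sumW by (intro Collect_cong conj_cong refl WA)
  moreover have "prob {\<omega> \<in> space M. ?W K \<omega> \<in> A} = real CARD('p) powi (- int i)"
  proof -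
    define J where "J = K - {k1}"
    have J: "insert k1 J = K" "k1 \<notin> J" "finite J" using k1 finite_K by (auto simp: J_def)
    have nz: "D k1 \<noteq> 0"
    proof
      assume "D k1 = 0"
      hence "real CARD('p) powi e = 0" unfolding k1(2)[symmetric] by (simp only: padic_norm_0)
      thus False using powi_card_pos[of e, where 'p='p] by linarith
    qed
    have JK: "J \<subseteq> K" by (auto simp: J_def)
    have quot: "padic_norm (D k / D k1) \<le> 1" if "k \<in> J" for k
      using D[of k] that JK unfolding padic_norm_divide k1(2) by (simp add: subset_iff)
    have pJ: "prob {\<omega> \<in> space M. ?W J \<omega> \<in> space (?N J) \<and>
        \<zeta> k1 \<omega> + (\<Sum>k\<in>J. ?W J \<omega> k * (D k / D k1)) \<in> padic_disc 0 (- int i)}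
      = real CARD('p) powi (- int i) * prob {\<omega> \<in> space M. ?W J \<omega> \<in> space (?N J)}"
      by (rule shift[OF _ J(2) JK sets.top quot]) (use k1 in auto)
    have inJ: "?W J \<omega> \<in> space (?N J)" if "\<omega> \<in> space M" for \<omega>
      using measurable_space[OF Wm that, of J] JK by blast
    have WA1: "?W K \<omega> \<in> A \<longleftrightarrow> \<zeta> k1 \<omega> + (\<Sum>k\<in>J. ?W J \<omega> k * (D k / D k1)) \<in> padic_disc 0 (- int i)"
      if \<omega>: "\<omega> \<in> space M" for \<omega>
    proof -
      have "(\<Sum>k\<in>K. \<zeta> k \<omega> * D k) = \<zeta> k1 \<omega> * D k1 + (\<Sum>k\<in>J. \<zeta> k \<omega> * D k)"
        unfolding J(1)[symmetric] by (rule sum.insert[OF J(3,2)])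
      also have "\<dots> = D k1 * (\<zeta> k1 \<omega> + (\<Sum>k\<in>J. ?W J \<omega> k * (D k / D k1)))"
        unfolding sumW distrib_left sum_distrib_left using nz by (intro arg_cong2[of _ _ _ _ "(+)"] sum.cong) auto
      finally have "padic_norm (\<Sum>k\<in>K. \<zeta> k \<omega> * D k)
        = real CARD('p) powi e * padic_norm (\<zeta> k1 \<omega> + (\<Sum>k\<in>J. ?W J \<omega> k * (D k / D k1)))"
        by (simp add: padic_norm_mult k1(2))
      moreover have "real CARD('p) powi (e - int i) = real CARD('p) powi e * real CARD('p) powi (- int i)"
        by (simp add: power_int_diff power_int_minus divide_inverse)
      ultimately show ?thesis
        unfolding WA[OF \<omega>] in_padic_disc diff_zero
        using mult_le_cancel_left_pos[OF powi_card_pos[of e, where 'p='p]] by simp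
    qed
    have "{\<omega> \<in> space M. ?W K \<omega> \<in> A} = {\<omega> \<in> space M. ?W J \<omega> \<in> space (?N J) \<and>
        \<zeta> k1 \<omega> + (\<Sum>k\<in>J. ?W J \<omega> k * (D k / D k1)) \<in> padic_disc 0 (- int i)}"
      using WA1 inJ by blast
    hence "prob {\<omega> \<in> space M. ?W K \<omega> \<in> A}
        = real CARD('p) powi (- int i) * prob {\<omega> \<in> space M. ?W J \<omega> \<in> space (?N J)}"
      using pJ by (simp only:)
    also have "{\<omega> \<in> space M. ?W J \<omega> \<in> space (?N J)} = space M" using inJ by blast
    finally show ?thesis by (simp only: prob_space mult_1_right)
  qed
  ultimately show ?thesis by simp
qed

text \<open>Write \<open>L\<close> for the random derivative at \<open>t\<close>. As long as \<open>\<bar>L\<bar>\<close> exceeds the size of the quadratic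
  remainder, the small disc about \<open>t\<close> contains a zero exactly if \<open>\<bar>F t\<bar>\<close> is at most \<open>\<bar>L\<bar>\<close> times the
  radius; summing the resulting joint probabilities over the possible values of \<open>\<bar>L\<bar>\<close> gives a
  geometric series with ratio \<open>1 / q\<^sup>2\<close>, the source of the denominator \<open>1 + 1 / q\<close>. For smaller \<open>\<bar>L\<bar>\<close> a
  zero still forces \<open>F t\<close> to be of second order in the radius, which costs the additional term in
  the upper bound.\<close>

lemma prob_zero_bounds:
  fixes r :: "'k \<Rightarrow> 'p padic \<Rightarrow> 'p padic"
  assumes t: "t \<in> padic_disc a 0"
    and r: "\<And>k. k \<in> K \<Longrightarrow> padic_norm (r k t) \<le> 1"
    and rem: "\<And>k. k \<in> K \<Longrightarrow> quadratic_remainder (padic_disc a 0) (r k) t (D k) (real CARD('p) powi \<kappa>)"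
    and D: "\<And>k. k \<in> K \<Longrightarrow> padic_norm (D k) \<le> real CARD('p) powi e"
    and k1: "k1 \<in> K" "padic_norm (D k1) = real CARD('p) powi e"
    and n: "\<kappa> \<le> int n" "e \<le> int n" "\<kappa> - e \<le> int n"
  defines "q \<equiv> real CARD('p)"
  defines "F \<equiv> \<lambda>\<omega> u. \<zeta> k\<^sub>0 \<omega> + (\<Sum>k\<in>K. \<zeta> k \<omega> * r k u)"
  defines "E \<equiv> {\<omega> \<in> space M. \<exists>u\<in>padic_disc t (- int n). F \<omega> u = 0}"
  assumes E: "E \<in> events"
  shows "q powi (e - int n) * (1 - q powi (- 2 * (int n - \<kappa> + e))) / (1 + 1 / q) \<le> prob E"
    and "prob E \<le> q powi (e - int n) / (1 + 1 / q) + q powi (\<kappa> - 2 * int n)"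
proof -
  define L where "L = (\<lambda>\<omega>. \<Sum>k\<in>K. \<zeta> k \<omega> * D k)"
  \<comment> \<open>the number of values \<open>\<bar>L\<bar> = p\<^sup>e\<^sup>-\<^sup>i\<close> that exceed the quadratic remainder\<close>
  define N where "N = nat (int n - \<kappa> + e)"
  define A where "A = (\<lambda>i. {\<omega> \<in> space M. padic_norm (L \<omega>) = q powi (e - int i) \<and>
     padic_norm (F \<omega> t) \<le> q powi (e - int i - int n)})"
  define R where "R = {\<omega> \<in> space M. padic_norm (F \<omega> t) \<le> q powi (\<kappa> - 2 * int n)}"
  have q: "1 < q" "0 < q" unfolding q_def by (rule card_gt_1, rule card_pos)
  have q_powi_pos: "0 < q powi i" for i using q by (simp add: zero_less_power_int)
  have q_add: "q powi i * q powi j = q powi (i + j)" for i j using q by (simp add: power_int_add)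
  have q_diff: "q powi i * q powi (- int j) = q powi (i - int j)" for i j by (simp add: q_add)
  have q_le: "q powi i \<le> q powi j \<longleftrightarrow> i \<le> j" and q_less: "q powi i < q powi j \<longleftrightarrow> i < j" for i j
    unfolding q_def by (rule powi_le_card_iff, rule powi_less_card_iff)
  have q_eq: "q powi i = q powi j \<longleftrightarrow> i = j" for i j
    by (metis q_le order_antisym order_refl)
  have [measurable]: "(\<lambda>\<omega>. F \<omega> t) \<in> borel_measurable M" "L \<in> borel_measurable M"
    unfolding F_def L_def by measurable
  have meas: "A i \<in> events" "R \<in> events" for i unfolding A_def R_def by measurable
  have joint: "prob {\<omega> \<in> space M. padic_norm (L \<omega>) \<le> q powi (e - int i) \<and> padic_norm (F \<omega> t) \<le> q powi (- int s)}
    = q powi (- int s) * q powi (- int i)" for i s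
    using prob_joint[of "\<lambda>k. r k t" D e k1 i s, OF r D k1]
    unfolding in_padic_disc L_def F_def q_def diff_zero .
  have AE_L: "AE \<omega> in M. padic_norm (L \<omega>) \<le> q powi e"
    using AE_coefficients_integral
  proof eventually_elim
    case (elim \<omega>)
    show ?case unfolding L_def q_def
    proof (rule padic_norm_sum_le)
      fix k assume k: "k \<in> K"
      have "padic_norm (\<zeta> k \<omega>) * padic_norm (D k) \<le> 1 * real CARD('p) powi e"
        using elim D k by (intro mult_mono) auto
      thus "padic_norm (\<zeta> k \<omega> * D k) \<le> real CARD('p) powi e" by (simp add: padic_norm_mult)
    qed (simp add: less_imp_le)
  qed
  have remF: "quadratic_remainder (padic_disc a 0) (F \<omega>) t (L \<omega>) (q powi \<kappa>)"
    if "\<forall>k\<in>insert k\<^sub>0 K. padic_norm (\<zeta> k \<omega>) \<le> 1" for \<omega>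
  proof -
    have "quadratic_remainder (padic_disc a 0) (\<lambda>u. \<Sum>k\<in>K. \<zeta> k \<omega> * r k u) t (\<Sum>k\<in>K. \<zeta> k \<omega> * D k) (q powi \<kappa>)"
    proof (rule quadratic_remainder_sum)
      fix k assume k: "k \<in> K"
      have "quadratic_remainder (padic_disc a 0) (\<lambda>u. \<zeta> k \<omega> * r k u) t (\<zeta> k \<omega> * D k) (padic_norm (\<zeta> k \<omega>) * q powi \<kappa>)"
        unfolding q_def using rem[OF k] by (rule quadratic_remainder_cmult)
      moreover have "padic_norm (\<zeta> k \<omega>) * q powi \<kappa> \<le> q powi \<kappa>"
        using that k q_powi_pos[of \<kappa>] by (simp add: mult_left_le_one_le)
      ultimately show "quadratic_remainder (padic_disc a 0) (\<lambda>u. \<zeta> k \<omega> * r k u) t (\<zeta> k \<omega> * D k) (q powi \<kappa>)"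
        by (rule quadratic_remainder_mono)
    qed (use q_powi_pos[of \<kappa>] in simp)
    from quadratic_remainder_add[OF quadratic_remainder_const this, of "\<zeta> k\<^sub>0 \<omega>"] show ?thesis
      using q_powi_pos[of \<kappa>] by (simp add: F_def[abs_def] L_def)
  qed
  have sub: "padic_disc t (- int n) \<subseteq> padic_disc a 0"
    using padic_disc_mono[of "- int n" 0 t] padic_disc_recentre[OF t] by simp
  have lower: "AE \<omega> in M. \<omega> \<in> (\<Union>i<N. A i) \<longrightarrow> \<omega> \<in> E"
    using AE_coefficients_integral
  proof eventually_elim
    case (elim \<omega>)
    show ?case
    proof
      assume "\<omega> \<in> (\<Union>i<N. A i)"
      then obtain i where i: "i < N" "\<omega> \<in> space M" "padic_norm (L \<omega>) = q powi (e - int i)"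
        "padic_norm (F \<omega> t) \<le> q powi (e - int i - int n)" by (auto simp: A_def)
      have "q powi \<kappa> * q powi (- int n) < padic_norm (L \<omega>)"
        unfolding q_diff i(3) q_less using i(1) by (simp add: N_def)
      moreover have "padic_norm (F \<omega> t) \<le> padic_norm (L \<omega>) * q powi (- int n)"
        unfolding i(3) q_diff by (rule i(4))
      ultimately have "\<exists>u\<in>padic_disc t (- int n). F \<omega> u = 0"
        unfolding q_def
        by (intro hensel_zero[OF remF[OF elim] sub, unfolded q_def]) (simp_all add: less_imp_le)
      thus "\<omega> \<in> E" using i(2) by (simp add: E_def)
    qed
  qed
  have upper: "AE \<omega> in M. \<omega> \<in> E \<longrightarrow> \<omega> \<in> (\<Union>i<N. A i) \<union> R"
    using AE_coefficients_integral AE_L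
  proof eventually_elim
    case (elim \<omega>)
    show ?case
    proof
      assume "\<omega> \<in> E"
      then obtain u where u: "\<omega> \<in> space M" "u \<in> padic_disc t (- int n)" "F \<omega> u = 0" by (auto simp: E_def)
      have Ft: "padic_norm (F \<omega> t) \<le> max (padic_norm (L \<omega>) * q powi (- int n)) (q powi \<kappa> * q powi (- int n) * q powi (- int n))"
        unfolding q_def
        by (rule zero_nearby_imp_small[OF remF[OF elim(1), unfolded q_def] sub _ u(2,3)]) (simp add: less_imp_le)
      have eq: "q powi \<kappa> * q powi (- int n) * q powi (- int n) = q powi (\<kappa> - 2 * int n)"
        unfolding q_diff by (simp add: algebra_simps)
      show "\<omega> \<in> (\<Union>i<N. A i) \<union> R"
      proof (cases "padic_norm (L \<omega>) \<le> q powi (\<kappa> - int n)")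
        case True
        hence "padic_norm (L \<omega>) * q powi (- int n) \<le> q powi (\<kappa> - int n) * q powi (- int n)"
          by (rule mult_right_mono) (rule less_imp_le[OF q_powi_pos])
        also have "\<dots> = q powi (\<kappa> - 2 * int n)" unfolding q_diff by (simp add: algebra_simps)
        finally have "padic_norm (F \<omega> t) \<le> q powi (\<kappa> - 2 * int n)"
          using Ft unfolding eq by linarith
        thus ?thesis using u(1) by (simp add: R_def)
      next
        case False
        hence "L \<omega> \<noteq> 0" using q_powi_pos[of "\<kappa> - int n"] by auto
        then obtain j where j: "padic_norm (L \<omega>) = q powi j" unfolding q_def by (rule padic_norm_value_group)
        define i where "i = nat (e - j)"
        have je: "j \<le> e" using elim(2) unfolding j q_le .
        have kj: "\<kappa> - int n < j" using False unfolding j q_le by simp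
        have i: "e - int i = j" using je by (simp add: i_def)
        have "i < N" using je kj by (simp add: i_def N_def)
        moreover have "q powi (\<kappa> - 2 * int n) \<le> q powi (j - int n)" unfolding q_le using kj by simp
        hence "padic_norm (F \<omega> t) \<le> q powi (j - int n)"
          using Ft unfolding eq unfolding j q_diff by linarith
        hence "\<omega> \<in> A i" using u(1) j i by (simp add: A_def)
        ultimately show ?thesis by blast
      qed
    qed
  qed
  \<comment> \<open>an equality \<open>\<bar>L\<bar> = p\<^sup>e\<^sup>-\<^sup>i\<close> is a difference of two of the events in \<open>joint\<close>\<close>
  have prob_A: "prob (A i) = q powi (e - int n) * (1 - 1 / q) * (1 / q ^ 2) ^ i" for i
  proof -
    define s where "s = nat (int i + int n - e)"
    have s: "- int s = e - int i - int n" using n by (simp add: s_def)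
    let ?J = "\<lambda>i. {\<omega> \<in> space M. padic_norm (L \<omega>) \<le> q powi (e - int i) \<and> padic_norm (F \<omega> t) \<le> q powi (- int s)}"
    have step: "padic_norm x = q powi (e - int i)
      \<longleftrightarrow> padic_norm x \<le> q powi (e - int i) \<and> \<not> padic_norm x \<le> q powi (e - int (Suc i))" for x :: "'p padic"
    proof (cases "x = 0")
      case True
      have "\<not> padic_norm x = q powi (e - int i)" "padic_norm x \<le> q powi (e - int (Suc i))"
        unfolding True padic_norm_0
        using q_powi_pos[of "e - int i"] q_powi_pos[of "e - int (Suc i)"] by linarith+
      thus ?thesis by blast
    next
      case False
      then obtain k where "padic_norm x = q powi k" unfolding q_def by (rule padic_norm_value_group)
      thus ?thesis by (auto simp: q_le q_eq)
    qed
    have "A i = ?J i - ?J (Suc i)"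
      unfolding A_def step s by auto
    moreover have "?J (Suc i) \<subseteq> ?J i"
      using q_le[of "e - int (Suc i)" "e - int i"] by auto
    moreover have "?J j \<in> events" for j by measurable
    ultimately have "prob (A i) = prob (?J i) - prob (?J (Suc i))"
      by (simp only: finite_measure_Diff)
    also have "\<dots> = q powi (- int s) * (q powi (- int i) - q powi (- int (Suc i)))"
      by (simp only: joint right_diff_distrib)
    also have "q powi (- int s) = q powi (e - int n) * q powi (- int i)"
      unfolding s by (simp add: q_add algebra_simps)
    also have "q powi (- int i) = (1 / q) ^ i" by (simp add: power_int_minus power_one_over inverse_eq_divide)
    also have "q powi (- int (Suc i)) = (1 / q) ^ i * (1 / q)"
      by (simp add: power_int_minus power_one_over inverse_eq_divide del: of_nat_Suc)
    also have "q powi (e - int n) * (1 / q) ^ i * ((1 / q) ^ i - (1 / q) ^ i * (1 / q))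
      = q powi (e - int n) * (1 - 1 / q) * ((1 / q) ^ i * (1 / q) ^ i)" by (simp add: algebra_simps)
    also have "(1 / q) ^ i * (1 / q) ^ i = (1 / q ^ 2) ^ i"
      by (simp add: power2_eq_square flip: power_mult_distrib)
    finally show ?thesis .
  qed
  have disj: "disjoint_family_on A {..<N}"
    by (auto simp: disjoint_family_on_def A_def q_eq)
  have "prob (\<Union>i<N. A i) = (\<Sum>i<N. q powi (e - int n) * (1 - 1 / q) * (1 / q ^ 2) ^ i)"
    using meas disj by (subst finite_measure_finite_Union) (auto simp: prob_A)
  also have "\<dots> = q powi (e - int n) * (1 - 1 / q) * (\<Sum>i<N. (1 / q ^ 2) ^ i)"
    by (simp add: sum_distrib_left)
  also have "(\<Sum>i<N. (1 / q ^ 2) ^ i) = (1 - (1 / q ^ 2) ^ N) / (1 - 1 / q ^ 2)"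
    using q by (subst sum_gp_strict) (auto simp: power2_eq_1_iff)
  also have "1 - 1 / q ^ 2 = (1 - 1 / q) * (1 + 1 / q)" by (simp add: algebra_simps power2_eq_square)
  also have "q powi (e - int n) * (1 - 1 / q) * ((1 - (1 / q ^ 2) ^ N) / ((1 - 1 / q) * (1 + 1 / q)))
    = q powi (e - int n) * (1 - (1 / q ^ 2) ^ N) / (1 + 1 / q)"
    using q by simp
  finally have prob_UA: "prob (\<Union>i<N. A i) = q powi (e - int n) * (1 - (1 / q ^ 2) ^ N) / (1 + 1 / q)" .

  have "q powi (- 2 * (int n - \<kappa> + e)) = q powi (- int (2 * N))" using n by (simp add: N_def)
  also have "\<dots> = (1 / q ^ 2) ^ N"
    by (simp only: power_int_minus power_int_of_nat power_mult power_one_over inverse_eq_divide)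
  finally have powN: "(1 / q ^ 2) ^ N = q powi (- 2 * (int n - \<kappa> + e))" by simp

  have prob_R: "prob R = q powi (\<kappa> - 2 * int n)"
  proof -
    define s where "s = nat (2 * int n - \<kappa>)"
    have s: "- int s = \<kappa> - 2 * int n" using n by (simp add: s_def)
    have "AE \<omega> in M. padic_norm (L \<omega>) \<le> q powi (e - int 0)"
      using AE_L by simp
    hence *: "prob R = prob {\<omega> \<in> space M. padic_norm (L \<omega>) \<le> q powi (e - int 0) \<and> padic_norm (F \<omega> t) \<le> q powi (- int s)}"
      unfolding R_def s by (intro finite_measure_eq_AE) (auto elim!: eventually_mono)
    show ?thesis unfolding * joint unfolding s by simp
  qed
  have "prob (\<Union>i<N. A i) \<le> prob E"
    using lower E by (rule finite_measure_mono_AE)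
  thus "q powi (e - int n) * (1 - q powi (- 2 * (int n - \<kappa> + e))) / (1 + 1 / q) \<le> prob E"
    by (simp add: prob_UA powN)
  have "prob E \<le> prob ((\<Union>i<N. A i) \<union> R)"
    using upper by (rule finite_measure_mono_AE) (use meas in auto)
  also have "\<dots> \<le> prob (\<Union>i<N. A i) + prob R"
    using meas by (intro measure_Un_le) auto
  also have "prob (\<Union>i<N. A i) \<le> q powi (e - int n) / (1 + 1 / q)"
    unfolding prob_UA using q q_powi_pos[of "e - int n"]
    by (intro divide_right_mono) (auto simp: mult_left_le)
  finally show "prob E \<le> q powi (e - int n) / (1 + 1 / q) + q powi (\<kappa> - 2 * int n)"
    by (simp add: prob_R)
qed

text \<open>A p-adic Kac--Rice formula for a unit disc on which the largest absolute value of a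
  derivative \<open>D k\<close> is constant. Each of the \<open>p\<^sup>n\<close> cells contains a zero with probability close to the
  expected absolute value of the derivative times the radius; since the bounds do not depend on the
  cell, their sum converges to the expected absolute value \<open>p\<^sup>e / (1 + 1 / p)\<close> of the derivative.\<close>

theorem expected_zeros_unit_disc:
  fixes r D :: "'k \<Rightarrow> 'p padic \<Rightarrow> 'p padic"
  assumes r: "\<And>k t. k \<in> K \<Longrightarrow> t \<in> padic_disc a 0 \<Longrightarrow> padic_norm (r k t) \<le> 1"
    and rem: "\<And>k t. k \<in> K \<Longrightarrow> t \<in> padic_disc a 0 \<Longrightarrow>
      quadratic_remainder (padic_disc a 0) (r k) t (D k t) (real CARD('p) powi \<kappa>)"
    and D: "\<And>k t. k \<in> K \<Longrightarrow> t \<in> padic_disc a 0 \<Longrightarrow> padic_norm (D k t) \<le> real CARD('p) powi e"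
    and k1: "k1 \<in> K" "\<And>t. t \<in> padic_disc a 0 \<Longrightarrow> padic_norm (D k1 t) = real CARD('p) powi e"
  defines "F \<equiv> \<lambda>\<omega> u. \<zeta> k\<^sub>0 \<omega> + (\<Sum>k\<in>K. \<zeta> k \<omega> * r k u)"
  shows "has_expectation M (\<lambda>\<omega>. num_zeros (F \<omega>) (padic_disc a 0))
    (real CARD('p) powi e / (1 + 1 / real CARD('p)))"
proof -
  define q where "q = real CARD('p)"
  define E where "E = (\<lambda>n c. {\<omega> \<in> space M. \<exists>t\<in>padic_disc (a + of_nat c) (- int n). F \<omega> t = 0})"
  define V where "V = q powi e / (1 + 1 / q)"
  have q: "1 < q" "0 < q" unfolding q_def by (rule card_gt_1, rule card_pos)
  have q_powi_pos: "0 < q powi i" for i using q by (simp add: zero_less_power_int)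
  have meas: "(\<lambda>\<omega>. F \<omega> t) \<in> borel_measurable M" for t
    unfolding F_def by measurable
  have "continuous_on (padic_disc a 0) (r k)" if "k \<in> K" for k
    by (rule quadratic_remainder_continuous_on[of _ _ "D k" "q powi \<kappa>"])
      (use rem that less_imp_le[OF q_powi_pos] in \<open>simp_all add: q_def\<close>)
  hence cont: "continuous_on (padic_disc a 0) (F \<omega>)" for \<omega>
    unfolding F_def by (intro continuous_on_add continuous_on_const continuous_on_sum continuous_on_mult')
  have E: "E n c \<in> events" for n c
    unfolding E_def by (rule sets_zero_in_sub_disc[OF meas cont])
  have lim: "(\<lambda>n. \<Sum>c<CARD('p) ^ n. emeasure M (E n c)) \<longlonglongrightarrow> (\<integral>\<^sup>+ \<omega>. num_zeros (F \<omega>) (padic_disc a 0) \<partial>M)"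
    unfolding E_def by (rule LIMSEQ_num_zeros_unit_disc[OF meas cont])
  define lo where "lo = (\<lambda>n. q powi e * (1 - q powi (2 * \<kappa> - 2 * e) * (1 / q ^ 2) ^ n) / (1 + 1 / q))"
  define hi where "hi = (\<lambda>n. V + q powi \<kappa> * (1 / q) ^ n)"
  have bounds: "lo n \<le> (\<Sum>c<CARD('p) ^ n. prob (E n c))" "(\<Sum>c<CARD('p) ^ n. prob (E n c)) \<le> hi n"
    if n: "\<kappa> \<le> int n" "e \<le> int n" "\<kappa> - e \<le> int n" for n
  proof -
    have t: "a + of_nat c \<in> padic_disc a 0" for c by (simp add: in_padic_disc)
    have b: "q powi (e - int n) * (1 - q powi (- 2 * (int n - \<kappa> + e))) / (1 + 1 / q) \<le> prob (E n c)"
      "prob (E n c) \<le> q powi (e - int n) / (1 + 1 / q) + q powi (\<kappa> - 2 * int n)" for c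
      unfolding q_def E_def F_def
      using prob_zero_bounds[of "a + of_nat c" a r "\<lambda>k. D k (a + of_nat c)" \<kappa> e k1 n,
          OF t r rem D k1(1) k1(2) n E[of n c, unfolded E_def F_def]] t[of c] by simp_all
    have qn: "q ^ n * q powi (i - int n) = q powi i" for i
      using q by (simp add: power_int_diff)
    have "q powi (- 2 * (int n - \<kappa> + e)) = q powi ((2 * \<kappa> - 2 * e) - int (2 * n))"
      by (simp add: algebra_simps)
    also have "\<dots> = q powi (2 * \<kappa> - 2 * e) * (1 / q ^ 2) ^ n"
      using q by (subst power_int_diff)
        (simp_all only: power_int_of_nat power_mult power_one_over times_divide_eq_right mult_1_right, simp_all)
    finally have "lo n = q ^ n * (q powi (e - int n) * (1 - q powi (- 2 * (int n - \<kappa> + e))) / (1 + 1 / q))"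
      unfolding lo_def using qn[of e] by (simp add: mult.assoc[symmetric])
    also have "\<dots> = (\<Sum>c<CARD('p) ^ n. q powi (e - int n) * (1 - q powi (- 2 * (int n - \<kappa> + e))) / (1 + 1 / q))"
      by (simp add: q_def)
    also have "\<dots> \<le> (\<Sum>c<CARD('p) ^ n. prob (E n c))" by (intro sum_mono b(1))
    finally show "lo n \<le> (\<Sum>c<CARD('p) ^ n. prob (E n c))" .
    have "(\<Sum>c<CARD('p) ^ n. prob (E n c)) \<le> (\<Sum>c<CARD('p) ^ n. q powi (e - int n) / (1 + 1 / q) + q powi (\<kappa> - 2 * int n))"
      by (intro sum_mono b(2))
    also have "\<dots> = q ^ n * q powi (e - int n) / (1 + 1 / q) + q ^ n * q powi (\<kappa> - 2 * int n)"
      by (simp add: q_def distrib_left)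
    also have "q powi (\<kappa> - 2 * int n) = q powi ((\<kappa> - int n) - int n)" by (simp add: algebra_simps)
    also have "q ^ n * q powi (e - int n) / (1 + 1 / q) + q ^ n * q powi ((\<kappa> - int n) - int n) = hi n"
      unfolding qn hi_def V_def using q by (simp add: power_int_diff power_inverse divide_inverse)
    finally show "(\<Sum>c<CARD('p) ^ n. prob (E n c)) \<le> hi n" .
  qed
  have "0 \<le> 1 / q" "1 / q < 1" using q by simp_all
  hence "(\<lambda>n. (1 / q) ^ n) \<longlonglongrightarrow> 0" by (rule LIMSEQ_realpow_zero)
  hence "(\<lambda>n. V + q powi \<kappa> * (1 / q) ^ n) \<longlonglongrightarrow> V + q powi \<kappa> * 0" by (intro tendsto_add tendsto_mult tendsto_const)
  hence hi: "hi \<longlonglongrightarrow> V" unfolding hi_def by (simp only: mult_zero_right add_0_right)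
  have "1 < q ^ 2" using q by (intro one_less_power) auto
  hence "0 \<le> 1 / q ^ 2" "1 / q ^ 2 < 1" using q by (simp_all add: divide_less_eq_1)
  hence "(\<lambda>n. (1 / q ^ 2) ^ n) \<longlonglongrightarrow> 0" by (rule LIMSEQ_realpow_zero)
  hence "(\<lambda>n. q powi e * (1 - q powi (2 * \<kappa> - 2 * e) * (1 / q ^ 2) ^ n) / (1 + 1 / q))
      \<longlonglongrightarrow> q powi e * (1 - q powi (2 * \<kappa> - 2 * e) * 0) / (1 + 1 / q)"
    using add_pos_pos[of 1 "1 / q"] q by (intro tendsto_divide tendsto_mult tendsto_diff tendsto_const) auto
  hence lo: "lo \<longlonglongrightarrow> V" by (simp add: lo_def[abs_def] V_def)
  have ev: "\<forall>\<^sub>F n in sequentially. \<kappa> \<le> int n \<and> e \<le> int n \<and> \<kappa> - e \<le> int n"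
    using eventually_ge_at_top[of "nat (max \<kappa> (max e (\<kappa> - e)))"] by eventually_elim auto
  have "(\<lambda>n. \<Sum>c<CARD('p) ^ n. prob (E n c)) \<longlonglongrightarrow> V"
    by (rule tendsto_sandwich[OF _ _ lo hi]) (use ev in \<open>auto elim!: eventually_mono intro: bounds\<close>)
  hence "(\<lambda>n. ennreal (\<Sum>c<CARD('p) ^ n. prob (E n c))) \<longlonglongrightarrow> ennreal V"
    by (rule tendsto_ennrealI)
  hence "(\<lambda>n. \<Sum>c<CARD('p) ^ n. emeasure M (E n c)) \<longlonglongrightarrow> ennreal V"
    by (simp add: emeasure_eq_measure)
  hence "(\<integral>\<^sup>+ \<omega>. num_zeros (F \<omega>) (padic_disc a 0) \<partial>M) = ennreal V"
    using lim LIMSEQ_unique by blast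
  thus ?thesis
    unfolding has_expectation_def V_def q_def
    using measurable_num_zeros_unit_disc[of a F M, OF meas cont] by blast
qed

end

section \<open>Binomial polynomials on the p-adic integers\<close>

lemma continuous_on_gbinomial:
  "continuous_on UNIV (\<lambda>t :: 'p::prime_card padic. t gchoose k)"
proof (induction k)
  case (Suc k)
  have "(\<lambda>t :: 'p padic. t gchoose Suc k) = (\<lambda>t. (t gchoose k) * ((t + - of_nat k) * inverse (of_nat (Suc k))))"
  proof
    fix t :: "'p padic"
    have "of_nat (Suc k) * (t gchoose Suc k) = (t - of_nat k) * (t gchoose k)"
      using gbinomial_mult_1[of t k] by (simp add: algebra_simps)
    moreover have "(of_nat (Suc k) :: 'p padic) \<noteq> 0" by (simp del: of_nat_Suc)
    ultimately show "t gchoose Suc k = (t gchoose k) * ((t + - of_nat k) * inverse (of_nat (Suc k)))"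
      by (simp add: field_simps del: of_nat_Suc)
  qed
  thus ?case
    using Suc by (simp only:) (intro continuous_on_mult' continuous_on_add continuous_on_const continuous_on_id)
qed simp

text \<open>Binomial coefficients of natural numbers are integers, and these are dense in the p-adic integers.\<close>

lemma padic_norm_gbinomial_le_1:
  assumes "padic_norm (t :: 'p::prime_card padic) \<le> 1"
  shows "padic_norm (t gchoose k) \<le> 1"
proof -
  have "isCont (\<lambda>t. t gchoose k) t"
    using continuous_on_gbinomial[of k, where 'p='p] by (simp add: continuous_on_eq_continuous_at)
  then obtain \<delta> where \<delta>: "\<delta> > 0" "\<And>s. dist s t < \<delta> \<Longrightarrow> dist (s gchoose k) (t gchoose k) < 1"
    unfolding continuous_at_eps_delta by (metis zero_less_one)
  obtain n where n: "real CARD('p) powi (- int n) < \<delta>" using ex_powi_less[OF \<delta>(1)] by blast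
  obtain c where c: "padic_norm (t - of_nat c) \<le> real CARD('p) powi (- int n)"
    using nat_approximation[OF assms] by metis
  have "dist (of_nat c gchoose k) (t gchoose k) < 1"
    using c n by (intro \<delta>(2)) (simp add: dist_padic_def padic_norm_diff_commute)
  moreover have "(of_nat c gchoose k :: 'p padic) = of_nat (c choose k)"
    by (simp add: binomial_gbinomial)
  ultimately have "padic_norm ((t gchoose k) - of_nat (c choose k)) \<le> 1"
    by (simp add: dist_padic_def padic_norm_diff_commute)
  from padic_norm_add_le[OF this padic_norm_of_nat_le_1[of "c choose k"]] show ?thesis by simp
qed

lemma padic_norm_inverse_nat_le:
  assumes "0 < j" "j < CARD('p::prime_card) ^ Suc L"
  shows "padic_norm (1 / of_nat j :: 'p padic) \<le> real CARD('p) powi int L"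
proof -
  let ?m = "multiplicity (int CARD('p)) (int j)"
  have "int CARD('p) ^ ?m dvd int j" by (rule multiplicity_dvd)
  hence "int CARD('p) ^ ?m \<le> int j" using assms(1) by (intro zdvd_imp_le) auto
  hence "CARD('p) ^ ?m \<le> j" by (metis of_nat_le_iff of_nat_power)
  hence "CARD('p) ^ ?m < CARD('p) ^ Suc L" using assms(2) by linarith
  hence "?m < Suc L"
    by (rule power_less_imp_less_exp[rotated]) (use prime_gt_1_nat[OF prime_card[where 'a='p]] in simp)
  moreover have "padic_norm (1 / of_nat j :: 'p padic) = real CARD('p) powi int ?m"
    unfolding padic_norm_divide padic_norm_of_nat[OF assms(1)] by (simp add: power_int_minus divide_inverse)
  ultimately show ?thesis by (simp only: powi_le_card_iff)
qed

lemma padic_norm_minus_1_gbinomial [simp]: "padic_norm (-1 gchoose k :: 'p::prime_card padic) = 1"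
proof -
  have "(of_nat k gchoose k :: 'p padic) = 1" by (simp flip: binomial_gbinomial)
  hence "(-1 gchoose k :: 'p padic) = (-1) ^ k"
    using gbinomial_minus[of "1 :: 'p padic" k] by simp
  thus ?thesis by (simp add: padic_norm_power)
qed

lemma padic_norm_gbinomial_le:
  fixes h :: "'p::prime_card padic"
  assumes "0 < j" "j < CARD('p) ^ Suc L" "padic_norm h \<le> 1"
  shows "padic_norm (h gchoose j) \<le> real CARD('p) powi int L * padic_norm h"
proof -
  have "h gchoose j = h * ((1 / of_nat j) * (h - 1 gchoose (j - 1)))"
    using gbinomial_absorption'[OF assms(1), of h] by simp
  hence "padic_norm (h gchoose j) = padic_norm h * (padic_norm (1 / of_nat j :: 'p padic) * padic_norm (h - 1 gchoose (j - 1)))"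
    by (simp only: padic_norm_mult)
  also have "\<dots> \<le> padic_norm h * (real CARD('p) powi int L * 1)"
    using assms padic_norm_inverse_nat_le[OF assms(1,2)]
    by (intro mult_left_mono mult_mono padic_norm_gbinomial_le_1 padic_norm_diff_le) auto
  finally show ?thesis by (simp add: mult.commute)
qed

text \<open>Vandermonde's identity expands \<open>t gchoose k\<close> about \<open>s\<close> in the polynomials
  \<open>t - s gchoose j\<close> with integral coefficients, and each term with \<open>j > 0\<close> is a multiple of
  \<open>(t - s) / j\<close>.\<close>

lemma padic_norm_gbinomial_diff_le:
  fixes s t :: "'p::prime_card padic"
  assumes "k < CARD('p) ^ Suc L" "padic_norm s \<le> 1" "padic_norm t \<le> 1"
  shows "padic_norm ((t gchoose k) - (s gchoose k)) \<le> real CARD('p) powi int L * padic_norm (t - s)"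
proof -
  have ts: "padic_norm (t - s) \<le> 1" using assms by (intro padic_norm_diff_le)
  have "(t gchoose k) = (\<Sum>j\<in>{0..k}. (t - s gchoose j) * (s gchoose (k - j)))"
    using gbinomial_Vandermonde[of "t - s" s k] by simp
  also have "\<dots> = (s gchoose k) + (\<Sum>j\<in>{1..k}. (t - s gchoose j) * (s gchoose (k - j)))"
    by (subst sum.atLeast_Suc_atMost) simp_all
  finally have "(t gchoose k) - (s gchoose k) = (\<Sum>j\<in>{1..k}. (t - s gchoose j) * (s gchoose (k - j)))" by simp
  also have "padic_norm \<dots> \<le> real CARD('p) powi int L * padic_norm (t - s)"
  proof (rule padic_norm_sum_le)
    fix j assume j: "j \<in> {1..k}"
    have "padic_norm (t - s gchoose j) * padic_norm (s gchoose (k - j)) \<le> (real CARD('p) powi int L * padic_norm (t - s)) * 1"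
      using j assms ts by (intro mult_mono padic_norm_gbinomial_le padic_norm_gbinomial_le_1) auto
    thus "padic_norm ((t - s gchoose j) * (s gchoose (k - j))) \<le> real CARD('p) powi int L * padic_norm (t - s)"
      by (simp add: padic_norm_mult)
  qed simp
  finally show ?thesis .
qed

text \<open>The derivative of \<open>t gchoose k\<close>, read off from Vandermonde's identity: \<open>x gchoose j\<close> equals
  \<open>x / j\<close> times \<open>x - 1 gchoose (j - 1)\<close>, so that its derivative at 0 is the second factor below.\<close>

definition gbinomial_deriv :: "nat \<Rightarrow> 'p::prime_card padic \<Rightarrow> 'p padic" where
  "gbinomial_deriv k t = (\<Sum>j\<in>{1..k}. (t gchoose (k - j)) * ((-1 gchoose (j - 1)) / of_nat j))"

lemma quadratic_remainder_gbinomial_0: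
  assumes "0 < j" "j < CARD('p::prime_card) ^ Suc L"
  shows "quadratic_remainder (padic_disc (0 :: 'p padic) 0) (\<lambda>x. x gchoose j) 0 ((-1 gchoose (j - 1)) / of_nat j)
    (real CARD('p) powi (2 * int L))"
  unfolding quadratic_remainder_def
proof (intro ballI)
  fix u v :: "'p padic" assume "u \<in> padic_disc 0 0" "v \<in> padic_disc 0 0"
  hence uv: "padic_norm u \<le> 1" "padic_norm v \<le> 1" by (auto simp: in_padic_disc)
  define Q where "Q = (\<lambda>x :: 'p padic. (1 / of_nat j) * (x - 1 gchoose (j - 1)))"
  let ?C = "real CARD('p) powi (2 * int L)" and ?M = "max (padic_norm u) (padic_norm v)"
  have C: "?C = real CARD('p) powi int L * real CARD('p) powi int L"
    unfolding mult_2 by (rule power_int_add) simp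
  have Q: "padic_norm (Q x - Q y) \<le> ?C * padic_norm (x - y)" if "padic_norm x \<le> 1" "padic_norm y \<le> 1" for x y
  proof -
    have "Q x - Q y = (1 / of_nat j) * ((x - 1 gchoose (j - 1)) - (y - 1 gchoose (j - 1)))"
      unfolding Q_def by (simp only: right_diff_distrib)
    hence "padic_norm (Q x - Q y) = padic_norm (1 / of_nat j :: 'p padic) * padic_norm ((x - 1 gchoose (j - 1)) - (y - 1 gchoose (j - 1)))"
      by (simp only: padic_norm_mult)
    also have "\<dots> \<le> real CARD('p) powi int L * (real CARD('p) powi int L * padic_norm ((x - 1) - (y - 1)))"
      using assms that
      by (intro mult_mono padic_norm_inverse_nat_le padic_norm_gbinomial_diff_le padic_norm_diff_le) auto
    finally show ?thesis by (simp add: C)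
  qed
  have gb: "x gchoose j = x * Q x" for x :: "'p padic"
    using gbinomial_absorption'[OF assms(1), of x] by (simp add: Q_def)
  have Q0: "(-1 gchoose (j - 1)) / of_nat j = Q 0" by (simp add: Q_def)
  have "(u gchoose j) - (v gchoose j) - ((-1 gchoose (j - 1)) / of_nat j) * (u - v)
    = (u - v) * (Q u - Q 0) + v * (Q u - Q v)"
    unfolding gb Q0 by (simp add: algebra_simps)
  moreover have "padic_norm ((u - v) * (Q u - Q 0)) \<le> ?C * padic_norm (u - v) * ?M"
  proof -
    have "padic_norm (Q u - Q 0) \<le> ?C * padic_norm (u - 0)" using uv by (intro Q) auto
    also have "\<dots> \<le> ?C * ?M" by (intro mult_left_mono) (auto simp: less_imp_le)
    finally have "padic_norm (u - v) * padic_norm (Q u - Q 0) \<le> padic_norm (u - v) * (?C * ?M)"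
      by (intro mult_left_mono) auto
    thus ?thesis by (simp add: padic_norm_mult ac_simps)
  qed
  moreover have "padic_norm (v * (Q u - Q v)) \<le> ?C * padic_norm (u - v) * ?M"
  proof -
    have "padic_norm v * padic_norm (Q u - Q v) \<le> ?M * (?C * padic_norm (u - v))"
      using uv by (intro mult_mono Q) (auto simp: le_max_iff_disj)
    thus ?thesis by (simp add: padic_norm_mult ac_simps)
  qed
  ultimately show "padic_norm ((u gchoose j) - (v gchoose j) - ((-1 gchoose (j - 1)) / of_nat j) * (u - v))
    \<le> ?C * padic_norm (u - v) * max (padic_norm (u - 0)) (padic_norm (v - 0))"
    by (simp only: diff_zero padic_norm_add_le)
qed

lemma quadratic_remainder_gbinomial:
  fixes t :: "'p::prime_card padic"
  assumes k: "k < CARD('p) ^ Suc L" and t: "t \<in> padic_disc 0 0"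
  shows "quadratic_remainder (padic_disc 0 0) (\<lambda>u. u gchoose k) t (gbinomial_deriv k t) (real CARD('p) powi (2 * int L))"
proof -
  let ?C = "real CARD('p) powi (2 * int L)"
  have t1: "padic_norm t \<le> 1" using t by (simp add: in_padic_disc)
  have "quadratic_remainder (padic_disc 0 0) (\<lambda>u. (t gchoose k) + (\<Sum>j\<in>{1..k}. (t gchoose (k - j)) * (u - t gchoose j)))
      t (0 + gbinomial_deriv k t) ?C"
    unfolding gbinomial_deriv_def
  proof (intro quadratic_remainder_add quadratic_remainder_const quadratic_remainder_sum)
    fix j assume j: "j \<in> {1..k}"
    have "quadratic_remainder (padic_disc 0 0) (\<lambda>u. u - t gchoose j) t ((-1 gchoose (j - 1)) / of_nat j) ?C"
      unfolding quadratic_remainder_def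
    proof (intro ballI)
      fix u v :: "'p padic" assume "u \<in> padic_disc 0 0" "v \<in> padic_disc 0 0"
      hence "u - t \<in> padic_disc 0 0" "v - t \<in> padic_disc 0 0"
        using t1 by (auto simp: in_padic_disc intro: padic_norm_diff_le)
      from quadratic_remainderD[OF quadratic_remainder_gbinomial_0 this, of j]
      show "padic_norm ((u - t gchoose j) - (v - t gchoose j) - (-1 gchoose (j - 1)) / of_nat j * (u - v))
        \<le> ?C * padic_norm (u - v) * max (padic_norm (u - t)) (padic_norm (v - t))"
        using j k by simp
    qed
    hence "quadratic_remainder (padic_disc 0 0) (\<lambda>u. (t gchoose (k - j)) * (u - t gchoose j)) t
      ((t gchoose (k - j)) * ((-1 gchoose (j - 1)) / of_nat j)) (padic_norm (t gchoose (k - j)) * ?C)"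
      by (rule quadratic_remainder_cmult)
    moreover have "padic_norm (t gchoose (k - j)) * ?C \<le> ?C"
      using padic_norm_gbinomial_le_1[OF t1] by (simp add: mult_left_le_one_le less_imp_le)
    ultimately show "quadratic_remainder (padic_disc 0 0) (\<lambda>u. (t gchoose (k - j)) * (u - t gchoose j)) t
      ((t gchoose (k - j)) * ((-1 gchoose (j - 1)) / of_nat j)) ?C"
      by (rule quadratic_remainder_mono)
  qed (simp_all add: less_imp_le)
  moreover have "(\<lambda>u. (t gchoose k) + (\<Sum>j\<in>{1..k}. (t gchoose (k - j)) * (u - t gchoose j))) = (\<lambda>u. u gchoose k)"
  proof
    fix u
    have "u gchoose k = (\<Sum>j\<in>{0..k}. (u - t gchoose j) * (t gchoose (k - j)))"
      using gbinomial_Vandermonde[of "u - t" t k] by simp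
    also have "\<dots> = (t gchoose k) + (\<Sum>j\<in>{1..k}. (t gchoose (k - j)) * (u - t gchoose j))"
      by (subst sum.atLeast_Suc_atMost) (simp_all add: mult.commute)
    finally show "(t gchoose k) + (\<Sum>j\<in>{1..k}. (t gchoose (k - j)) * (u - t gchoose j)) = u gchoose k" by simp
  qed
  ultimately show ?thesis by simp
qed

lemma padic_norm_gbinomial_deriv_term:
  fixes t :: "'p::prime_card padic"
  assumes "padic_norm t \<le> 1" "0 < j" "j < CARD('p) ^ Suc l"
  shows "padic_norm ((t gchoose i) * ((-1 gchoose (j - 1)) / of_nat j)) \<le> real CARD('p) powi int l"
proof -
  have "padic_norm (t gchoose i) * padic_norm (1 / of_nat j :: 'p padic) \<le> 1 * real CARD('p) powi int l"
    using assms by (intro mult_mono padic_norm_gbinomial_le_1 padic_norm_inverse_nat_le) auto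
  thus ?thesis by (simp add: padic_norm_mult padic_norm_divide)
qed

lemma padic_norm_gbinomial_deriv_le:
  fixes t :: "'p::prime_card padic"
  assumes "k < CARD('p) ^ Suc L" "padic_norm t \<le> 1"
  shows "padic_norm (gbinomial_deriv k t) \<le> real CARD('p) powi int L"
  unfolding gbinomial_deriv_def
proof (rule padic_norm_sum_le)
  fix j assume "j \<in> {1..k}"
  thus "padic_norm ((t gchoose (k - j)) * ((-1 gchoose (j - 1)) / of_nat j)) \<le> real CARD('p) powi int L"
    using assms by (intro padic_norm_gbinomial_deriv_term) auto
qed (simp add: less_imp_le)

text \<open>This and the preceding bound show that the largest derivative among the binomial polynomials up
  to degree \<open>d\<close> has the same absolute value \<open>p\<^sup>L\<close> everywhere on the p-adic integers, \<open>p\<^sup>L\<close> being the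
  largest power of \<open>p\<close> up to \<open>d\<close>. It is attained at degree \<open>p\<^sup>L\<close>, where the summand
  with \<open>1 / p\<^sup>L\<close> dominates all the others.\<close>

lemma padic_norm_gbinomial_deriv_prime_power:
  fixes t :: "'p::prime_card padic"
  assumes "padic_norm t \<le> 1"
  shows "padic_norm (gbinomial_deriv (CARD('p) ^ L) t) = real CARD('p) powi int L"
proof -
  let ?k = "CARD('p) ^ L"
  let ?f = "\<lambda>j. (t gchoose (?k - j)) * ((-1 gchoose (j - 1)) / of_nat j)"
  have k: "0 < ?k" using prime_gt_0_nat[OF prime_card[where 'a='p]] by simp
  have "?f ?k = (-1 gchoose (?k - 1)) / of_nat CARD('p) ^ L" by simp
  hence "padic_norm (?f ?k) = 1 / inverse (real CARD('p)) ^ L"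
    by (simp only: padic_norm_divide padic_norm_power padic_norm_card padic_norm_minus_1_gbinomial)
  also have "\<dots> = real CARD('p) powi int L"
    unfolding power_inverse power_int_of_nat by (simp add: divide_inverse)
  finally have fk: "padic_norm (?f ?k) = real CARD('p) powi int L" .
  have split: "gbinomial_deriv ?k t = ?f ?k + (\<Sum>j\<in>{1..<?k}. ?f j)"
  proof -
    have "{1..?k} = insert ?k {1..<?k}" using k by auto
    thus ?thesis unfolding gbinomial_deriv_def by simp
  qed
  have "padic_norm (\<Sum>j\<in>{1..<?k}. ?f j) \<le> real CARD('p) powi (int L - 1)"
  proof (rule padic_norm_sum_le)
    fix j assume j: "j \<in> {1..<?k}"
    hence "L \<noteq> 0" by (intro notI) simp
    then obtain l where l: "L = Suc l" using not0_implies_Suc by blast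
    have "padic_norm (?f j) \<le> real CARD('p) powi int l"
      using j assms unfolding l by (intro padic_norm_gbinomial_deriv_term) auto
    thus "padic_norm (?f j) \<le> real CARD('p) powi (int L - 1)" using l by simp
  qed (simp add: less_imp_le)
  moreover have "real CARD('p) powi (int L - 1) < real CARD('p) powi int L"
    by (subst powi_less_card_iff) simp
  ultimately have "padic_norm (\<Sum>j\<in>{1..<?k}. ?f j) < padic_norm (?f ?k)"
    unfolding fk by linarith
  from padic_norm_add_eq[OF this] show ?thesis
    unfolding split fk .
qed

section \<open>Ratios of binomial polynomials outside the p-adic integers\<close>

text \<open>\<open>A\<close> bounds the function, and each differentiation divides the bound by \<open>\<tau>\<close>, as for
  inverse powers of \<open>t\<close> on a set where \<open>\<bar>t\<bar> = \<tau>\<close>. With the bounds tied together in this way, a product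
  of two such functions is again of this kind and the constants \<open>A\<close> multiply.\<close>

definition decaying :: "real \<Rightarrow> 'p::prime_card padic set \<Rightarrow> real \<Rightarrow> ('p padic \<Rightarrow> 'p padic) \<Rightarrow> ('p padic \<Rightarrow> 'p padic) \<Rightarrow> bool" where
  "decaying \<tau> S A f f' \<longleftrightarrow> (\<forall>t\<in>S. padic_norm (f t) \<le> A \<and> padic_norm (f' t) \<le> A / \<tau>
     \<and> quadratic_remainder S f t (f' t) (A / \<tau>\<^sup>2))
     \<and> (\<forall>u\<in>S. \<forall>v\<in>S. padic_norm (f u - f v) \<le> A / \<tau> * padic_norm (u - v))"

lemma decaying_mono:
  assumes f: "decaying \<tau> S A f f'" and A: "A \<le> B" and \<tau>: "0 < \<tau>"
  shows "decaying \<tau> S B f f'"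
proof -
  have le: "A / \<tau> \<le> B / \<tau>" "A / \<tau>\<^sup>2 \<le> B / \<tau>\<^sup>2" using A \<tau> by (auto intro: divide_right_mono)
  show ?thesis
    unfolding decaying_def
  proof (intro conjI ballI)
    fix t assume t: "t \<in> S"
    show "padic_norm (f t) \<le> B" "padic_norm (f' t) \<le> B / \<tau>"
      using f t A le unfolding decaying_def by (meson order_trans)+
    show "quadratic_remainder S f t (f' t) (B / \<tau>\<^sup>2)"
      by (rule quadratic_remainder_mono[OF _ le(2)]) (use f t in \<open>simp add: decaying_def\<close>)
  next
    fix u v assume uv: "u \<in> S" "v \<in> S"
    have "padic_norm (f u - f v) \<le> A / \<tau> * padic_norm (u - v)" using f uv by (simp add: decaying_def)
    also have "\<dots> \<le> B / \<tau> * padic_norm (u - v)" using le by (intro mult_right_mono) auto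
    finally show "padic_norm (f u - f v) \<le> B / \<tau> * padic_norm (u - v)" .
  qed
qed

lemma decaying_mult:
  assumes f: "decaying \<tau> S A f f'" and g: "decaying \<tau> S B g g'"
    and AB: "0 \<le> A" "0 \<le> B" and \<tau>: "0 < \<tau>"
  shows "decaying \<tau> S (A * B) (\<lambda>t. f t * g t) (\<lambda>t. f' t * g t + f t * g' t)"
proof -
  have F: "padic_norm (f t) \<le> A" "padic_norm (f' t) \<le> A / \<tau>" "quadratic_remainder S f t (f' t) (A / \<tau>\<^sup>2)" if "t \<in> S" for t
    using f that by (auto simp: decaying_def)
  have G: "padic_norm (g t) \<le> B" "padic_norm (g' t) \<le> B / \<tau>" "quadratic_remainder S g t (g' t) (B / \<tau>\<^sup>2)" if "t \<in> S" for t
    using g that by (auto simp: decaying_def)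
  have Fl: "padic_norm (f u - f v) \<le> A / \<tau> * padic_norm (u - v)" if "u \<in> S" "v \<in> S" for u v
    using f that by (auto simp: decaying_def)
  have Gl: "padic_norm (g u - g v) \<le> B / \<tau> * padic_norm (u - v)" if "u \<in> S" "v \<in> S" for u v
    using g that by (auto simp: decaying_def)
  note nn = padic_norm_nonneg AB less_imp_le[OF \<tau>]
  have mm: "padic_norm (x * y) \<le> X * Y" if "padic_norm x \<le> X" "padic_norm y \<le> Y" for x y :: "'a padic" and X Y
  proof -
    have "0 \<le> X" using that(1) padic_norm_nonneg[of x] by linarith
    thus ?thesis unfolding padic_norm_mult using that by (intro mult_mono) auto
  qed
  show ?thesis
    unfolding decaying_def
  proof (intro conjI ballI)
    fix t assume t: "t \<in> S"
    show "padic_norm (f t * g t) \<le> A * B" using t by (intro mm F G)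
    show "padic_norm (f' t * g t + f t * g' t) \<le> A * B / \<tau>"
      using mm[OF F(2)[OF t] G(1)[OF t]] mm[OF F(1)[OF t] G(2)[OF t]]
      by (intro padic_norm_add_le) (simp_all add: field_simps)
    show "quadratic_remainder S (\<lambda>t. f t * g t) t (f' t * g t + f t * g' t) (A * B / \<tau>\<^sup>2)"
      unfolding quadratic_remainder_def
    proof (intro ballI)
      fix u v assume uv: "u \<in> S" "v \<in> S"
      let ?h = "padic_norm (u - v)" and ?M = "max (padic_norm (u - t)) (padic_norm (v - t))"
      have M: "padic_norm (u - t) \<le> ?M" "padic_norm (v - t) \<le> ?M" by simp_all
      \<comment> \<open>the remainders of \<open>f\<close> and \<open>g\<close>, followed by the error of evaluating \<open>g\<close> and \<open>f\<close> at \<open>t\<close>\<close>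
      have eq: "f u * g u - f v * g v - (f' t * g t + f t * g' t) * (u - v)
        = ((f u - f v - f' t * (u - v)) * g u + f v * (g u - g v - g' t * (u - v)))
          + (f' t * (u - v) * (g u - g t) + (f v - f t) * (g' t * (u - v)))"
        by (simp add: algebra_simps)
      have "padic_norm ((f u - f v - f' t * (u - v)) * g u) \<le> A / \<tau>\<^sup>2 * ?h * ?M * B"
        using uv t by (intro mm G quadratic_remainderD[OF F(3)])
      moreover have "padic_norm (f v * (g u - g v - g' t * (u - v))) \<le> A * (B / \<tau>\<^sup>2 * ?h * ?M)"
        using uv t by (intro mm F quadratic_remainderD[OF G(3)])
      moreover have "padic_norm (g u - g t) \<le> B / \<tau> * ?M"
        using Gl[OF uv(1) t] mult_left_mono[OF M(1), of "B / \<tau>"] AB \<tau> by simp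
      hence "padic_norm (f' t * (u - v) * (g u - g t)) \<le> A / \<tau> * ?h * (B / \<tau> * ?M)"
        using t by (intro mm F order_refl)
      moreover have "padic_norm (f v - f t) \<le> A / \<tau> * ?M"
        using Fl[OF uv(2) t] mult_left_mono[OF M(2), of "A / \<tau>"] AB \<tau> by simp
      hence "padic_norm ((f v - f t) * (g' t * (u - v))) \<le> A / \<tau> * ?M * (B / \<tau> * ?h)"
        using t by (intro mm G order_refl)
      moreover have "A / \<tau>\<^sup>2 * ?h * ?M * B = A * B / \<tau>\<^sup>2 * ?h * ?M"
        "A * (B / \<tau>\<^sup>2 * ?h * ?M) = A * B / \<tau>\<^sup>2 * ?h * ?M"
        "A / \<tau> * ?h * (B / \<tau> * ?M) = A * B / \<tau>\<^sup>2 * ?h * ?M"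
        "A / \<tau> * ?M * (B / \<tau> * ?h) = A * B / \<tau>\<^sup>2 * ?h * ?M"
        by (simp_all add: power2_eq_square)
      ultimately show "padic_norm (f u * g u - f v * g v - (f' t * g t + f t * g' t) * (u - v)) \<le> A * B / \<tau>\<^sup>2 * ?h * ?M"
        unfolding eq by (intro padic_norm_add_le) (simp_all only:)
    qed
  next
    fix u v assume uv: "u \<in> S" "v \<in> S"
    have eq: "f u * g u - f v * g v = (f u - f v) * g u + f v * (g u - g v)" by (simp add: algebra_simps)
    have "padic_norm ((f u - f v) * g u) \<le> A / \<tau> * padic_norm (u - v) * B" using uv by (intro mm G Fl)
    moreover have "padic_norm (f v * (g u - g v)) \<le> A * (B / \<tau> * padic_norm (u - v))" using uv by (intro mm F Gl)
    ultimately show "padic_norm (f u * g u - f v * g v) \<le> A * B / \<tau> * padic_norm (u - v)"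
      unfolding eq by (intro padic_norm_add_le) (simp_all add: field_simps)
  qed
qed

lemma decaying_simple_pole:
  fixes b c :: "'p::prime_card padic"
  assumes S: "\<And>t. t \<in> S \<Longrightarrow> padic_norm (t - b) = \<tau>" and \<tau>: "0 < \<tau>"
  shows "decaying \<tau> S (padic_norm c / \<tau>) (\<lambda>t. c / (t - b)) (\<lambda>t. - (c / (t - b)\<^sup>2))"
  unfolding decaying_def
proof (intro conjI ballI)
  fix t assume t: "t \<in> S"
  have nz: "t - b \<noteq> 0" using S[OF t] \<tau> by auto
  show "padic_norm (c / (t - b)) \<le> padic_norm c / \<tau>" using S[OF t] by (simp add: padic_norm_divide)
  show "padic_norm (- (c / (t - b)\<^sup>2)) \<le> padic_norm c / \<tau> / \<tau>"
    using S[OF t] by (simp add: padic_norm_divide padic_norm_mult power2_eq_square)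
  show "quadratic_remainder S (\<lambda>t. c / (t - b)) t (- (c / (t - b)\<^sup>2)) (padic_norm c / \<tau> / \<tau>\<^sup>2)"
    unfolding quadratic_remainder_def
  proof (intro ballI)
    fix u v assume uv: "u \<in> S" "v \<in> S"
    define x y z where xyz: "x = u - b" "y = v - b" "z = t - b"
    have n: "padic_norm x = \<tau>" "padic_norm y = \<tau>" "padic_norm z = \<tau>" using S uv t by (auto simp: xyz)
    hence nz: "x \<noteq> 0" "y \<noteq> 0" "z \<noteq> 0" using \<tau> by auto
    let ?M = "max (padic_norm (u - t)) (padic_norm (v - t))"
    have diffs: "u - v = x - y" "u - t = x - z" "v - t = y - z" by (simp_all add: xyz)
    have "c / x - c / y - - (c / z\<^sup>2) * (x - y) = c * (x - y) * (x * (y - z) + z * (x - z)) / (z\<^sup>2 * (x * y))"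
      using nz by (simp add: divide_simps) (simp add: algebra_simps power2_eq_square)
    hence "padic_norm (c / x - c / y - - (c / z\<^sup>2) * (x - y))
      = padic_norm c * padic_norm (x - y) * padic_norm (x * (y - z) + z * (x - z)) / (\<tau>\<^sup>2 * (\<tau> * \<tau>))"
      by (simp only: padic_norm_divide padic_norm_mult padic_norm_power n)
    also have "\<dots> \<le> padic_norm c * padic_norm (x - y) * (\<tau> * ?M) / (\<tau>\<^sup>2 * (\<tau> * \<tau>))"
    proof (intro divide_right_mono mult_left_mono padic_norm_add_le)
      show "padic_norm (x * (y - z)) \<le> \<tau> * ?M" "padic_norm (z * (x - z)) \<le> \<tau> * ?M"
        using \<tau> by (simp_all add: padic_norm_mult n diffs)
    qed (use \<tau> in simp_all)
    also have "\<dots> = padic_norm c / \<tau> / \<tau>\<^sup>2 * padic_norm (x - y) * ?M"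
      using \<tau> by (simp add: field_simps power2_eq_square)
    finally show "padic_norm (c / (u - b) - c / (v - b) - - (c / (t - b)\<^sup>2) * (u - v))
      \<le> padic_norm c / \<tau> / \<tau>\<^sup>2 * padic_norm (u - v) * ?M"
      by (simp only: diffs flip: xyz)
  qed
next
  fix u v assume uv: "u \<in> S" "v \<in> S"
  have n: "padic_norm (u - b) = \<tau>" "padic_norm (v - b) = \<tau>" using S uv by auto
  hence nz: "u - b \<noteq> 0" "v - b \<noteq> 0" using \<tau> by auto
  have "c / (u - b) - c / (v - b) = - (c * (u - v) / ((u - b) * (v - b)))"
    using nz by (simp add: divide_simps) (simp add: algebra_simps)
  hence "padic_norm (c / (u - b) - c / (v - b)) = padic_norm c * padic_norm (u - v) / (\<tau> * \<tau>)"
    by (simp only: padic_norm_minus padic_norm_divide padic_norm_mult n)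
  thus "padic_norm (c / (u - b) - c / (v - b)) \<le> padic_norm c / \<tau> / \<tau> * padic_norm (u - v)" by simp
qed

lemma padic_norm_diff_nat_eq:
  assumes "1 < padic_norm (t :: 'p::prime_card padic)"
  shows "padic_norm (t - of_nat i) = padic_norm t"
proof -
  have "padic_norm (- of_nat i :: 'p padic) < padic_norm t"
    using padic_norm_of_nat_le_1[of i, where 'p='p] assms by (simp only: padic_norm_minus)
  from padic_norm_add_eq[OF this] show ?thesis by simp
qed

lemma gbinomial_nonzero:
  assumes "1 < padic_norm (t :: 'p::prime_card padic)"
  shows "t gchoose k \<noteq> 0"
proof -
  have "t - of_nat i \<noteq> 0" for i
    using padic_norm_diff_nat_eq[OF assms, of i] assms by auto
  thus ?thesis by (simp add: gbinomial_prod_rev)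
qed

definition gbinomial_ratio :: "nat \<Rightarrow> nat \<Rightarrow> 'p::prime_card padic \<Rightarrow> 'p padic" where
  "gbinomial_ratio d k t = (t gchoose k) / (t gchoose d)"

text \<open>The derivative of the ratio, as a logarithmic derivative: the ratio is a constant divided by the
  product of the factors \<open>t - i\<close> with \<open>k \<le> i < d\<close>.\<close>

definition gbinomial_ratio_deriv :: "nat \<Rightarrow> nat \<Rightarrow> 'p::prime_card padic \<Rightarrow> 'p padic" where
  "gbinomial_ratio_deriv d k t = - (gbinomial_ratio d k t * (\<Sum>i\<in>{k..<d}. 1 / (t - of_nat i)))"

lemma gbinomial_ratio_step:
  assumes t: "1 < padic_norm (t :: 'p::prime_card padic)"
  shows "gbinomial_ratio d k t = of_nat (Suc k) / (t - of_nat k) * gbinomial_ratio d (Suc k) t"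
proof -
  have "t - of_nat k \<noteq> 0" using padic_norm_diff_nat_eq[OF t, of k] t by auto
  moreover have "of_nat (Suc k) * (t gchoose Suc k) = (t - of_nat k) * (t gchoose k)"
    using gbinomial_mult_1[of t k] by (simp add: algebra_simps)
  ultimately have "t gchoose k = of_nat (Suc k) * (t gchoose Suc k) / (t - of_nat k)"
    by (simp del: of_nat_Suc)
  thus ?thesis unfolding gbinomial_ratio_def by (simp del: of_nat_Suc)
qed

lemma gbinomial_ratio_last:
  assumes t: "1 < padic_norm (t :: 'p::prime_card padic)"
  shows "gbinomial_ratio (Suc k) k t = of_nat (Suc k) / (t - of_nat k)"
    and "gbinomial_ratio_deriv (Suc k) k t = - (of_nat (Suc k) / (t - of_nat k)\<^sup>2)"
proof -
  show 1: "gbinomial_ratio (Suc k) k t = of_nat (Suc k) / (t - of_nat k)"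
    using gbinomial_ratio_step[OF t, of "Suc k" k] gbinomial_nonzero[OF t, of "Suc k"]
    by (simp add: gbinomial_ratio_def)
  show "gbinomial_ratio_deriv (Suc k) k t = - (of_nat (Suc k) / (t - of_nat k)\<^sup>2)"
    unfolding gbinomial_ratio_deriv_def 1 by (simp add: power2_eq_square)
qed

lemma decaying_cong:
  assumes "\<And>t. t \<in> S \<Longrightarrow> f t = g t" "\<And>t. t \<in> S \<Longrightarrow> f' t = g' t"
  shows "decaying \<tau> S A f f' \<longleftrightarrow> decaying \<tau> S A g g'"
  using assms by (simp add: decaying_def quadratic_remainder_def cong: ball_cong)

text \<open>The ratio is the product of the functions \<open>(i + 1) / (t - i)\<close> with \<open>k \<le> i < d\<close>. The factor with
  \<open>i = d - 1\<close> alone has the asserted bound, and the other factors have bounds at most 1. This is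
  where the absolute value of \<open>d\<close> in the final formula comes from.\<close>

lemma decaying_gbinomial_ratio:
  fixes S :: "'p::prime_card padic set"
  assumes S: "\<And>t. t \<in> S \<Longrightarrow> padic_norm t = \<tau>" and \<tau>: "1 < \<tau>" and k: "k < d"
  shows "decaying \<tau> S (padic_norm (of_nat d :: 'p padic) / \<tau>) (gbinomial_ratio d k) (gbinomial_ratio_deriv d k)"
proof -
  obtain d' where d: "d = Suc d'" using k by (cases d) auto
  have S1: "1 < padic_norm t" if "t \<in> S" for t using S[OF that] \<tau> by simp
  have pole: "padic_norm (t - of_nat i) = \<tau>" if "t \<in> S" for t i
    using padic_norm_diff_nat_eq[OF S1[OF that]] S[OF that] by simp
  have "k \<le> d'" using k d by simp
  thus ?thesis
  proof (induction rule: inc_induct)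
    case base
    have "decaying \<tau> S (padic_norm (of_nat d :: 'p padic) / \<tau>) (\<lambda>t. of_nat d / (t - of_nat d')) (\<lambda>t. - (of_nat d / (t - of_nat d')\<^sup>2))"
      using \<tau> by (intro decaying_simple_pole pole) auto
    also have "?this \<longleftrightarrow> ?case"
      unfolding d using S1 by (intro decaying_cong) (simp_all only: gbinomial_ratio_last)
    finally show ?case .
  next
    case (step k)
    let ?A = "padic_norm (of_nat d :: 'p padic) / \<tau>" and ?B = "padic_norm (of_nat (Suc k) :: 'p padic) / \<tau>"
    have "padic_norm (of_nat (Suc k) :: 'p padic) \<le> \<tau>"
      using padic_norm_of_nat_le_1[of "Suc k", where 'p='p] \<tau> by linarith
    hence B: "0 \<le> ?B" "?B \<le> 1" using \<tau> by (auto simp del: of_nat_Suc)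
    have A: "0 \<le> ?A" using \<tau> by auto
    have "decaying \<tau> S (?B * ?A) (\<lambda>t. of_nat (Suc k) / (t - of_nat k) * gbinomial_ratio d (Suc k) t)
      (\<lambda>t. - (of_nat (Suc k) / (t - of_nat k)\<^sup>2) * gbinomial_ratio d (Suc k) t
        + of_nat (Suc k) / (t - of_nat k) * gbinomial_ratio_deriv d (Suc k) t)"
      using \<tau> A B by (intro decaying_mult step.IH decaying_simple_pole pole) auto
    hence "decaying \<tau> S ?A (\<lambda>t. of_nat (Suc k) / (t - of_nat k) * gbinomial_ratio d (Suc k) t)
      (\<lambda>t. - (of_nat (Suc k) / (t - of_nat k)\<^sup>2) * gbinomial_ratio d (Suc k) t
        + of_nat (Suc k) / (t - of_nat k) * gbinomial_ratio_deriv d (Suc k) t)"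
      by (rule decaying_mono) (use mult_right_mono[OF B(2) A] \<tau> in auto)
    also have "?this \<longleftrightarrow> ?case"
    proof (rule decaying_cong)
      fix t assume t: "t \<in> S"
      show "of_nat (Suc k) / (t - of_nat k) * gbinomial_ratio d (Suc k) t = gbinomial_ratio d k t"
        by (rule gbinomial_ratio_step[OF S1[OF t], symmetric])
      have "{k..<d} = insert k {Suc k..<d}" using step.hyps d by auto
      hence "(\<Sum>i\<in>{k..<d}. 1 / (t - of_nat i)) = 1 / (t - of_nat k) + (\<Sum>i\<in>{Suc k..<d}. 1 / (t - of_nat i))"
        by simp
      thus "- (of_nat (Suc k) / (t - of_nat k)\<^sup>2) * gbinomial_ratio d (Suc k) t
        + of_nat (Suc k) / (t - of_nat k) * gbinomial_ratio_deriv d (Suc k) t = gbinomial_ratio_deriv d k t"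
        unfolding gbinomial_ratio_deriv_def gbinomial_ratio_step[OF S1[OF t], of d k]
        by (simp add: power2_eq_square distrib_left del: of_nat_Suc)
    qed
    finally show ?case .
  qed
qed

section \<open>Counting the zeros of the random polynomial\<close>

lemma num_zeros_finite_Union:
  assumes "finite I" "disjoint_family_on A I"
  shows "num_zeros f (\<Union>i\<in>I. A i) = (\<Sum>i\<in>I. num_zeros f (A i))"
proof -
  have "{t \<in> (\<Union>i\<in>I. A i). f t = 0} = (\<Union>i\<in>I. {t \<in> A i. f t = 0})" by auto
  moreover have "disjoint_family_on (\<lambda>i. {t \<in> A i. f t = 0}) I"
    using assms(2) by (fastforce simp: disjoint_family_on_def)
  ultimately show ?thesis
    unfolding num_zeros_def using assms(1) by (simp add: sum_emeasure)
qed

lemma num_zeros_UN_nat: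
  assumes "disjoint_family A"
  shows "num_zeros f (\<Union>i::nat. A i) = (\<Sum>i. num_zeros f (A i))"
proof -
  have "{t \<in> (\<Union>i. A i). f t = 0} = (\<Union>i. {t \<in> A i. f t = 0})" by auto
  moreover have "disjoint_family (\<lambda>i. {t \<in> A i. f t = 0})"
    using assms by (fastforce simp: disjoint_family_on_def)
  ultimately show ?thesis
    unfolding num_zeros_def by (simp add: suminf_emeasure)
qed

lemma num_zeros_Un:
  assumes "A \<inter> B = {}"
  shows "num_zeros f (A \<union> B) = num_zeros f A + num_zeros f B"
proof -
  have "{t \<in> A \<union> B. f t = 0} = {t \<in> A. f t = 0} \<union> {t \<in> B. f t = 0}" by auto
  thus ?thesis unfolding num_zeros_def using assms by (simp add: plus_emeasure disjoint_iff)
qed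

lemma has_expectation_finite_sum:
  assumes "finite I" "\<And>i. i \<in> I \<Longrightarrow> has_expectation M (X i) e" "0 \<le> e"
  shows "has_expectation M (\<lambda>\<omega>. \<Sum>i\<in>I. X i \<omega>) (real (card I) * e)"
proof -
  have "(\<integral>\<^sup>+ \<omega>. (\<Sum>i\<in>I. X i \<omega>) \<partial>M) = (\<Sum>i\<in>I. \<integral>\<^sup>+ \<omega>. X i \<omega> \<partial>M)"
    using assms by (intro nn_integral_sum) (auto simp: has_expectation_def)
  also have "\<dots> = (\<Sum>i\<in>I. ennreal e)" using assms by (intro sum.cong) (auto simp: has_expectation_def)
  also have "\<dots> = ennreal (real (card I) * e)"
    using assms(3) by (simp add: ennreal_mult' ennreal_of_nat_eq_real_of_nat)
  finally show ?thesis
    using assms unfolding has_expectation_def by (blast intro: borel_measurable_sum)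
qed

lemma has_expectation_suminf:
  assumes X: "\<And>i. has_expectation M (X i) (e i)" and e: "e sums s" "\<And>i. 0 \<le> e i"
  shows "has_expectation M (\<lambda>\<omega>. \<Sum>i. X i \<omega>) s"
proof -
  have [measurable]: "X i \<in> borel_measurable M" for i using X by (simp add: has_expectation_def)
  have "(\<integral>\<^sup>+ \<omega>. (\<Sum>i. X i \<omega>) \<partial>M) = (\<Sum>i. \<integral>\<^sup>+ \<omega>. X i \<omega> \<partial>M)"
    by (rule nn_integral_suminf) measurable
  also have "\<dots> = (\<Sum>i. ennreal (e i))" using X by (simp add: has_expectation_def)
  also have "\<dots> = ennreal s" using e by (metis suminf_ennreal_eq)
  finally show ?thesis unfolding has_expectation_def by simp
qed

lemma has_expectation_add:
  assumes "has_expectation M X a" "has_expectation M Y b" "0 \<le> a" "0 \<le> b"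
  shows "has_expectation M (\<lambda>\<omega>. X \<omega> + Y \<omega>) (a + b)"
  using assms by (auto simp: has_expectation_def nn_integral_add ennreal_plus)

lemma padic_annulus_eq:
  assumes "m \<ge> 1"
  shows "padic_scaled_integers m - padic_scaled_integers (m - 1)
    = {t :: 'p::prime_card padic. padic_norm t = real CARD('p) powi int m}"
proof (intro equalityI subsetI)
  fix t :: "'p padic"
  assume "t \<in> padic_scaled_integers m - padic_scaled_integers (m - 1)"
  hence t: "padic_norm t \<le> real CARD('p) powi int m" "\<not> padic_norm t \<le> real CARD('p) powi int (m - 1)"
    unfolding padic_scaled_integers_eq_disc in_padic_disc Diff_iff diff_zero by blast+
  hence "t \<noteq> 0" by (auto simp: less_imp_le)
  then obtain k where k: "padic_norm t = real CARD('p) powi k" by (rule padic_norm_value_group)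
  have "k = int m" using t assms unfolding k powi_le_card_iff by linarith
  thus "t \<in> {t. padic_norm t = real CARD('p) powi int m}" by (simp only: k mem_Collect_eq)
next
  fix t :: "'p padic"
  assume "t \<in> {t. padic_norm t = real CARD('p) powi int m}"
  hence t: "padic_norm t = real CARD('p) powi int m" by (simp only: mem_Collect_eq)
  show "t \<in> padic_scaled_integers m - padic_scaled_integers (m - 1)"
    unfolding padic_scaled_integers_eq_disc in_padic_disc Diff_iff diff_zero t powi_le_card_iff
    using assms by simp
qed

text \<open>Divided by \<open>q\<^sup>m\<close>, these are the centres of the unit discs that partition the annulus of radius
  \<open>q\<^sup>m\<close>.\<close>

definition annulus_centres :: "nat \<Rightarrow> nat \<Rightarrow> nat set" where
  "annulus_centres q m = {j. j < q ^ m \<and> \<not> q dvd j}"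

lemma card_annulus_centres:
  assumes "q > 0" "m \<ge> 1"
  shows "card (annulus_centres q m) = q ^ m - q ^ (m - 1)"
proof -
  obtain l where m: "m = Suc l" using assms(2) by (cases m) auto
  have "annulus_centres q m = {..<q ^ m} - (*) q ` {..<q ^ l}"
    using assms(1) by (auto simp: annulus_centres_def m elim!: dvdE)
  moreover have "(*) q ` {..<q ^ l} \<subseteq> {..<q ^ m}" using assms(1) by (auto simp: m)
  moreover have "card ((*) q ` {..<q ^ l}) = q ^ l"
    using assms(1) by (subst card_image) (auto simp: inj_on_def)
  ultimately show ?thesis by (simp add: card_Diff_subset m)
qed

lemma padic_norm_prime_to_p:
  assumes "\<not> CARD('p::prime_card) dvd j"
  shows "padic_norm (of_nat j :: 'p padic) = 1"
proof -
  have "j > 0" using assms by (cases j) auto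
  moreover have "\<not> int CARD('p) dvd int j" using assms by simp
  hence "multiplicity (int CARD('p)) (int j) = 0" by (rule not_dvd_imp_multiplicity_0)
  ultimately show ?thesis by (simp add: padic_norm_of_nat)
qed

lemma annulus_centre_norm:
  assumes "j \<in> annulus_centres CARD('p::prime_card) m"
  shows "padic_norm (of_nat j / of_nat CARD('p) ^ m :: 'p padic) = real CARD('p) powi int m"
proof -
  have "padic_norm (of_nat j :: 'p padic) = 1"
    using assms by (intro padic_norm_prime_to_p) (simp add: annulus_centres_def)
  thus ?thesis
    unfolding padic_norm_divide padic_norm_power padic_norm_card power_inverse power_int_of_nat
    by (simp add: divide_inverse)
qed

lemma norm_on_annulus_disc:
  assumes j: "j \<in> annulus_centres CARD('p::prime_card) m" and m: "m \<ge> 1"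
    and t: "t \<in> padic_disc (of_nat j / of_nat CARD('p) ^ m :: 'p padic) 0"
  shows "padic_norm t = real CARD('p) powi int m"
proof -
  let ?a = "of_nat j / of_nat CARD('p) ^ m :: 'p padic"
  have "real CARD('p) powi 0 < real CARD('p) powi int m"
    unfolding powi_less_card_iff using m by simp
  hence "padic_norm (t - ?a) < padic_norm ?a"
    using t unfolding annulus_centre_norm[OF j] in_padic_disc by linarith
  from padic_norm_add_eq[OF this] show ?thesis by (simp only: annulus_centre_norm[OF j]) simp
qed

lemma annulus_eq_Union_discs:
  assumes m: "m \<ge> 1"
  shows "{t :: 'p::prime_card padic. padic_norm t = real CARD('p) powi int m}
    = (\<Union>j\<in>annulus_centres CARD('p) m. padic_disc (of_nat j / of_nat CARD('p) ^ m) 0)"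
proof (intro equalityI subsetI)
  fix t :: "'p padic" assume "t \<in> {t. padic_norm t = real CARD('p) powi int m}"
  hence t: "padic_norm t = real CARD('p) ^ m" by simp
  let ?P = "of_nat CARD('p) ^ m :: 'p padic"
  have P: "padic_norm ?P = inverse (real CARD('p)) ^ m" "?P \<noteq> 0"
    by (simp_all add: padic_norm_power)
  have Pt: "padic_norm (?P * t) = 1"
    unfolding padic_norm_mult P(1) t by (simp flip: power_mult_distrib)
  then obtain j where j: "j < CARD('p) ^ m" "padic_norm (?P * t - of_nat j) \<le> real CARD('p) powi (- int m)"
    using nat_approximation[of "?P * t" m] by auto
  have "\<not> CARD('p) dvd j"
  proof
    assume "CARD('p) dvd j"
    hence "int CARD('p) ^ 1 dvd int j" by simp
    hence "padic_norm (of_int (int j) :: 'p padic) \<le> real CARD('p) powi (- int 1)"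
      by (subst padic_norm_of_int_le_iff)
    moreover have "real CARD('p) powi (- int m) \<le> real CARD('p) powi (- int 1)"
      unfolding powi_le_card_iff using m by simp
    ultimately have "padic_norm ((?P * t - of_nat j) + of_nat j) \<le> real CARD('p) powi (- int 1)"
      using j(2) by (intro padic_norm_add_le) auto
    moreover have "real CARD('p) powi (- int 1) < real CARD('p) powi 0"
      unfolding powi_less_card_iff by simp
    ultimately show False using Pt by simp
  qed
  hence "j \<in> annulus_centres CARD('p) m" using j(1) by (simp add: annulus_centres_def)
  moreover have "t \<in> padic_disc (of_nat j / ?P) 0"
  proof -
    have "t - of_nat j / ?P = (?P * t - of_nat j) / ?P" using P(2) by (simp add: field_simps)
    hence "padic_norm (t - of_nat j / ?P) = padic_norm (?P * t - of_nat j) / inverse (real CARD('p)) ^ m"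
      by (simp only: padic_norm_divide P(1))
    also have "\<dots> \<le> real CARD('p) powi (- int m) / inverse (real CARD('p)) ^ m"
      using j(2) by (intro divide_right_mono) auto
    also have "\<dots> = 1" unfolding power_int_minus power_int_of_nat power_inverse by simp
    finally show ?thesis by (simp add: in_padic_disc)
  qed
  ultimately show "t \<in> (\<Union>j\<in>annulus_centres CARD('p) m. padic_disc (of_nat j / ?P) 0)" by blast
qed (use norm_on_annulus_disc[OF _ m] in blast)

lemma disjoint_annulus_discs:
  "disjoint_family_on (\<lambda>j. padic_disc (of_nat j / of_nat CARD('p) ^ m :: 'p::prime_card padic) 0)
    (annulus_centres CARD('p) m)"
  unfolding disjoint_family_on_def
proof (intro ballI impI, rule ccontr)
  fix i j
  let ?P = "of_nat CARD('p) ^ m :: 'p padic"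
  assume ij: "i \<in> annulus_centres CARD('p) m" "j \<in> annulus_centres CARD('p) m" "i \<noteq> j"
    and "padic_disc (of_nat i / ?P) 0 \<inter> padic_disc (of_nat j / ?P) 0 \<noteq> {}"
  then obtain t where "padic_norm (t - of_nat j / ?P) \<le> 1" "padic_norm (t - of_nat i / ?P) \<le> 1"
    by (auto simp: in_padic_disc)
  from padic_norm_diff_le[OF this] have "padic_norm ((of_nat i - of_nat j) / ?P) \<le> 1"
    by (simp add: diff_divide_distrib)
  hence "padic_norm (of_nat i - of_nat j :: 'p padic) \<le> real CARD('p) powi (- int m)"
    unfolding padic_norm_divide padic_norm_power padic_norm_card
    by (simp add: power_int_minus power_inverse divide_le_eq)
  hence "i mod CARD('p) ^ m = j mod CARD('p) ^ m" unfolding padic_norm_of_nat_diff_le_iff .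
  thus False using ij by (simp add: annulus_centres_def)
qed

text \<open>The weights of the annuli are indexed from 1, so the geometric series starts with \<open>1 / q\<close> and
  its sum cancels the factor \<open>1 - 1 / q\<close>.\<close>

lemma annuli_sums:
  fixes q c :: real
  assumes q: "1 < q"
  shows "(\<lambda>i. c / q ^ Suc i * ((1 - 1 / q) / (1 + 1 / q))) sums (c * (1 / q) / (1 + 1 / q))"
proof -
  define r where "r = (1 - 1 / q) / (1 + 1 / q)"
  have "(\<lambda>i. (1 / q) ^ i) sums (1 / (1 - 1 / q))"
    using q by (intro geometric_sums) simp
  hence "(\<lambda>i. c * (1 / q) * r * (1 / q) ^ i) sums (c * (1 / q) * r * (1 / (1 - 1 / q)))"
    by (rule sums_mult)
  moreover have "c * (1 / q) * r * (1 / q) ^ i = c / q ^ Suc i * r" for i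
    by (simp add: power_one_over)
  moreover have "c * (1 / q) * r * (1 / (1 - 1 / q)) = c * (1 / q) / (1 + 1 / q)"
  proof -
    have "1 - 1 / q \<noteq> 0" using q by simp
    moreover have "c * (1 / q) * (x / y) * (1 / x) = c * (1 / q) / y" if "x \<noteq> 0" for x y
      using that by simp
    ultimately show ?thesis unfolding r_def by blast
  qed
  ultimately show ?thesis unfolding r_def[symmetric] by (simp only:)
qed

lemma infsum_annuli:
  fixes q c :: real
  assumes q: "1 < q" and c: "0 \<le> c"
  shows "(\<Sum>\<^sub>\<infinity>m\<in>{1::nat..}. c / q ^ m * ((1 - 1 / q) / (1 + 1 / q))) = c * (1 / q) / (1 + 1 / q)"
proof -
  let ?f = "\<lambda>m. c / q ^ m * ((1 - 1 / q) / (1 + 1 / q))"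
  have "0 \<le> ?f m" for m using q c by (intro mult_nonneg_nonneg divide_nonneg_nonneg) auto
  hence "((\<lambda>i. ?f (Suc i)) has_sum (c * (1 / q) / (1 + 1 / q))) UNIV"
    by (intro sums_nonneg_imp_has_sum annuli_sums q)
  moreover have "bij_betw Suc UNIV {1..}"
    by (rule bij_betwI[where g = "\<lambda>n. n - 1"]) auto
  ultimately have "(?f has_sum (c * (1 / q) / (1 + 1 / q))) {1..}"
    using has_sum_reindex_bij_betw[of Suc UNIV "{1..}" ?f] by blast
  thus ?thesis by (rule infsumI)
qed

locale random_binomial_polynomial = prob_space M
  for M :: "'a measure" +
  fixes \<zeta> :: "nat \<Rightarrow> 'a \<Rightarrow> 'p::prime_card padic" and d :: nat
  assumes d: "d \<ge> 1"
    and indep: "indep_vars (\<lambda>_. borel) \<zeta> {..d}"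
    and uniform: "\<And>k. k \<le> d \<Longrightarrow> residue_uniform M (\<zeta> k)"
begin

definition q where "q = real CARD('p)"

definition g where "g \<omega> = binomial_poly d (\<lambda>k. \<zeta> k \<omega>)"

lemma q_gt_1: "1 < q" and q_pos: "0 < q"
  unfolding q_def by (rule card_gt_1, rule card_pos)

lemma powi_minus_double: "q powi (- 2 * int m) = 1 / q powi int m / q powi int m"
proof -
  have "- 2 * int m = - int m + - int m" by simp
  hence "q powi (- 2 * int m) = q powi (- int m) * q powi (- int m)"
    using q_pos power_int_add[of q "- int m" "- int m"] by simp
  thus ?thesis by (simp add: power_int_minus divide_inverse)
qed

lemma uniform_coefficients_minus: "k \<le> d \<Longrightarrow> uniform_coefficients M \<zeta> k ({..d} - {k})"
  by unfold_locales (use indep uniform in \<open>auto simp: insert_absorb\<close>)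

text \<open>Here the constant polynomial, with coefficient \<open>\<zeta> 0\<close>, is the normalised coordinate.\<close>

lemma expected_zeros_integers:
  assumes L: "CARD('p) ^ L \<le> d" "d < CARD('p) ^ Suc L"
  shows "has_expectation M (\<lambda>\<omega>. num_zeros (g \<omega>) padic_integers) (q powi int L / (1 + 1 / q))"
proof -
  interpret U: uniform_coefficients M \<zeta> 0 "{..d} - {0}" by (rule uniform_coefficients_minus) simp
  have k: "k < CARD('p) ^ Suc L" if "k \<in> {..d} - {0}" for k using that L(2) by auto
  have "has_expectation M (\<lambda>\<omega>. num_zeros (\<lambda>u. \<zeta> 0 \<omega> + (\<Sum>k\<in>{..d} - {0}. \<zeta> k \<omega> * (u gchoose k))) (padic_disc 0 0))
    (real CARD('p) powi int L / (1 + 1 / real CARD('p)))"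
  proof (rule U.expected_zeros_unit_disc[where D = gbinomial_deriv and \<kappa> = "2 * int L" and ?k1.0 = "CARD('p) ^ L"])
    fix k t assume kt: "k \<in> {..d} - {0}" "t \<in> padic_disc (0 :: 'p padic) 0"
    hence t: "padic_norm t \<le> 1" by (simp add: in_padic_disc)
    show "padic_norm (t gchoose k) \<le> 1" by (rule padic_norm_gbinomial_le_1[OF t])
    show "quadratic_remainder (padic_disc 0 0) (\<lambda>u. u gchoose k) t (gbinomial_deriv k t) (real CARD('p) powi (2 * int L))"
      by (rule quadratic_remainder_gbinomial[OF k[OF kt(1)] kt(2)])
    show "padic_norm (gbinomial_deriv k t) \<le> real CARD('p) powi int L"
      by (rule padic_norm_gbinomial_deriv_le[OF k[OF kt(1)] t])
  next
    show "CARD('p) ^ L \<in> {..d} - {0}" using L by simp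
    show "padic_norm (gbinomial_deriv (CARD('p) ^ L) t) = real CARD('p) powi int L" if "t \<in> padic_disc 0 0" for t :: "'p padic"
      using that by (intro padic_norm_gbinomial_deriv_prime_power) (simp add: in_padic_disc)
  qed
  moreover have "(\<lambda>u. \<zeta> 0 \<omega> + (\<Sum>k\<in>{..d} - {0}. \<zeta> k \<omega> * (u gchoose k))) = g \<omega>" for \<omega>
    unfolding g_def binomial_poly_def by (subst sum.remove[of "{..d}" 0]) auto
  ultimately show ?thesis by (simp only: padic_integers_eq_disc q_def)
qed

text \<open>Outside the p-adic integers the binomial polynomial of degree \<open>d\<close> dominates. Dividing by it does
  not change the zeros and makes \<open>\<zeta> d\<close> the normalised coefficient. The largest derivative is that
  of the ratio with \<open>k = d - 1\<close>.\<close>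

lemma expected_zeros_annulus_disc:
  assumes m: "m \<ge> 1" and S: "\<And>t. t \<in> padic_disc a 0 \<Longrightarrow> padic_norm t = q powi int m"
  shows "has_expectation M (\<lambda>\<omega>. num_zeros (g \<omega>) (padic_disc a 0))
    (padic_norm (of_nat d :: 'p padic) * q powi (- 2 * int m) / (1 + 1 / q))"
proof -
  interpret U: uniform_coefficients M \<zeta> d "{..d} - {d}" by (rule uniform_coefficients_minus) simp
  define e where "e = - int (multiplicity (int CARD('p)) (int d)) - 2 * int m"
  let ?\<tau> = "q powi int m" and ?nd = "padic_norm (of_nat d :: 'p padic)"
  have "q powi 0 < q powi int m" unfolding q_def powi_less_card_iff using m by simp
  hence \<tau>: "1 < ?\<tau>" by simp
  have nd: "?nd \<le> 1" by simp
  have \<tau>2: "?nd / ?\<tau> / ?\<tau> = ?nd * q powi (- 2 * int m)"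
    unfolding powi_minus_double by simp
  have e: "?nd * q powi (- 2 * int m) = q powi e"
    unfolding padic_norm_of_nat[OF less_le_trans[OF zero_less_one d]] e_def q_def
    unfolding power_int_add[OF disjI1[OF less_imp_neq[OF card_pos, symmetric]], symmetric] by simp
  have dec: "decaying ?\<tau> (padic_disc a 0) (?nd / ?\<tau>) (gbinomial_ratio d k) (gbinomial_ratio_deriv d k)" if "k < d" for k
    using S \<tau> that by (rule decaying_gbinomial_ratio)
  have t1: "1 < padic_norm t" if "t \<in> padic_disc a 0" for t using S[OF that] \<tau> by simp
  have H: "has_expectation M (\<lambda>\<omega>. num_zeros (\<lambda>u. \<zeta> d \<omega> + (\<Sum>k\<in>{..d} - {d}. \<zeta> k \<omega> * gbinomial_ratio d k u)) (padic_disc a 0))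
    (real CARD('p) powi e / (1 + 1 / real CARD('p)))"
  proof (rule U.expected_zeros_unit_disc[where D = "gbinomial_ratio_deriv d" and \<kappa> = 0 and ?k1.0 = "d - 1"])
    fix k t assume kt: "k \<in> {..d} - {d}" "t \<in> padic_disc a 0"
    hence k: "k < d" by auto
    \<comment> \<open>The remainder constant is at most 1, since \<open>\<bar>d\<bar> \<le> 1 < \<tau>\<close>; hence \<open>\<kappa> = 0\<close>.\<close>
    note D = dec[OF k, unfolded decaying_def]
    have "?nd \<le> ?\<tau>" using nd \<tau> by linarith
    hence A1: "?nd / ?\<tau> \<le> 1" using \<tau> by (intro divide_le_eq_1[THEN iffD2]) linarith
    thus "padic_norm (gbinomial_ratio d k t) \<le> 1" using D kt(2) by (meson order_trans)
    have "1 \<le> ?\<tau>\<^sup>2" using \<tau> by (simp add: one_le_power)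
    hence "?nd / ?\<tau> / ?\<tau>\<^sup>2 \<le> 1" using A1 by (intro divide_le_eq_1[THEN iffD2]) auto
    moreover have "quadratic_remainder (padic_disc a 0) (gbinomial_ratio d k) t (gbinomial_ratio_deriv d k t) (?nd / ?\<tau> / ?\<tau>\<^sup>2)"
      using D kt(2) by blast
    ultimately show "quadratic_remainder (padic_disc a 0) (gbinomial_ratio d k) t (gbinomial_ratio_deriv d k t) (real CARD('p) powi 0)"
      unfolding power_int_0_right by (rule quadratic_remainder_mono[rotated])
    have "padic_norm (gbinomial_ratio_deriv d k t) \<le> ?nd / ?\<tau> / ?\<tau>" using D kt(2) by blast
    thus "padic_norm (gbinomial_ratio_deriv d k t) \<le> real CARD('p) powi e" unfolding \<tau>2 e unfolding q_def .
  next
    show "d - 1 \<in> {..d} - {d}" using d by auto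
    fix t assume t: "t \<in> padic_disc a 0"
    have Sd: "Suc (d - 1) = d" using d by simp
    have "gbinomial_ratio_deriv d (d - 1) t = - (of_nat d / (t - of_nat (d - 1))\<^sup>2)"
      using gbinomial_ratio_last(2)[OF t1[OF t], of "d - 1"] unfolding Sd .
    hence "padic_norm (gbinomial_ratio_deriv d (d - 1) t) = ?nd / ?\<tau> / ?\<tau>"
      by (simp only: padic_norm_minus padic_norm_divide padic_norm_mult padic_norm_diff_nat_eq[OF t1[OF t]] S[OF t]
          power2_eq_square divide_divide_eq_left)
    thus "padic_norm (gbinomial_ratio_deriv d (d - 1) t) = real CARD('p) powi e" unfolding \<tau>2 e unfolding q_def .
  qed
  have eq: "num_zeros (\<lambda>u. \<zeta> d \<omega> + (\<Sum>k\<in>{..d} - {d}. \<zeta> k \<omega> * gbinomial_ratio d k u)) (padic_disc a 0)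
    = num_zeros (g \<omega>) (padic_disc a 0)" for \<omega>
  proof -
    have "\<zeta> d \<omega> + (\<Sum>k\<in>{..d} - {d}. \<zeta> k \<omega> * gbinomial_ratio d k u) = 0 \<longleftrightarrow> g \<omega> u = 0"
      if u: "u \<in> padic_disc a 0" for u
    proof -
      have nz: "u gchoose d \<noteq> 0" by (rule gbinomial_nonzero[OF t1[OF u]])
      have "g \<omega> u = \<zeta> d \<omega> * (u gchoose d) + (\<Sum>k\<in>{..d} - {d}. \<zeta> k \<omega> * (u gchoose k))"
        unfolding g_def binomial_poly_def by (subst sum.remove[of "{..d}" d]) auto
      also have "\<dots> = (\<zeta> d \<omega> + (\<Sum>k\<in>{..d} - {d}. \<zeta> k \<omega> * gbinomial_ratio d k u)) * (u gchoose d)"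
        using nz by (simp add: distrib_right sum_distrib_right gbinomial_ratio_def)
      finally show ?thesis using nz by simp
    qed
    hence "{t \<in> padic_disc a 0. \<zeta> d \<omega> + (\<Sum>k\<in>{..d} - {d}. \<zeta> k \<omega> * gbinomial_ratio d k t) = 0}
      = {t \<in> padic_disc a 0. g \<omega> t = 0}" by blast
    thus ?thesis by (simp only: num_zeros_def)
  qed
  show ?thesis using H unfolding eq e unfolding q_def .
qed

lemma expected_zeros_annulus:
  assumes m: "m \<ge> 1"
  shows "has_expectation M (\<lambda>\<omega>. num_zeros (g \<omega>) (padic_scaled_integers m - padic_scaled_integers (m - 1)))
    (padic_norm (of_nat d :: 'p padic) / q ^ m * ((1 - 1 / q) / (1 + 1 / q)))"
proof -
  let ?J = "annulus_centres CARD('p) m" and ?nd = "padic_norm (of_nat d :: 'p padic)"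
  let ?a = "\<lambda>j. of_nat j / of_nat CARD('p) ^ m :: 'p padic"
  let ?v = "?nd * q powi (- 2 * int m) / (1 + 1 / q)"
  have fin: "finite ?J" by (simp add: annulus_centres_def)
  have H: "has_expectation M (\<lambda>\<omega>. \<Sum>j\<in>?J. num_zeros (g \<omega>) (padic_disc (?a j) 0)) (real (card ?J) * ?v)"
  proof (rule has_expectation_finite_sum[OF fin])
    fix j assume "j \<in> ?J"
    from norm_on_annulus_disc[OF this m]
    show "has_expectation M (\<lambda>\<omega>. num_zeros (g \<omega>) (padic_disc (?a j) 0)) ?v"
      unfolding q_def[symmetric] by (rule expected_zeros_annulus_disc[OF m])
  next
    show "0 \<le> ?v" using q_pos by (simp add: zero_le_power_int)
  qed
  have v: "real (card ?J) * ?v = ?nd / q ^ m * ((1 - 1 / q) / (1 + 1 / q))"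
  proof -
    obtain l where l: "m = Suc l" using m by (cases m) auto
    have pos: "0 < CARD('p)" by (rule prime_gt_0_nat[OF prime_card])
    hence "CARD('p) ^ l \<le> CARD('p) ^ m" by (intro power_increasing) (simp_all add: l)
    hence "real (card ?J) = q ^ m - q ^ l"
      unfolding card_annulus_centres[OF pos m] q_def by (simp add: l of_nat_diff)
    also have "\<dots> = q ^ m * (1 - 1 / q)" using q_pos by (simp add: l right_diff_distrib)
    finally have c: "real (card ?J) = q ^ m * (1 - 1 / q)" .
    have p: "q powi (- 2 * int m) = 1 / q ^ m / q ^ m"
      unfolding powi_minus_double power_int_of_nat by (rule refl)
    have "q ^ m * x * (n * (1 / q ^ m / q ^ m) / y) = n / q ^ m * (x / y)" for n x y
      using q_pos by simp
    thus ?thesis unfolding c p .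
  qed
  have U: "num_zeros (g \<omega>) (padic_scaled_integers m - padic_scaled_integers (m - 1))
      = (\<Sum>j\<in>?J. num_zeros (g \<omega>) (padic_disc (?a j) 0))" for \<omega>
    unfolding padic_annulus_eq[OF m] annulus_eq_Union_discs[OF m]
    by (rule num_zeros_finite_Union[OF fin disjoint_annulus_discs])
  show ?thesis unfolding U by (rule H[unfolded v])
qed

lemma expected_zeros:
  assumes L: "CARD('p) ^ L \<le> d" "d < CARD('p) ^ Suc L"
  shows "has_expectation M (\<lambda>\<omega>. num_zeros (g \<omega>) UNIV)
    (q powi int L / (1 + 1 / q) + padic_norm (of_nat d :: 'p padic) * (1 / q) / (1 + 1 / q))"
proof -
  let ?nd = "padic_norm (of_nat d :: 'p padic)"
  let ?A = "\<lambda>i. padic_scaled_integers (Suc i) - padic_scaled_integers (Suc i - 1) :: 'p padic set"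
  have A: "?A i = {t. padic_norm t = real CARD('p) powi int (Suc i)}" for i
    by (rule padic_annulus_eq) simp
  have disj_A: "disjoint_family ?A"
    unfolding A disjoint_family_on_def
  proof (intro ballI impI, rule ccontr)
    fix i j :: nat
    assume "i \<noteq> j" and "{t :: 'p padic. padic_norm t = real CARD('p) powi int (Suc i)} \<inter>
      {t. padic_norm t = real CARD('p) powi int (Suc j)} \<noteq> {}"
    then have "real CARD('p) powi int (Suc i) = real CARD('p) powi int (Suc j)" by auto
    hence "int (Suc i) = int (Suc j)" by (metis order_antisym order_refl powi_le_card_iff)
    thus False using \<open>i \<noteq> j\<close> by simp
  qed
  have disj: "padic_integers \<inter> (\<Union>i. ?A i) = {}"
  proof -
    have "\<not> real CARD('p) powi int (Suc i) \<le> real CARD('p) powi 0" for i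
      unfolding powi_le_card_iff by simp
    thus ?thesis unfolding A padic_integers_def by auto
  qed
  have "padic_integers \<union> (\<Union>i. ?A i) = UNIV"
  proof (rule equalityI[OF subset_UNIV subsetI])
    fix t :: "'p padic"
    show "t \<in> padic_integers \<union> (\<Union>i. ?A i)"
    proof (cases "padic_norm t \<le> 1")
      case False
      hence "t \<noteq> 0" by auto
      then obtain k where k: "padic_norm t = real CARD('p) powi k" by (rule padic_norm_value_group)
      have "\<not> real CARD('p) powi k \<le> real CARD('p) powi 0" using False k by simp
      hence "0 < k" unfolding powi_le_card_iff by simp
      hence "k = int (Suc (nat k - 1))" by simp
      hence "t \<in> ?A (nat k - 1)" unfolding A using k by (metis mem_Collect_eq)
      thus ?thesis by blast
    qed (simp add: padic_integers_def)
  qed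
  note cover = this
  have split: "num_zeros (g \<omega>) UNIV = num_zeros (g \<omega>) padic_integers + (\<Sum>i. num_zeros (g \<omega>) (?A i))" for \<omega>
    unfolding cover[symmetric] num_zeros_Un[OF disj] num_zeros_UN_nat[OF disj_A] by (rule refl)
  have "has_expectation M (\<lambda>\<omega>. \<Sum>i. num_zeros (g \<omega>) (?A i)) (?nd * (1 / q) / (1 + 1 / q))"
  proof (rule has_expectation_suminf)
    show "has_expectation M (\<lambda>\<omega>. num_zeros (g \<omega>) (?A i)) (?nd / q ^ Suc i * ((1 - 1 / q) / (1 + 1 / q)))" for i
      by (rule expected_zeros_annulus) simp
    show "(\<lambda>i. ?nd / q ^ Suc i * ((1 - 1 / q) / (1 + 1 / q))) sums (?nd * (1 / q) / (1 + 1 / q))"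
      by (rule annuli_sums[OF q_gt_1])
    show "0 \<le> ?nd / q ^ Suc i * ((1 - 1 / q) / (1 + 1 / q))" for i
      using q_gt_1 by (intro mult_nonneg_nonneg divide_nonneg_nonneg) auto
  qed
  moreover have "0 \<le> q powi int L / (1 + 1 / q)" "0 \<le> ?nd * (1 / q) / (1 + 1 / q)"
    using q_pos by (auto intro!: divide_nonneg_nonneg)
  ultimately show ?thesis
    unfolding split by (intro has_expectation_add expected_zeros_integers L)
qed

end

theorem theorem5:
  fixes M :: "'a measure"
    and \<zeta> :: "nat \<Rightarrow> 'a \<Rightarrow> 'p::prime_card padic"
    and d p :: nat
  assumes "p = CARD('p)"
    and "d \<ge> 1"
    and "prob_space M"
    and "prob_space.indep_vars M (\<lambda>_. borel) \<zeta> {..d}"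
    and "\<And>k. k \<le> d \<Longrightarrow> uniform_padic_integers M (\<zeta> k)"
  defines "g \<equiv> \<lambda>\<omega>. binomial_poly d (\<lambda>k. \<zeta> k \<omega>)"
  shows "has_expectation M (\<lambda>\<omega>. num_zeros (g \<omega>) padic_integers)
           (real p powi \<lfloor>log (real p) (real d)\<rfloor> / (1 + 1 / real p))
    \<and> (\<forall>m::nat. m \<ge> 1 \<longrightarrow>
         has_expectation M
           (\<lambda>\<omega>. num_zeros (g \<omega>) (padic_scaled_integers m - padic_scaled_integers (m - 1)))
           (padic_norm (of_nat d :: 'p padic) / real p ^ m
              * ((1 - 1 / real p) / (1 + 1 / real p))))
    \<and> has_expectation M (\<lambda>\<omega>. num_zeros (g \<omega>) UNIV)
           (real p powi \<lfloor>log (real p) (real d)\<rfloor> / (1 + 1 / real p)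
            + (\<Sum>\<^sub>\<infinity>m\<in>{1::nat..}. padic_norm (of_nat d :: 'p padic) / real p ^ m
                 * ((1 - 1 / real p) / (1 + 1 / real p))))
    \<and> real p powi \<lfloor>log (real p) (real d)\<rfloor> / (1 + 1 / real p)
           + (\<Sum>\<^sub>\<infinity>m\<in>{1::nat..}. padic_norm (of_nat d :: 'p padic) / real p ^ m
                * ((1 - 1 / real p) / (1 + 1 / real p)))
         = (real p powi \<lfloor>log (real p) (real d)\<rfloor> + padic_norm (of_nat d :: 'p padic) * (1 / real p))
             / (1 + 1 / real p)"
proof -
  interpret prob_space M by fact
  interpret R: random_binomial_polynomial M \<zeta> d
    using assms(2,4,5) by unfold_locales (auto intro: residue_uniform_if_uniform)
  have g: "R.g = g" unfolding g_def R.g_def[abs_def] ..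
  have q: "R.q = real p" unfolding R.q_def assms(1) ..
  have p: "1 < p" using prime_gt_1_nat[OF prime_card[where 'a='p]] assms(1) by simp
  obtain L where L: "p ^ L \<le> d" "d < p ^ Suc L"
    using ex_power_ivl1[of p d] p assms(2) by auto
  have log: "\<lfloor>log (real p) (real d)\<rfloor> = int L"
    using L p by (intro floor_log_nat_eq_if) auto
  let ?nd = "padic_norm (of_nat d :: 'p padic)"
  have inf: "(\<Sum>\<^sub>\<infinity>m\<in>{1::nat..}. ?nd / real p ^ m * ((1 - 1 / real p) / (1 + 1 / real p)))
      = ?nd * (1 / real p) / (1 + 1 / real p)"
    using p by (intro infsum_annuli) auto
  show ?thesis
    unfolding log inf
    using R.expected_zeros_integers[of L] R.expected_zeros_annulus R.expected_zeros[of L] L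
    unfolding g q assms(1)[symmetric] by (auto simp: add_divide_distrib)
qed

end
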